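(* Let $M$ and $N$ be homology cylinders over $\Sigma=\Sigma_{g,n}$, $n\ge1$. Then $\tilde\mu_q$ is a crossed homomorphism on $\mathcal H_{g,n}$ in the sense that each coordinate $\tilde\mu_q(-)_k$ satisfies $$\tilde\mu_q(M\cdot N)_k=\tilde\mu_q(M)_k\cdot\eta_q(M)(\tilde\mu_q(N)_k)$$ for $k=1,\dots,2g+n-1$.
   Context: For a group $G$: $G_1=G$, $G_{k+1}=[G,G_k]$. Manifolds are compact and oriented. $\Sigma=\Sigma_{g,n}$ is a connected surface of genus $g$ with $n\ge1$ boundary components $\partial_1,\dots,\partial_n$. Homology cylinders. A homology cylinder over $\Sigma$ is a 3-manifold $M$ with two embeddings $i_+,i_-\colon\Sigma\hookrightarrow\partial M$ (markings) such that $i_+|_{\partial\Sigma}=i_-|_{\partial\Sigma}$; $i_+\cup i_-\colon\Sigma\cup_\partial(-\Sigma)\to\partial M$ is an orientation-preserving homeomorphism; and $i_\pm$ induce isomorphisms $H_*(\Sigma;\mathbb Z)\to H_*(M;\mathbb Z)$. Product: $(M,i_+,i_-)\cdot(N,j_+,j_-)=(M\cup_{i_-\circ j_+^{-1}}N,\,i_+,\,j_-)$. Two homology cylinders $(M,i_\pm),(N,j_\pm)$ are homology cobordant if there is a 4-manifold $W$ with $\partial W=M\cup(-N)/\!\sim$, where $\sim$ identifies $i_+(x)$ with $j_+(x)$ and $i_-(x)$ with $j_-(x)$ for $x\in\Sigma$, such that $M\hookrightarrow W$, $N\hookrightarrow W$ induce isomorphisms on integral homology. $\mathcal H_{g,n}$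 is the group of homology cobordism classes under the product; $\tilde\mu_q$ and $\eta_q$ below are well-defined on it. Invariants. Fix a base point $*\in\partial_n$ and the standard free generating set $x_1,\dots,x_{n-1},m_1,\dots,m_g,l_1,\dots,l_g$ of $F=\pi_1(\Sigma,* )$, where $x_i$ is freely homotopic to $\partial_i$, $m_j,l_j$ are a meridian and longitude of the $j$th handle, and $[\partial_n]=\prod_i x_i\prod_j[m_j,l_j]$. Write $x_i=[\alpha_i\cdot\beta_i\cdot\alpha_i^{-1}]$ with $\beta_i$ a closed path parametrizing $\partial_i$ (homeomorphically on $I/\partial I$) and $\alpha_i$ a path from $*$ to $\beta_i(0)$. For a homology cylinder $M$ define in $\pi_1(M,i_+( * ))$: $\lambda_i=[(i_+\circ\alpha_i)\cdot(i_-\circ\alpha_i^{-1})]$ ($1\le i\le n-1$), $\lambda'_j=(i_+)_*(m_j)(i_-)_*(m_j^{-1})$, $\lambda''_j=(i_+)_*(l_j)(i_-)_*(l_j^{-1})$ ($1\le j\le g$). By Stallings' theorem $i_\pm$ induce isomorphisms $(i_\pm)_{*q}\colon F/F_q\to\pi_1(M)/\pi_1(M)_q$. $\tilde\mu_q(M)\in(F/F_q)^{2g+n-1}$ is the tuple of preimages under $(i_+)_{*q}$ of the classes of the $\lambda_i,\lambda_j',\lambda_j''$, with $k$th coordinate $\tilde\mu_q(M)_k$. $\eta_q(M)=(i_+)_{*q}^{-1}\circ(i_-)_{*q}\in\operatorname{Aut}(F/F_q)$. *)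

theory Defs
  imports "HOL-Homology.Homology" "HOL-Analysis.Analysis"
begin

section \<open>Compact oriented manifolds\<close>

definition half_space :: "nat \<Rightarrow> (nat \<Rightarrow> real) topology" where
  "half_space n = subtopology (Euclidean_space n) {x. 0 \<le> x 0}"

definition compact_manifold :: "nat \<Rightarrow> 'a topology \<Rightarrow> bool" where
  "compact_manifold n X \<longleftrightarrow>
     compact_space X \<and> Hausdorff_space X \<and> second_countable X \<and>
     (\<forall>x\<in>topspace X. \<exists>U V. openin X U \<and> x \<in> U \<and> openin (half_space n) V \<and>
        subtopology X U homeomorphic_space subtopology (half_space n) V)"

definition mfd_boundary :: "nat \<Rightarrow> 'a topology \<Rightarrow> 'a set" where
  "mfd_boundary n X = {x \<in> topspace X. \<not> (\<exists>U. openin X U \<and> x \<in> U \<and>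
     subtopology X U homeomorphic_space Euclidean_space n)}"

definition mfd_interior :: "nat \<Rightarrow> 'a topology \<Rightarrow> 'a set" where
  "mfd_interior n X = topspace X - mfd_boundary n X"

abbreviation boundary_space :: "nat \<Rightarrow> 'a topology \<Rightarrow> 'a topology" where
  "boundary_space n X \<equiv> subtopology X (mfd_boundary n X)"

text \<open>An orientation of a compact manifold is given by its fundamental class in
  \<open>H\<^sub>n(X, \<partial>X; \<int>)\<close>, i.e. a class restricting to a generator of the local homology group
  \<open>H\<^sub>n(X, X - x) \<cong> \<int>\<close> at every interior point \<open>x\<close>.  The induced orientation of \<open>\<partial>X\<close> is the
  image of this class under the connecting map, and reversing the orientation is inversion.\<close>

definition fundamental_class :: "nat \<Rightarrow> 'a topology \<Rightarrow> 'a chain set \<Rightarrow> bool" where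
  "fundamental_class n X a \<longleftrightarrow>
     a \<in> carrier (relative_homology_group (int n) X (mfd_boundary n X)) \<and>
     (\<forall>x\<in>mfd_interior n X.
        let L = relative_homology_group (int n) X (topspace X - {x}) in
        generate L {hom_induced (int n) X (mfd_boundary n X) X (topspace X - {x}) id a} = carrier L)"

definition oriented_manifold :: "nat \<Rightarrow> 'a topology \<Rightarrow> 'a chain set \<Rightarrow> bool" where
  "oriented_manifold n X a \<longleftrightarrow> compact_manifold n X \<and> fundamental_class n X a"

definition opposite_orientation :: "nat \<Rightarrow> 'a topology \<Rightarrow> 'a chain set \<Rightarrow> 'a chain set" where
  "opposite_orientation n X a = inv\<^bsub>relative_homology_group (int n) X (mfd_boundary n X)\<^esub> a"

definition boundary_orientation ::
    "nat \<Rightarrow> 'a topology \<Rightarrow> 'a chain set \<Rightarrow> 'a chain set" where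
  "boundary_orientation n X a = hom_boundary (int n) X (mfd_boundary n X) a"

definition homology_iso :: "'a topology \<Rightarrow> 'b topology \<Rightarrow> ('a \<Rightarrow> 'b) \<Rightarrow> bool" where
  "homology_iso X Y f \<longleftrightarrow> (\<forall>p::nat.
     hom_induced (int p) X {} Y {} f \<in> iso (homology_group (int p) X) (homology_group (int p) Y))"


section \<open>Gluing two spaces\<close>

text \<open>The quotient of the disjoint union of \<open>X\<close> and \<open>Y\<close> by the equivalence relation generated by
  \<open>x \<sim> y\<close> for \<open>(x, y) \<in> R\<close>; points are equivalence classes.\<close>

definition glue_equiv :: "('a \<times> 'b) set \<Rightarrow> (('a + 'b) \<times> ('a + 'b)) set" where
  "glue_equiv R = (let E = {(Inl x, Inr y) | x y. (x, y) \<in> R} in (E \<union> E\<inverse>)\<^sup>*)"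

definition glue_point :: "('a \<times> 'b) set \<Rightarrow> 'a + 'b \<Rightarrow> ('a + 'b) set" where
  "glue_point R p = glue_equiv R `` {p}"

definition glue_left :: "('a \<times> 'b) set \<Rightarrow> 'a \<Rightarrow> ('a + 'b) set" where
  "glue_left R x = glue_point R (Inl x)"

definition glue_right :: "('a \<times> 'b) set \<Rightarrow> 'b \<Rightarrow> ('a + 'b) set" where
  "glue_right R y = glue_point R (Inr y)"

definition glue :: "'a topology \<Rightarrow> 'b topology \<Rightarrow> ('a \<times> 'b) set \<Rightarrow> ('a + 'b) set topology" where
  "glue X Y R = topology (\<lambda>U.
     U \<subseteq> glue_left R ` topspace X \<union> glue_right R ` topspace Y \<and>
     openin X {x \<in> topspace X. glue_left R x \<in> U} \<and>
     openin Y {y \<in> topspace Y. glue_right R y \<in> U})"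

lemma openin_glue:
  "openin (glue X Y R) U \<longleftrightarrow>
     U \<subseteq> glue_left R ` topspace X \<union> glue_right R ` topspace Y \<and>
     openin X {x \<in> topspace X. glue_left R x \<in> U} \<and>
     openin Y {y \<in> topspace Y. glue_right R y \<in> U}"
proof -
  have inter: "{x \<in> topspace Z. f x \<in> S \<inter> T} = {x \<in> topspace Z. f x \<in> S} \<inter> {x \<in> topspace Z. f x \<in> T}"
    for Z :: "'z topology" and f :: "'z \<Rightarrow> ('a + 'b) set" and S T by auto
  have un: "{x \<in> topspace Z. f x \<in> \<Union>K} = \<Union>((\<lambda>S. {x \<in> topspace Z. f x \<in> S}) ` K)"
    for Z :: "'z topology" and f :: "'z \<Rightarrow> ('a + 'b) set" and K by auto
  have "istopology (\<lambda>U. U \<subseteq> glue_left R ` topspace X \<union> glue_right R ` topspace Y \<and>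
     openin X {x \<in> topspace X. glue_left R x \<in> U} \<and>
     openin Y {y \<in> topspace Y. glue_right R y \<in> U})"
    unfolding istopology_def
  proof (intro conjI allI impI)
    fix K assume K: "\<forall>U\<in>K. U \<subseteq> glue_left R ` topspace X \<union> glue_right R ` topspace Y \<and>
     openin X {x \<in> topspace X. glue_left R x \<in> U} \<and>
     openin Y {y \<in> topspace Y. glue_right R y \<in> U}"
    then show "\<Union>K \<subseteq> glue_left R ` topspace X \<union> glue_right R ` topspace Y" by blast
    show "openin X {x \<in> topspace X. glue_left R x \<in> \<Union>K}"
      unfolding un using K by (intro openin_Union) auto
    show "openin Y {y \<in> topspace Y. glue_right R y \<in> \<Union>K}"
      unfolding un using K by (intro openin_Union) auto
  qed (auto simp: inter simp del: Int_iff)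
  then show ?thesis
    unfolding glue_def by (simp add: topology_inverse')
qed

text \<open>The map out of \<open>glue X Y R\<close> determined by \<open>f\<close> and \<open>g\<close>; meaningful if \<open>f x = g y\<close> for
  all \<open>(x, y) \<in> R\<close>.\<close>

definition glue_map :: "('a \<Rightarrow> 'c) \<Rightarrow> ('b \<Rightarrow> 'c) \<Rightarrow> ('a + 'b) set \<Rightarrow> 'c" where
  "glue_map f g C = the_elem (case_sum f g ` C)"

text \<open>The orientation class \<open>c\<close> of \<open>glue X Y R\<close> restricts to the orientations \<open>a\<close> of \<open>X\<close> and
  \<open>b\<close> of \<open>Y\<close> at all interior points of the two pieces (\<open>R\<close> relates boundary points only).\<close>

definition glued_orientation ::
  "nat \<Rightarrow> 'a topology \<Rightarrow> 'a chain set \<Rightarrow> 'b topology \<Rightarrow> 'b chain set \<Rightarrow> ('a \<times> 'b) set \<Rightarrow>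
    ('a + 'b) set chain set \<Rightarrow> bool" where
  "glued_orientation n X a Y b R c \<longleftrightarrow>
     (let G = glue X Y R in
      fundamental_class n G c \<and>
      (\<forall>x\<in>mfd_interior n X.
         hom_induced (int n) G (mfd_boundary n G) G (topspace G - {glue_left R x}) id c =
         hom_induced (int n) X (mfd_boundary n X) G (topspace G - {glue_left R x}) (glue_left R) a) \<and>
      (\<forall>y\<in>mfd_interior n Y.
         hom_induced (int n) G (mfd_boundary n G) G (topspace G - {glue_right R y}) id c =
         hom_induced (int n) Y (mfd_boundary n Y) G (topspace G - {glue_right R y}) (glue_right R) b))"


section \<open>The fundamental group\<close>

text \<open>The library operations on paths require a type of class \<open>topological_space\<close>; the spaces
  here are abstract topologies.  Only the restriction of a path to \<open>[0, 1]\<close> matters.\<close>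

definition join_path :: "(real \<Rightarrow> 'a) \<Rightarrow> (real \<Rightarrow> 'a) \<Rightarrow> real \<Rightarrow> 'a" where
  "join_path p q = (\<lambda>t. if t \<le> 1/2 then p (2 * t) else q (2 * t - 1))"

definition reverse_path :: "(real \<Rightarrow> 'a) \<Rightarrow> real \<Rightarrow> 'a" where
  "reverse_path p = (\<lambda>t. p (1 - t))"

definition path_homotopic :: "'a topology \<Rightarrow> (real \<Rightarrow> 'a) \<Rightarrow> (real \<Rightarrow> 'a) \<Rightarrow> bool" where
  "path_homotopic X p q \<longleftrightarrow>
     homotopic_with (\<lambda>h. h 0 = p 0 \<and> h 1 = p 1) (top_of_set {0..1}) X p q"

definition path_class :: "'a topology \<Rightarrow> (real \<Rightarrow> 'a) \<Rightarrow> (real \<Rightarrow> 'a) set" where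
  "path_class X p = {q. path_homotopic X p q}"

definition path_between :: "'a topology \<Rightarrow> 'a \<Rightarrow> 'a \<Rightarrow> (real \<Rightarrow> 'a) \<Rightarrow> bool" where
  "path_between X x y p \<longleftrightarrow> pathin X p \<and> p 0 = x \<and> p 1 = y"

definition pi1 :: "'a topology \<Rightarrow> 'a \<Rightarrow> (real \<Rightarrow> 'a) set monoid" where
  "pi1 X x = \<lparr>carrier = path_class X ` {p. path_between X x x p},
             monoid.mult = (\<lambda>c d. \<Union>p\<in>c. \<Union>q\<in>d. path_class X (join_path p q)),
             monoid.one = path_class X (\<lambda>t. x)\<rparr>"

definition pi1_map :: "'b topology \<Rightarrow> ('a \<Rightarrow> 'b) \<Rightarrow> (real \<Rightarrow> 'a) set \<Rightarrow> (real \<Rightarrow> 'b) set" where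
  "pi1_map Y f c = (\<Union>p\<in>c. path_class Y (f \<circ> p))"


section \<open>Lower central series and free generators\<close>

definition comm_elt :: "('g, 'm) monoid_scheme \<Rightarrow> 'g \<Rightarrow> 'g \<Rightarrow> 'g" where
  "comm_elt G a b = a \<otimes>\<^bsub>G\<^esub> b \<otimes>\<^bsub>G\<^esub> inv\<^bsub>G\<^esub> a \<otimes>\<^bsub>G\<^esub> inv\<^bsub>G\<^esub> b"

text \<open>Indexed so that \<open>lcs G 1 = G\<close>; the value at \<open>0\<close> is irrelevant.\<close>

fun lcs :: "('g, 'm) monoid_scheme \<Rightarrow> nat \<Rightarrow> 'g set" where
  "lcs G 0 = carrier G"
| "lcs G (Suc 0) = carrier G"
| "lcs G (Suc (Suc k)) = generate G {comm_elt G a b | a b. a \<in> carrier G \<and> b \<in> lcs G (Suc k)}"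

abbreviation nil_quot :: "('g, 'm) monoid_scheme \<Rightarrow> nat \<Rightarrow> 'g set monoid" where
  "nil_quot G q \<equiv> G Mod lcs G q"

text \<open>The map \<open>G/G\<^sub>q \<rightarrow> H/H\<^sub>q\<close> induced by \<open>f : G \<rightarrow> H\<close>, sending the coset \<open>C = G\<^sub>q x\<close> to the coset
  \<open>H\<^sub>q f(C) = H\<^sub>q f(x)\<close>.\<close>

definition nil_quot_map :: "('h, 'm) monoid_scheme \<Rightarrow> nat \<Rightarrow> ('g \<Rightarrow> 'h) \<Rightarrow> 'g set \<Rightarrow> 'h set" where
  "nil_quot_map H q f C = lcs H q <#>\<^bsub>H\<^esub> (f ` C)"

definition word_value :: "('g, 'm) monoid_scheme \<Rightarrow> ('i \<Rightarrow> 'g) \<Rightarrow> ('i \<times> bool) list \<Rightarrow> 'g" where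
  "word_value G a w =
     foldr (\<lambda>(i, b) y. (if b then a i else inv\<^bsub>G\<^esub> (a i)) \<otimes>\<^bsub>G\<^esub> y) w \<one>\<^bsub>G\<^esub>"

definition reduced_word :: "('i \<times> bool) list \<Rightarrow> bool" where
  "reduced_word w \<longleftrightarrow> successively (\<lambda>(i, b) (j, c). \<not> (i = j \<and> b \<noteq> c)) w"

definition freely_generated_by :: "('g, 'm) monoid_scheme \<Rightarrow> ('i \<Rightarrow> 'g) \<Rightarrow> 'i set \<Rightarrow> bool" where
  "freely_generated_by G a I \<longleftrightarrow>
     a ` I \<subseteq> carrier G \<and> generate G (a ` I) = carrier G \<and>
     (\<forall>w. fst ` set w \<subseteq> I \<and> reduced_word w \<and> w \<noteq> [] \<longrightarrow> word_value G a w \<noteq> \<one>\<^bsub>G\<^esub>)"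

definition list_prod :: "('g, 'm) monoid_scheme \<Rightarrow> 'g list \<Rightarrow> 'g" where
  "list_prod G xs = foldr (monoid.mult G) xs \<one>\<^bsub>G\<^esub>"


section \<open>The surface and its standard generators\<close>

text \<open>The genus of a compact connected oriented surface is the maximal number of pairwise disjoint
  simple closed curves in its interior whose union does not separate it.\<close>

definition nonseparating_system :: "'s topology \<Rightarrow> 's set set \<Rightarrow> bool" where
  "nonseparating_system X \<C> \<longleftrightarrow>
     finite \<C> \<and> disjoint \<C> \<and>
     (\<forall>C\<in>\<C>. C \<subseteq> mfd_interior 2 X \<and>
        subtopology X C homeomorphic_space top_of_set (sphere (0::complex) 1)) \<and>
     connectedin X (topspace X - \<Union>\<C>)"

definition has_genus :: "'s topology \<Rightarrow> nat \<Rightarrow> bool" where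
  "has_genus X g \<longleftrightarrow> (\<exists>\<C>. nonseparating_system X \<C> \<and> card \<C> = g) \<and>
     (\<forall>\<C>. nonseparating_system X \<C> \<longrightarrow> card \<C> \<le> g)"

text \<open>A torus \<open>S\<^sup>1 \<times> S\<^sup>1\<close> minus an open disc, with meridian \<open>S\<^sup>1 \<times> 1\<close> and longitude \<open>1 \<times> S\<^sup>1\<close>.\<close>

definition one_holed_torus :: "(complex \<times> complex) set" where
  "one_holed_torus = {(z, w). cmod z = 1 \<and> cmod w = 1 \<and> (0 \<le> Re z \<or> 0 \<le> Re w)}"

definition torus_meridian :: "real \<Rightarrow> complex \<times> complex" where
  "torus_meridian t = (cis (2 * pi * t), 1)"

definition torus_longitude :: "real \<Rightarrow> complex \<times> complex" where
  "torus_longitude t = (1, cis (2 * pi * t))"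

text \<open>A closed path inducing a homeomorphism of \<open>I/\<partial>I\<close> onto \<open>C\<close> (for Hausdorff \<open>X\<close>).\<close>

definition parametrizes :: "'s topology \<Rightarrow> (real \<Rightarrow> 's) \<Rightarrow> 's set \<Rightarrow> bool" where
  "parametrizes X p C \<longleftrightarrow> pathin X p \<and> p 0 = p 1 \<and> inj_on p {0..<1} \<and> p ` {0..1} = C"

text \<open>A surface with its orientation class, base point, boundary components \<open>\<partial>\<^sub>1, \<dots>, \<partial>\<^sub>n\<close>, the
  paths \<open>\<alpha>\<^sub>i\<close>, \<open>\<beta>\<^sub>i\<close> and the elements \<open>m\<^sub>j\<close>, \<open>l\<^sub>j\<close> of its fundamental group.\<close>

record 's marked_surface =
  surf :: "'s topology"
  surf_class :: "'s chain set"
  basept :: 's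
  bdry_comp :: "nat \<Rightarrow> 's set"
  alpha :: "nat \<Rightarrow> real \<Rightarrow> 's"
  beta :: "nat \<Rightarrow> real \<Rightarrow> 's"
  mer :: "nat \<Rightarrow> (real \<Rightarrow> 's) set"
  lon :: "nat \<Rightarrow> (real \<Rightarrow> 's) set"

definition FS :: "'s marked_surface \<Rightarrow> (real \<Rightarrow> 's) set monoid" where
  "FS S = pi1 (surf S) (basept S)"

definition bdry_gen :: "'s marked_surface \<Rightarrow> nat \<Rightarrow> (real \<Rightarrow> 's) set" where
  "bdry_gen S i =
     path_class (surf S) (join_path (alpha S i) (join_path (beta S i) (reverse_path (alpha S i))))"

text \<open>\<open>x\<^sub>1, \<dots>, x\<^bsub>n-1\<^esub>, m\<^sub>1, \<dots>, m\<^sub>g, l\<^sub>1, \<dots>, l\<^sub>g\<close> in this order, indexed from 1.\<close>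

definition std_gen :: "nat \<Rightarrow> nat \<Rightarrow> 's marked_surface \<Rightarrow> nat \<Rightarrow> (real \<Rightarrow> 's) set" where
  "std_gen g n S k =
     (if k \<le> n - 1 then bdry_gen S k
      else if k \<le> n - 1 + g then mer S (k - (n - 1))
      else lon S (k - (n - 1 + g)))"

definition meridians_longitudes :: "nat \<Rightarrow> 's marked_surface \<Rightarrow> bool" where
  "meridians_longitudes g S \<longleftrightarrow>
     (\<exists>h \<gamma>. (\<forall>j\<in>{1..g}.
          embedding_map (top_of_set one_holed_torus) (surf S) (h j) \<and>
          path_between (surf S) (basept S) (h j (1, 1)) (\<gamma> j) \<and>
          mer S j = path_class (surf S)
            (join_path (\<gamma> j) (join_path (h j \<circ> torus_meridian) (reverse_path (\<gamma> j)))) \<and>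
          lon S j = path_class (surf S)
            (join_path (\<gamma> j) (join_path (h j \<circ> torus_longitude) (reverse_path (\<gamma> j))))) \<and>
        disjoint_family_on (\<lambda>j. h j ` one_holed_torus) {1..g})"

definition standard_surface :: "nat \<Rightarrow> nat \<Rightarrow> 's marked_surface \<Rightarrow> bool" where
  "standard_surface g n S \<longleftrightarrow>
     oriented_manifold 2 (surf S) (surf_class S) \<and> connected_space (surf S) \<and>
     has_genus (surf S) g \<and>
     bij_betw (bdry_comp S) {1..n} (connected_components_of (boundary_space 2 (surf S))) \<and>
     basept S \<in> bdry_comp S n \<and>
     (\<forall>i\<in>{1..n - 1}. parametrizes (surf S) (beta S i) (bdry_comp S i) \<and>
        path_between (surf S) (basept S) (beta S i 0) (alpha S i)) \<and>
     meridians_longitudes g S \<and>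
     freely_generated_by (FS S) (std_gen g n S) {1..2 * g + n - 1} \<and>
     (\<exists>\<delta>. parametrizes (surf S) \<delta> (bdry_comp S n) \<and> \<delta> 0 = basept S \<and>
        path_class (surf S) \<delta> =
          list_prod (FS S) (map (bdry_gen S) [1..<n]) \<otimes>\<^bsub>FS S\<^esub>
          list_prod (FS S) (map (\<lambda>j. comm_elt (FS S) (mer S j) (lon S j)) [1..<Suc g]))"


section \<open>Homology cylinders\<close>

record ('s, 'a) cylinder =
  mfd :: "'a topology"
  mfd_class :: "'a chain set"
  mk_plus :: "'s \<Rightarrow> 'a"
  mk_minus :: "'s \<Rightarrow> 'a"

text \<open>The double \<open>\<Sigma> \<union>\<^sub>\<partial> (-\<Sigma>)\<close> glues two copies of \<open>\<Sigma>\<close> along \<open>\<partial>\<Sigma>\<close>.\<close>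

definition double_rel :: "'s marked_surface \<Rightarrow> ('s \<times> 's) set" where
  "double_rel S = Id_on (mfd_boundary 2 (surf S))"

definition homology_cylinder :: "'s marked_surface \<Rightarrow> ('s, 'a) cylinder \<Rightarrow> bool" where
  "homology_cylinder S M \<longleftrightarrow>
     oriented_manifold 3 (mfd M) (mfd_class M) \<and>
     embedding_map (surf S) (boundary_space 3 (mfd M)) (mk_plus M) \<and>
     embedding_map (surf S) (boundary_space 3 (mfd M)) (mk_minus M) \<and>
     (\<forall>s\<in>mfd_boundary 2 (surf S). mk_plus M s = mk_minus M s) \<and>
     homeomorphic_map (glue (surf S) (surf S) (double_rel S)) (boundary_space 3 (mfd M))
       (glue_map (mk_plus M) (mk_minus M)) \<and>
     (\<exists>c. glued_orientation 2 (surf S) (surf_class S)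
            (surf S) (opposite_orientation 2 (surf S) (surf_class S)) (double_rel S) c \<and>
          hom_induced 2 (glue (surf S) (surf S) (double_rel S)) {} (boundary_space 3 (mfd M)) {}
            (glue_map (mk_plus M) (mk_minus M)) c =
          boundary_orientation 3 (mfd M) (mfd_class M)) \<and>
     homology_iso (surf S) (mfd M) (mk_plus M) \<and>
     homology_iso (surf S) (mfd M) (mk_minus M)"

text \<open>Graph of \<open>j\<^sub>+ \<circ> i\<^sub>-\<inverse>\<close>, identifying \<open>i\<^sub>-(s) \<in> M\<close> with \<open>j\<^sub>+(s) \<in> N\<close>.\<close>

definition prod_rel ::
    "'s marked_surface \<Rightarrow> ('s, 'a) cylinder \<Rightarrow> ('s, 'b) cylinder \<Rightarrow> ('a \<times> 'b) set" where
  "prod_rel S M N = {(mk_minus M s, mk_plus N s) | s. s \<in> topspace (surf S)}"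

definition cyl_prod ::
    "'s marked_surface \<Rightarrow> ('s, 'a) cylinder \<Rightarrow> ('s, 'b) cylinder \<Rightarrow> ('s, ('a + 'b) set) cylinder" where
  "cyl_prod S M N =
     (let R = prod_rel S M N in
      \<lparr>mfd = glue (mfd M) (mfd N) R,
       mfd_class = (SOME c. glued_orientation 3 (mfd M) (mfd_class M) (mfd N) (mfd_class N) R c),
       mk_plus = glue_left R \<circ> mk_plus M,
       mk_minus = glue_right R \<circ> mk_minus N\<rparr>)"

definition cob_rel ::
    "'s marked_surface \<Rightarrow> ('s, 'a) cylinder \<Rightarrow> ('s, 'b) cylinder \<Rightarrow> ('a \<times> 'b) set" where
  "cob_rel S M N = {(mk_plus M s, mk_plus N s) | s. s \<in> topspace (surf S)} \<union>
                   {(mk_minus M s, mk_minus N s) | s. s \<in> topspace (surf S)}"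

text \<open>\<open>e\<close> identifies \<open>M \<union> (-N)/\<sim>\<close> with \<open>\<partial>W\<close>.  Every compact manifold is homeomorphic to a subspace
  of some \<open>\<real>\<^sup>k\<close>, hence to a topology on a subset of the type \<open>nat \<Rightarrow> real\<close>, so taking \<open>W\<close> on that
  type is no restriction.\<close>

definition homology_cobordant ::
    "'s marked_surface \<Rightarrow> ('s, 'a) cylinder \<Rightarrow> ('s, 'b) cylinder \<Rightarrow> bool" where
  "homology_cobordant S M N \<longleftrightarrow>
     (\<exists>(W :: (nat \<Rightarrow> real) topology) w e c.
        (let R = cob_rel S M N; G = glue (mfd M) (mfd N) R in
         oriented_manifold 4 W w \<and>
         homeomorphic_map G (boundary_space 4 W) e \<and>
         glued_orientation 3 (mfd M) (mfd_class M)
           (mfd N) (opposite_orientation 3 (mfd N) (mfd_class N)) R c \<and>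
         hom_induced 3 G {} (boundary_space 4 W) {} e c = boundary_orientation 4 W w \<and>
         homology_iso (mfd M) W (e \<circ> glue_left R) \<and>
         homology_iso (mfd N) W (e \<circ> glue_right R)))"

text \<open>The elements of \<open>\<H>\<^bsub>g,n\<^esub>\<close>, as classes of homology cylinders with points in \<open>nat \<Rightarrow> real\<close>
  (again no restriction up to homeomorphism).  The product of two classes is the class of
  the homology cylinders on that type cobordant to a product of representatives.\<close>

definition hcob_classes :: "'s marked_surface \<Rightarrow> ('s, nat \<Rightarrow> real) cylinder set set" where
  "hcob_classes S = {M. homology_cylinder S M} //
     {(M, N). homology_cylinder S M \<and> homology_cylinder S N \<and> homology_cobordant S M N}"

definition hcob_mult :: "'s marked_surface \<Rightarrow> ('s, nat \<Rightarrow> real) cylinder set \<Rightarrow>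
    ('s, nat \<Rightarrow> real) cylinder set \<Rightarrow> ('s, nat \<Rightarrow> real) cylinder set" where
  "hcob_mult S c d = {P. homology_cylinder S P \<and>
     (\<exists>M\<in>c. \<exists>N\<in>d. homology_cobordant S (cyl_prod S M N) P)}"


section \<open>The invariants\<close>

definition FM :: "'s marked_surface \<Rightarrow> ('s, 'a) cylinder \<Rightarrow> (real \<Rightarrow> 'a) set monoid" where
  "FM S M = pi1 (mfd M) (mk_plus M (basept S))"

definition plus_q ::
    "'s marked_surface \<Rightarrow> nat \<Rightarrow> ('s, 'a) cylinder \<Rightarrow> (real \<Rightarrow> 's) set set \<Rightarrow> (real \<Rightarrow> 'a) set set" where
  "plus_q S q M = nil_quot_map (FM S M) q (pi1_map (mfd M) (mk_plus M))"

definition minus_q ::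
    "'s marked_surface \<Rightarrow> nat \<Rightarrow> ('s, 'a) cylinder \<Rightarrow> (real \<Rightarrow> 's) set set \<Rightarrow> (real \<Rightarrow> 'a) set set" where
  "minus_q S q M = nil_quot_map (FM S M) q (pi1_map (mfd M) (mk_minus M))"

definition bdry_longitude :: "'s marked_surface \<Rightarrow> ('s, 'a) cylinder \<Rightarrow> nat \<Rightarrow> (real \<Rightarrow> 'a) set" where
  "bdry_longitude S M i = path_class (mfd M)
     (join_path (mk_plus M \<circ> alpha S i) (mk_minus M \<circ> reverse_path (alpha S i)))"

definition difference_loop ::
    "'s marked_surface \<Rightarrow> ('s, 'a) cylinder \<Rightarrow> (real \<Rightarrow> 's) set \<Rightarrow> (real \<Rightarrow> 'a) set" where
  "difference_loop S M x = pi1_map (mfd M) (mk_plus M) x \<otimes>\<^bsub>FM S M\<^esub>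
     pi1_map (mfd M) (mk_minus M) (inv\<^bsub>FS S\<^esub> x)"

text \<open>\<open>\<lambda>\<^sub>1, \<dots>, \<lambda>\<^bsub>n-1\<^esub>, \<lambda>'\<^sub>1, \<dots>, \<lambda>'\<^sub>g, \<lambda>''\<^sub>1, \<dots>, \<lambda>''\<^sub>g\<close> in this order, indexed from 1.\<close>

definition all_longitudes ::
    "nat \<Rightarrow> nat \<Rightarrow> 's marked_surface \<Rightarrow> ('s, 'a) cylinder \<Rightarrow> nat \<Rightarrow> (real \<Rightarrow> 'a) set" where
  "all_longitudes g n S M k =
     (if k \<le> n - 1 then bdry_longitude S M k
      else if k \<le> n - 1 + g then difference_loop S M (mer S (k - (n - 1)))
      else difference_loop S M (lon S (k - (n - 1 + g))))"

definition mu :: "nat \<Rightarrow> nat \<Rightarrow> 's marked_surface \<Rightarrow> nat \<Rightarrow> ('s, 'a) cylinder \<Rightarrow> nat \<Rightarrow>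
    (real \<Rightarrow> 's) set set" where
  "mu g n S q M k = inv_into (carrier (nil_quot (FS S) q)) (plus_q S q M)
     (lcs (FM S M) q #>\<^bsub>FM S M\<^esub> all_longitudes g n S M k)"

definition eta :: "'s marked_surface \<Rightarrow> nat \<Rightarrow> ('s, 'a) cylinder \<Rightarrow>
    (real \<Rightarrow> 's) set set \<Rightarrow> (real \<Rightarrow> 's) set set" where
  "eta S q M = inv_into (carrier (nil_quot (FS S) q)) (plus_q S q M) \<circ> minus_q S q M"

end

theory Submission
  imports Defs
begin

text \<open>Stallings' theorem is proved without classifying spaces.  A homomorphism \<open>\<pi>\<^sub>1(X) \<rightarrow> \<Gamma>\<close> covering
  \<open>\<pi>\<^sub>1(Y) \<rightarrow> Q\<close> along a central extension \<open>\<Gamma> \<rightarrow> Q\<close> is extended over a homology isomorphism \<open>X \<rightarrow> Y\<close>: the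
  obstruction is a singular 2-cocycle on \<open>Y\<close> with a given primitive on \<open>X\<close>, hence a coboundary.
  Iterating over the central extensions \<open>G/G\<^sub>k\<^sub>+\<^sub>1 \<rightarrow> G/G\<^sub>k\<close> shows that every homomorphism from \<open>\<pi>\<^sub>1(X)\<close> to a
  nilpotent quotient \<open>G/G\<^sub>q\<close> extends to \<open>\<pi>\<^sub>1(Y)\<close>; surjectivity modulo \<open>G\<^sub>q\<close> follows from surjectivity on \<open>H\<^sub>1\<close>.

  In \<open>\<pi>\<^sub>1(M \<cdot> N)\<close> a longitude of the product is the product of the longitudes of \<open>M\<close> and \<open>N\<close>, and
  \<open>i\<^sub>- = j\<^sub>+\<close> there, so \<open>\<mu>(M) \<eta>(M)(\<mu>(N))\<close> is a preimage of it under the plus marking.  That marking is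
  injective modulo \<open>G\<^sub>q\<close> without using that \<open>M \<cdot> N\<close> is a homology cylinder: \<open>\<pi>\<^sub>1(M \<cdot> N)\<close> maps to
  \<open>\<pi>\<^sub>1(M) / \<pi>\<^sub>1(M)\<^sub>q\<close>, extending the quotient map of \<open>\<pi>\<^sub>1(M)\<close>, by glueing two homomorphisms of fundamental
  groupoids along \<open>\<Sigma>\<close>.  For cobordant cylinders the invariants are compared in \<open>\<pi>\<^sub>1\<close> of the cobordism.\<close>

section \<open>Paths and the fundamental group\<close>

text \<open>The first half of the claim concerns \<open>cyl_prod\<close> itself, where
  \<open>mu\<close> is an \<open>inv_into\<close> of \<open>plus_q\<close>: a preimage of the
  longitude determines it only once \<open>plus_q\<close> of the product is known to be injective.
  This forces a construction on the glued space. The two pieces are closed there, not open, so the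
  two homomorphisms are encoded as a principal covering of the glued space, described by local
  primitives, and the wanted homomorphism is its monodromy. Homomorphisms are handled as functions
  on all paths, not only on loops. On 1-simplices such a function is a multiplicative cocycle, which
  ties fundamental groups to singular chains, and along the common surface two such functions can be
  compared path by path. The price is that homomorphisms agreeing on loops agree on paths only up to
  a choice at each point; base paths are therefore corrected or chosen compatibly. Extending the
  quotient map \<open>G -> G/G_q\<close> gives injectivity modulo \<open>G_q\<close>, because
  homomorphisms respect the lower central series and the term \<open>(G/G_q)_q\<close> is
  trivial.\<close>

abbreviation real_seqs :: "(nat \<Rightarrow> real) topology" where
  "real_seqs \<equiv> powertop_real UNIV"

abbreviation unit_interval :: "real topology" where
  "unit_interval \<equiv> top_of_set {0..1}"

abbreviation unit_square :: "(real \<times> real) topology" where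
  "unit_square \<equiv> prod_topology unit_interval unit_interval"

text \<open>Standard simplices and half-space charts both live in
  \<open>nat \<Rightarrow> real\<close> with the product topology; one notion of convexity gives the
  straight-line homotopies in both.\<close>

definition convex_seqs :: "(nat \<Rightarrow> real) set \<Rightarrow> bool" where
  "convex_seqs K \<longleftrightarrow> (\<forall>x\<in>K. \<forall>y\<in>K. \<forall>u\<in>{0..1}. (\<lambda>i. (1 - u) * x i + u * y i) \<in> K)"

lemma reverse_path_ends [simp]: "reverse_path p 0 = p 1" "reverse_path p 1 = p 0"
  by (simp_all add: reverse_path_def)

lemma reverse_reverse_path [simp]: "reverse_path (reverse_path p) = p"
  by (simp add: reverse_path_def)

lemma join_path_ends [simp]: "join_path p q 0 = p 0" "join_path p q 1 = q 1"
  by (simp_all add: join_path_def)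

lemma comp_join_path: "f \<circ> join_path p q = join_path (f \<circ> p) (f \<circ> q)"
  by (auto simp: join_path_def)

lemma comp_reverse_path: "f \<circ> reverse_path p = reverse_path (f \<circ> p)"
  by (auto simp: reverse_path_def)

lemma path_homotopicI:
  assumes h: "continuous_map unit_square X h"
    and "\<And>t. t \<in> {0..1} \<Longrightarrow> h (0, t) = p t" "\<And>t. t \<in> {0..1} \<Longrightarrow> h (1, t) = q t"
    and "\<And>s. s \<in> {0..1} \<Longrightarrow> h (s, 0) = p 0" "\<And>s. s \<in> {0..1} \<Longrightarrow> h (s, 1) = p 1"
  shows "path_homotopic X p q"
  unfolding path_homotopic_def
  by (subst homotopic_with) (use assms in auto)

lemma path_homotopicE:
  assumes "path_homotopic X p q"
  obtains h where "continuous_map unit_square X h"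
    "\<And>t. h (0, t) = p t" "\<And>t. h (1, t) = q t"
    "\<And>s. s \<in> {0..1} \<Longrightarrow> h (s, 0) = p 0" "\<And>s. s \<in> {0..1} \<Longrightarrow> h (s, 1) = p 1"
proof -
  obtain h where "continuous_map unit_square X h"
    "\<forall>t. h (0, t) = p t" "\<forall>t. h (1, t) = q t"
    "\<forall>s\<in>{0..1}. h (s, 0) = p 0 \<and> h (s, 1) = p 1"
    using assms unfolding path_homotopic_def homotopic_with_def by (elim exE conjE) simp
  then show ?thesis using that[of h] by simp
qed

lemma path_homotopic_refl: "pathin X p \<Longrightarrow> path_homotopic X p p"
  by (simp add: path_homotopic_def pathin_def)

lemma path_homotopic_ends:
  assumes "path_homotopic X p q" shows "q 0 = p 0" "q 1 = p 1"
  using homotopic_with_imp_property[OF assms[unfolded path_homotopic_def]] by simp_all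

lemma path_homotopic_pathin:
  assumes "path_homotopic X p q" shows "pathin X p" "pathin X q"
  using homotopic_with_imp_continuous_maps[OF assms[unfolded path_homotopic_def]]
  by (simp_all add: pathin_def)

lemma path_homotopic_sym: "path_homotopic X p q \<Longrightarrow> path_homotopic X q p"
  using path_homotopic_ends[of X p q] by (simp add: path_homotopic_def homotopic_with_sym)

lemma path_homotopic_trans [trans]:
  "path_homotopic X p q \<Longrightarrow> path_homotopic X q r \<Longrightarrow> path_homotopic X p r"
  using path_homotopic_ends[of X p q] homotopic_with_trans[of _ _ X p q r]
  by (simp add: path_homotopic_def)

lemma path_homotopic_eq:
  "pathin X p \<Longrightarrow> (\<And>t. t \<in> {0..1} \<Longrightarrow> p t = q t) \<Longrightarrow> path_homotopic X p q"
  unfolding path_homotopic_def pathin_def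
  by (rule homotopic_with_equal) auto

lemma path_homotopic_image:
  assumes "path_homotopic X p q" "continuous_map X Y f"
  shows "path_homotopic Y (f \<circ> p) (f \<circ> q)"
  unfolding path_homotopic_def
  by (rule homotopic_with_compose_continuous_map_left[OF assms(1)[unfolded path_homotopic_def] assms(2)])
    simp

section \<open>Homotopies from convexity and reparametrisation\<close>

lemma pathin_seqs:
  "pathin real_seqs p \<longleftrightarrow> (\<forall>i. continuous_on {0..1} (\<lambda>t. p t i))"
  by (simp add: pathin_def continuous_map_componentwise_UNIV)

text \<open>The straight-line homotopy from \<open>p\<close> to \<open>q\<close> stays in
  \<open>K\<close> and is carried to \<open>X\<close> by \<open>f\<close>. It serves for
  reparametrisations, for the edges of a triangle and for charts of manifolds.\<close>

lemma path_homotopic_convex: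
  assumes f: "continuous_map (subtopology real_seqs K) X f" and K: "convex_seqs K"
    and p: "pathin (subtopology real_seqs K) p" and q: "pathin (subtopology real_seqs K) q"
    and "p 0 = q 0" "p 1 = q 1"
  shows "path_homotopic X (f \<circ> p) (f \<circ> q)"
proof -
  define k where "k = (\<lambda>(s, t) i. (1 - s) * p t i + s * q t i)"
  have cp: "continuous_on {0..1} (\<lambda>t. p t i)" "continuous_on {0..1} (\<lambda>t. q t i)" for i
    using p q by (auto simp: pathin_subtopology pathin_seqs)
  have "continuous_on ({0..1} \<times> {0..1}) (\<lambda>x. k x i)" for i
    unfolding k_def split_def
    by (intro continuous_intros continuous_on_compose2[OF cp(1)] continuous_on_compose2[OF cp(2)]) auto
  then have "continuous_map (top_of_set ({0..1} \<times> {0..1})) real_seqs k"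
    by (simp add: continuous_map_componentwise_UNIV)
  moreover have "k x \<in> K" if "x \<in> {0..1} \<times> {0..1}" for x
    using that K p q by (auto simp: k_def convex_seqs_def pathin_subtopology)
  ultimately have "continuous_map (top_of_set ({0..1} \<times> {0..1})) (subtopology real_seqs K) k"
    by (auto simp: continuous_map_in_subtopology)
  then have "continuous_map unit_square (subtopology real_seqs K) k"
    by simp
  then have "continuous_map unit_square X (f \<circ> k)"
    using f continuous_map_compose by blast
  then show ?thesis
  proof (rule path_homotopicI)
    have "k (s, 0) = p 0" "k (s, 1) = p 1" for s
      using assms by (auto simp: k_def algebra_simps)
    then show "(f \<circ> k) (s, 0) = (f \<circ> p) 0" "(f \<circ> k) (s, 1) = (f \<circ> p) 1" for s
      by simp_all
  qed (auto simp: k_def)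
qed

lemma path_homotopic_reparam:
  assumes p: "pathin X p" and "continuous_on {0..1} u" "continuous_on {0..1} v"
    and "u ` {0..1} \<subseteq> {0..1}" "v ` {0..1} \<subseteq> {0..1}" "u 0 = v 0" "u 1 = v 1"
  shows "path_homotopic X (p \<circ> u) (p \<circ> v)"
proof -
  \<comment> \<open>Parameters are stored as constant sequences, so that \<open>u\<close> and
    \<open>v\<close> become two paths in the convex set \<open>?K\<close>, on which \<open>p\<close>
    is read off from coordinate 0.\<close>
  let ?e = "\<lambda>t::real. \<lambda>i::nat. t"
  let ?K = "{x::nat \<Rightarrow> real. x 0 \<in> {0..1}}"
  have "continuous_map real_seqs euclideanreal (\<lambda>x. x 0)"
    by (rule continuous_map_product_projection) simp
  then have "continuous_map (subtopology real_seqs ?K) unit_interval (\<lambda>x. x 0)"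
    by (auto simp: continuous_map_in_subtopology continuous_map_from_subtopology)
  then have "continuous_map (subtopology real_seqs ?K) X (p \<circ> (\<lambda>x. x 0))"
    using p continuous_map_compose unfolding pathin_def by blast
  moreover have "convex_seqs ?K"
    by (auto simp: convex_seqs_def convex_bound_le)
  moreover have "pathin (subtopology real_seqs ?K) (?e \<circ> w)"
    if "continuous_on {0..1} w" "w ` {0..1} \<subseteq> {0..1}" for w
    using that by (auto simp: pathin_subtopology pathin_seqs image_subset_iff)
  ultimately have "path_homotopic X ((p \<circ> (\<lambda>x. x 0)) \<circ> (?e \<circ> u)) ((p \<circ> (\<lambda>x. x 0)) \<circ> (?e \<circ> v))"
    by (intro path_homotopic_convex[of ?K]) (use assms in auto)
  then show ?thesis by (simp add: o_def)
qed

lemma pathin_reparam: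
  assumes "pathin X p" "continuous_on {0..1} u" "u ` {0..1} \<subseteq> {0..1}"
  shows "pathin X (p \<circ> u)"
proof -
  have "continuous_map unit_interval unit_interval u"
    using assms by (auto simp: continuous_map_in_subtopology)
  then show ?thesis
    using assms(1) continuous_map_compose unfolding pathin_def by blast
qed

lemma pathin_join:
  assumes "pathin X p" "pathin X q" "p 1 = q 0"
  shows "pathin X (join_path p q)"
  unfolding pathin_def join_path_def
proof (rule continuous_map_cases_le)
  have "continuous_map (top_of_set {0..1/2}) unit_interval (\<lambda>t. 2 * t)"
    "continuous_map (top_of_set {1/2..1}) unit_interval (\<lambda>t. 2 * t - 1)"
    by (auto simp: continuous_map_in_subtopology intro!: continuous_intros)
  from this[THEN continuous_map_compose] assms
  have "continuous_map (top_of_set {0..1/2}) X (p \<circ> (\<lambda>t. 2 * t))"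
    "continuous_map (top_of_set {1/2..1}) X (q \<circ> (\<lambda>t. 2 * t - 1))"
    by (auto simp: pathin_def)
  moreover have "{0..1} \<inter> {t. 0 \<le> t \<and> t \<le> 1 \<and> t * 2 \<le> 1} = {0..1/2::real}"
    "{0..1} \<inter> {t. 0 \<le> t \<and> t \<le> 1 \<and> 1 \<le> t * 2} = {1/2..1::real}"
    by auto
  ultimately show "continuous_map (subtopology unit_interval {t \<in> topspace unit_interval. t \<le> 1/2}) X (\<lambda>t. p (2 * t))"
    "continuous_map (subtopology unit_interval {t \<in> topspace unit_interval. 1/2 \<le> t}) X (\<lambda>t. q (2 * t - 1))"
    by (simp_all add: subtopology_subtopology o_def)
  show "p (2 * t) = q (2 * t - 1)" if "t = 1/2" for t
    unfolding that using assms(3) by simp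
qed auto

lemma pathin_reverse: "pathin X p \<Longrightarrow> pathin X (reverse_path p)"
  using pathin_reparam[of X p "\<lambda>t. 1 - t"]
  by (simp add: reverse_path_def o_def continuous_on_diff image_subset_iff)

lemma path_homotopic_join:
  assumes "path_homotopic X p p'" "path_homotopic X q q'" "p 1 = q 0"
  shows "path_homotopic X (join_path p q) (join_path p' q')"
proof -
  obtain h where h: "continuous_map unit_square X h"
    "\<And>t. h (0, t) = p t" "\<And>t. h (1, t) = p' t"
    "\<And>s. s \<in> {0..1} \<Longrightarrow> h (s, 0) = p 0" "\<And>s. s \<in> {0..1} \<Longrightarrow> h (s, 1) = p 1"
    by (rule path_homotopicE[OF assms(1)]) (rule that; assumption)
  obtain k where k: "continuous_map unit_square X k"
    "\<And>t. k (0, t) = q t" "\<And>t. k (1, t) = q' t"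
    "\<And>s. s \<in> {0..1} \<Longrightarrow> k (s, 0) = q 0" "\<And>s. s \<in> {0..1} \<Longrightarrow> k (s, 1) = q 1"
    by (rule path_homotopicE[OF assms(2)]) (rule that; assumption)
  let ?l = "\<lambda>x. if snd x \<le> 1/2 then (h \<circ> (\<lambda>(s, t). (s, 2 * t))) x
                  else (k \<circ> (\<lambda>(s, t). (s, 2 * t - 1))) x"
  have "continuous_map unit_square X ?l"
  proof (rule continuous_map_cases_le)
    show "continuous_map unit_square euclideanreal snd"
      by (auto intro!: continuous_intros)
    have "continuous_map (top_of_set ({0..1} \<times> {0..1/2})) unit_square
        (\<lambda>(s, t). (s, 2 * t))"
      "continuous_map (top_of_set ({0..1} \<times> {1/2..1})) unit_square
        (\<lambda>(s, t). (s, 2 * t - 1))"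
      by (auto simp: continuous_map_in_subtopology split_def intro!: continuous_intros)
    note this(1)[THEN continuous_map_compose, OF h(1)] this(2)[THEN continuous_map_compose, OF k(1)]
    moreover have "({0..1} \<times> {0..1}) \<inter> {x \<in> {0..1} \<times> {0..1}. snd x * 2 \<le> 1} = {0..1::real} \<times> {0..1/2::real}"
      "({0..1} \<times> {0..1}) \<inter> {x \<in> {0..1} \<times> {0..1}. 1 \<le> snd x * 2} = {0..1::real} \<times> {1/2..1::real}"
      by auto
    ultimately show
      "continuous_map (subtopology unit_square
         {x \<in> topspace unit_square. snd x \<le> 1/2}) X (h \<circ> (\<lambda>(s, t). (s, 2 * t)))"
      "continuous_map (subtopology unit_square
         {x \<in> topspace unit_square. 1/2 \<le> snd x}) X (k \<circ> (\<lambda>(s, t). (s, 2 * t - 1)))"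
      by (simp_all add: subtopology_subtopology)
    fix x :: "real \<times> real"
    assume x: "x \<in> topspace unit_square" "snd x = 1/2"
    then obtain s where "x = (s, 1/2)" "s \<in> {0..1}" by (cases x) auto
    then show "(h \<circ> (\<lambda>(s, t). (s, 2 * t))) x = (k \<circ> (\<lambda>(s, t). (s, 2 * t - 1))) x"
      using h(5) k(4) assms(3) by simp
  qed simp
  then show ?thesis
    by (rule path_homotopicI) (use h k in \<open>auto simp: join_path_def\<close>)
qed

lemma join_path_assoc:
  assumes "pathin X p" "pathin X q" "pathin X r" "p 1 = q 0" "q 1 = r 0"
  shows "path_homotopic X (join_path (join_path p q) r) (join_path p (join_path q r))"
proof -
  \<comment> \<open>Piecewise linear, sending 0, 1/4, 1/2, 1 to 0, 1/2, 3/4, 1; the slopes 2, 1, 1/2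
    decrease, so the map is the minimum of its three linear pieces.\<close>
  let ?u = "\<lambda>t::real. min (2 * t) (min (t + 1/4) ((t + 1) / 2))"
  have "path_homotopic X (join_path p (join_path q r) \<circ> ?u) (join_path p (join_path q r) \<circ> (\<lambda>t. t))"
    by (rule path_homotopic_reparam)
      (use assms in \<open>auto intro!: pathin_join continuous_intros simp: min_le_iff_disj\<close>)
  moreover have "join_path p (join_path q r) \<circ> ?u = join_path (join_path p q) r"
  proof
    fix t :: real
    consider "t \<le> 1/4" | "1/4 < t" "t \<le> 1/2" | "1/2 < t" by linarith
    then show "(join_path p (join_path q r) \<circ> ?u) t = join_path (join_path p q) r t"
    proof cases
      case 1
      then have "?u t = 2 * t" by simp
      with 1 show ?thesis by (simp add: join_path_def)
    next
      case 2
      then have "?u t = t + 1/4" by simp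
      with 2 show ?thesis by (simp add: join_path_def algebra_simps)
    next
      case 3
      then have "?u t = (t + 1) / 2" by simp
      moreover have "2 * ((t + 1) / 2) - 1 = t" by (simp add: field_simps)
      ultimately show ?thesis using 3 by (simp add: join_path_def del: times_divide_eq_right)
    qed
  qed
  ultimately show ?thesis by (simp add: o_def)
qed

lemma join_path_const_left:
  assumes "pathin X p" "x = p 0"
  shows "path_homotopic X (join_path (\<lambda>t. x) p) p"
proof -
  have "path_homotopic X (p \<circ> (\<lambda>t. max 0 (2 * t - 1))) (p \<circ> (\<lambda>t. t))"
    by (rule path_homotopic_reparam) (use assms in \<open>auto intro!: continuous_intros\<close>)
  moreover have "p \<circ> (\<lambda>t. max 0 (2 * t - 1)) = join_path (\<lambda>t. x) p"
  proof
    show "(p \<circ> (\<lambda>t. max 0 (2 * t - 1))) t = join_path (\<lambda>t. x) p t" for t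
      using assms by (cases "t \<le> 1/2") (auto simp: join_path_def max_absorb1 max_absorb2)
  qed
  ultimately show ?thesis by (simp add: o_def)
qed

lemma join_path_const_right:
  assumes "pathin X p" "x = p 1"
  shows "path_homotopic X (join_path p (\<lambda>t. x)) p"
proof -
  have "path_homotopic X (p \<circ> (\<lambda>t. min (2 * t) 1)) (p \<circ> (\<lambda>t. t))"
    by (rule path_homotopic_reparam) (use assms in \<open>auto intro!: continuous_intros\<close>)
  moreover have "p \<circ> (\<lambda>t. min (2 * t) 1) = join_path p (\<lambda>t. x)"
    using assms by (auto simp: join_path_def fun_eq_iff min_def)
  ultimately show ?thesis by (simp add: o_def)
qed

lemma join_path_reverse_right:
  assumes "pathin X p"
  shows "path_homotopic X (join_path p (reverse_path p)) (\<lambda>t. p 0)"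
proof -
  \<comment> \<open>The tent function runs up to 1 and back; it contracts to the constant 0 inside
    the parameter interval.\<close>
  have "path_homotopic X (p \<circ> (\<lambda>t. min (2 * t) (2 - 2 * t))) (p \<circ> (\<lambda>t. 0))"
    by (rule path_homotopic_reparam) (use assms in \<open>auto intro!: continuous_intros simp: min_le_iff_disj\<close>)
  moreover have "p \<circ> (\<lambda>t. min (2 * t) (2 - 2 * t)) = join_path p (reverse_path p)"
    by (auto simp: join_path_def reverse_path_def fun_eq_iff min_def)
  ultimately show ?thesis by (simp add: o_def)
qed

lemma join_path_reverse_left:
  assumes "pathin X p"
  shows "path_homotopic X (join_path (reverse_path p) p) (\<lambda>t. p 1)"
  using join_path_reverse_right[OF pathin_reverse[OF assms]] by simp

lemma join_path_cancel:
  assumes b: "pathin X b" and q: "pathin X q" and bq: "q 0 = b 1"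
  shows "path_homotopic X (join_path (reverse_path b) (join_path b q)) q"
proof -
  note p = b q pathin_reverse[OF b]
  have A: "path_homotopic X (join_path (join_path (reverse_path b) b) q) (join_path (\<lambda>t. b 1) q)"
    by (rule path_homotopic_join[OF join_path_reverse_left[OF b] path_homotopic_refl[OF q]]) (simp add: bq)
  also have "path_homotopic X \<dots> q"
    by (rule join_path_const_left[OF q]) (simp add: bq)
  finally have A: "path_homotopic X (join_path (join_path (reverse_path b) b) q) q" .
  show ?thesis
    by (rule path_homotopic_trans[OF path_homotopic_sym[OF join_path_assoc] A]) (simp_all add: p bq)
qed

section \<open>The fundamental group and induced maps\<close>

lemma path_class_eq_iff:
  assumes "pathin X p"
  shows "path_class X p = path_class X q \<longleftrightarrow> path_homotopic X p q"
proof
  assume "path_class X p = path_class X q"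
  then have "path_homotopic X q p"
    using path_homotopic_refl[OF assms] unfolding path_class_def by blast
  then show "path_homotopic X p q" by (rule path_homotopic_sym)
next
  assume "path_homotopic X p q"
  then show "path_class X p = path_class X q"
    unfolding path_class_def using path_homotopic_sym path_homotopic_trans by blast
qed

lemma path_class_eqI: "path_homotopic X p q \<Longrightarrow> path_class X p = path_class X q"
  using path_class_eq_iff path_homotopic_pathin by metis

lemma carrier_pi1: "carrier (pi1 X x) = path_class X ` {p. path_between X x x p}"
  and one_pi1: "\<one>\<^bsub>pi1 X x\<^esub> = path_class X (\<lambda>t. x)"
  by (simp_all add: pi1_def)

lemma path_class_in_pi1: "path_between X x x p \<Longrightarrow> path_class X p \<in> carrier (pi1 X x)"
  by (simp add: carrier_pi1)

lemma pi1_E: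
  assumes "c \<in> carrier (pi1 X x)"
  obtains p where "path_between X x x p" "c = path_class X p"
  using assms by (auto simp: carrier_pi1)

text \<open>The union in \<open>pi1\<close> runs over pairs of representatives, and every pair
  contributes the same class. The base point does not enter the product, so \<open>p\<close> and
  \<open>q\<close> may be any composable paths.\<close>

lemma mult_pi1:
  assumes "pathin X p" "pathin X q" "p 1 = q 0"
  shows "path_class X p \<otimes>\<^bsub>pi1 X x\<^esub> path_class X q = path_class X (join_path p q)"
proof -
  have "path_class X (join_path p' q') = path_class X (join_path p q)"
    if "path_homotopic X p p'" "path_homotopic X q q'" for p' q'
    using path_homotopic_join[OF that assms(3)] by (metis path_class_eqI)
  then have "(\<Union>p'\<in>path_class X p. \<Union>q'\<in>path_class X q. path_class X (join_path p' q'))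
      = (\<Union>p'\<in>path_class X p. \<Union>q'\<in>path_class X q. path_class X (join_path p q))"
    by (intro SUP_cong refl) (auto simp: path_class_def[of X p] path_class_def[of X q])
  moreover have "p \<in> path_class X p" "q \<in> path_class X q"
    using assms by (auto simp: path_class_def path_homotopic_refl)
  ultimately show ?thesis
    by (auto simp: pi1_def)
qed

lemma path_betweenD:
  assumes "path_between X x y p" shows "pathin X p" "p 0 = x" "p 1 = y"
  using assms by (auto simp: path_between_def)

lemma path_between_join: "path_between X x y p \<Longrightarrow> path_between X y z q \<Longrightarrow> path_between X x z (join_path p q)"
  by (simp add: path_between_def pathin_join)

lemma path_between_reverse: "path_between X x y p \<Longrightarrow> path_between X y x (reverse_path p)"
  by (simp add: path_between_def pathin_reverse)

lemma path_between_image: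
  "path_between X x y p \<Longrightarrow> continuous_map X Y f \<Longrightarrow> path_between Y (f x) (f y) (f \<circ> p)"
  by (auto simp: path_between_def pathin_compose)

lemma path_between_const: "x \<in> topspace X \<Longrightarrow> path_between X x x (\<lambda>t. x)"
  by (simp add: path_between_def)

lemma group_pi1:
  assumes "x \<in> topspace X"
  shows "group (pi1 X x)"
proof (rule groupI)
  show "\<one>\<^bsub>pi1 X x\<^esub> \<in> carrier (pi1 X x)"
    using assms by (simp add: one_pi1 path_class_in_pi1 path_between_const)
next
  fix a b assume "a \<in> carrier (pi1 X x)" "b \<in> carrier (pi1 X x)"
  then show "a \<otimes>\<^bsub>pi1 X x\<^esub> b \<in> carrier (pi1 X x)"
    by (elim pi1_E) (simp add: mult_pi1 path_betweenD path_class_in_pi1 path_between_join)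
next
  fix a b c assume "a \<in> carrier (pi1 X x)" "b \<in> carrier (pi1 X x)" "c \<in> carrier (pi1 X x)"
  then show "a \<otimes>\<^bsub>pi1 X x\<^esub> b \<otimes>\<^bsub>pi1 X x\<^esub> c = a \<otimes>\<^bsub>pi1 X x\<^esub> (b \<otimes>\<^bsub>pi1 X x\<^esub> c)"
    by (elim pi1_E) (simp add: mult_pi1 path_betweenD pathin_join path_class_eqI join_path_assoc)
next
  fix a assume "a \<in> carrier (pi1 X x)"
  then show "\<one>\<^bsub>pi1 X x\<^esub> \<otimes>\<^bsub>pi1 X x\<^esub> a = a"
    by (elim pi1_E) (simp add: one_pi1 mult_pi1 path_betweenD assms path_class_eqI join_path_const_left)
next
  fix a assume "a \<in> carrier (pi1 X x)"
  then obtain p where p: "path_between X x x p" "a = path_class X p"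
    by (elim pi1_E)
  have "path_class X (reverse_path p) \<otimes>\<^bsub>pi1 X x\<^esub> a = \<one>\<^bsub>pi1 X x\<^esub>"
    using path_class_eqI[OF join_path_reverse_left, of X p] p
    by (simp add: mult_pi1 pathin_reverse path_betweenD one_pi1)
  then show "\<exists>b\<in>carrier (pi1 X x). b \<otimes>\<^bsub>pi1 X x\<^esub> a = \<one>\<^bsub>pi1 X x\<^esub>"
    using path_class_in_pi1[OF path_between_reverse[OF p(1)]] by blast
qed

lemma pi1_map_path_class:
  assumes "pathin X p" "continuous_map X Y f"
  shows "pi1_map Y f (path_class X p) = path_class Y (f \<circ> p)"
proof -
  have "path_class Y (f \<circ> q) = path_class Y (f \<circ> p)" if "path_homotopic X p q" for q
    using path_class_eqI[OF path_homotopic_image[OF that assms(2)]] by simp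
  then have "(\<Union>q\<in>path_class X p. path_class Y (f \<circ> q)) = (\<Union>q\<in>path_class X p. path_class Y (f \<circ> p))"
    by (intro SUP_cong refl) (simp add: path_class_def[of X p])
  moreover have "p \<in> path_class X p"
    by (simp add: path_class_def path_homotopic_refl assms(1))
  ultimately show ?thesis
    unfolding pi1_map_def by auto
qed

lemma pi1_map_hom:
  assumes f: "continuous_map X Y f" and y: "y = f x"
  shows "pi1_map Y f \<in> hom (pi1 X x) (pi1 Y y)"
proof (rule homI)
  fix a assume "a \<in> carrier (pi1 X x)"
  then obtain p where p: "path_between X x x p" "a = path_class X p"
    by (rule pi1_E)
  then have "path_between Y y y (f \<circ> p)"
    using path_between_image[OF p(1) f] y by simp
  then show "pi1_map Y f a \<in> carrier (pi1 Y y)"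
    using p by (simp add: pi1_map_path_class[OF _ f] path_betweenD path_class_in_pi1)
next
  fix a b assume "a \<in> carrier (pi1 X x)" "b \<in> carrier (pi1 X x)"
  then obtain p q where "path_between X x x p" "path_between X x x q"
    "a = path_class X p" "b = path_class X q"
    by (auto simp: carrier_pi1)
  then show "pi1_map Y f (a \<otimes>\<^bsub>pi1 X x\<^esub> b) = pi1_map Y f a \<otimes>\<^bsub>pi1 Y y\<^esub> pi1_map Y f b"
    by (simp add: pi1_map_path_class[OF _ f] path_betweenD mult_pi1 pathin_join
        comp_join_path pathin_compose[OF _ f])
qed

lemma pi1_map_comp:
  assumes "c \<in> carrier (pi1 X x)" "continuous_map X Y f" "continuous_map Y Z g"
  shows "pi1_map Z g (pi1_map Y f c) = pi1_map Z (g \<circ> f) c"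
proof -
  obtain p where "pathin X p" "c = path_class X p"
    using assms(1) by (auto simp: carrier_pi1 path_between_def)
  then show ?thesis
    using assms(2,3) by (simp add: pi1_map_path_class[OF _ assms(2)] pi1_map_path_class[OF _ assms(3)]
        pi1_map_path_class[OF _ continuous_map_compose[OF assms(2,3)]] pathin_compose o_assoc)
qed

lemma pi1_map_cong:
  assumes "c \<in> carrier (pi1 X x)" "continuous_map X Y f" "\<And>z. z \<in> topspace X \<Longrightarrow> f z = g z"
  shows "pi1_map Y f c = pi1_map Y g c"
proof -
  obtain p where p: "path_between X x x p" "c = path_class X p"
    by (rule pi1_E[OF assms(1)])
  note pp = path_betweenD(1)[OF p(1)]
  have g: "continuous_map X Y g"
    using continuous_map_eq[OF assms(2,3)] .
  have "p t \<in> topspace X" if "t \<in> {0..1}" for t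
    using path_image_subset_topspace[OF pp] that by blast
  then have "path_homotopic Y (f \<circ> p) (g \<circ> p)"
    by (intro path_homotopic_eq pathin_compose[OF pp assms(2)]) (simp add: assms(3))
  then show ?thesis
    unfolding p(2) pi1_map_path_class[OF pp assms(2)] pi1_map_path_class[OF pp g] by (rule path_class_eqI)
qed

lemma group_hom_pi1_map:
  assumes "continuous_map X Y f" "x \<in> topspace X" "y = f x"
  shows "group_hom (pi1 X x) (pi1 Y y) (pi1_map Y f)"
proof -
  have "y \<in> topspace Y" using assms by (auto simp: continuous_map_def)
  then show ?thesis
    using group_pi1[OF assms(2)] group_pi1[of y Y] pi1_map_hom[OF assms(1,3)]
    by (simp add: group_hom_def group_hom_axioms_def)
qed

section \<open>Path functors\<close>

text \<open>A homomorphism from the fundamental groupoid of \<open>X\<close>, as a function on paths.\<close>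

definition path_functor :: "'a topology \<Rightarrow> ('g, 'm) monoid_scheme \<Rightarrow> ((real \<Rightarrow> 'a) \<Rightarrow> 'g) \<Rightarrow> bool" where
  "path_functor X G E \<longleftrightarrow> (\<forall>p. pathin X p \<longrightarrow> E p \<in> carrier G) \<and>
     (\<forall>p q. pathin X p \<longrightarrow> pathin X q \<longrightarrow> p 1 = q 0 \<longrightarrow> E (join_path p q) = E p \<otimes>\<^bsub>G\<^esub> E q) \<and>
     (\<forall>p q. path_homotopic X p q \<longrightarrow> E p = E q)"

lemma path_functorD:
  assumes "path_functor X G E"
  shows "pathin X p \<Longrightarrow> E p \<in> carrier G"
    and "pathin X p \<Longrightarrow> pathin X q \<Longrightarrow> p 1 = q 0 \<Longrightarrow> E (join_path p q) = E p \<otimes>\<^bsub>G\<^esub> E q"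
    and "path_homotopic X p q \<Longrightarrow> E p = E q"
  using assms unfolding path_functor_def by blast+

lemma path_functor_const:
  assumes "path_functor X G E" "group G" "x \<in> topspace X"
  shows "E (\<lambda>t. x) = \<one>\<^bsub>G\<^esub>"
proof -
  interpret group G by fact
  have p: "pathin X (\<lambda>t. x)" using assms by simp
  have "E (\<lambda>t. x) \<otimes>\<^bsub>G\<^esub> E (\<lambda>t. x) = E (\<lambda>t. x)"
    using path_functorD(2)[OF assms(1) p p] by (simp add: join_path_def)
  then show ?thesis
    using path_functorD(1)[OF assms(1) p] by (simp add: l_cancel_one')
qed

lemma path_functor_reverse:
  assumes "path_functor X G E" "group G" "pathin X p"
  shows "E (reverse_path p) = inv\<^bsub>G\<^esub> (E p)"
proof -
  interpret group G by fact
  note r = pathin_reverse[OF assms(3)]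
  have "E (reverse_path p) \<otimes>\<^bsub>G\<^esub> E p = E (join_path (reverse_path p) p)"
    using path_functorD(2)[OF assms(1) r assms(3)] by simp
  also have "\<dots> = E (\<lambda>t. p 1)"
    using path_functorD(3)[OF assms(1) join_path_reverse_left[OF assms(3)]] .
  also have "\<dots> = \<one>\<^bsub>G\<^esub>"
    using path_functor_const[OF assms(1,2)] path_finish_in_topspace[OF assms(3)] by simp
  finally show ?thesis
    using inv_equality path_functorD(1)[OF assms(1)] r assms(3) by metis
qed

lemma path_functor_imp_hom:
  assumes E: "path_functor X G E"
  obtains \<phi> where "\<phi> \<in> hom (pi1 X x) G" "\<And>p. path_between X x x p \<Longrightarrow> \<phi> (path_class X p) = E p"
proof
  let ?\<phi> = "\<lambda>c. E (SOME p. p \<in> c)"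
  have \<phi>: "?\<phi> (path_class X p) = E p" if "pathin X p" for p
  proof -
    have "p \<in> path_class X p"
      using path_homotopic_refl[OF that] by (simp add: path_class_def)
    then have "(SOME q. q \<in> path_class X p) \<in> path_class X p"
      by (rule someI[of "\<lambda>q. q \<in> path_class X p"])
    then show ?thesis
      using path_functorD(3)[OF E] by (simp add: path_class_def)
  qed
  then show "path_between X x x p \<Longrightarrow> ?\<phi> (path_class X p) = E p" for p
    by (simp add: path_betweenD)
  show "?\<phi> \<in> hom (pi1 X x) G"
  proof (rule homI)
    fix a assume "a \<in> carrier (pi1 X x)"
    then obtain p where "path_between X x x p" "a = path_class X p"
      by (rule pi1_E)
    then show "?\<phi> a \<in> carrier G"
      using \<phi> path_functorD(1)[OF E] path_betweenD(1) by metis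
  next
    fix a b assume "a \<in> carrier (pi1 X x)" "b \<in> carrier (pi1 X x)"
    then obtain p q where pq: "path_between X x x p" "path_between X x x q"
      "a = path_class X p" "b = path_class X q"
      by (auto simp: carrier_pi1)
    then have "?\<phi> (a \<otimes>\<^bsub>pi1 X x\<^esub> b) = ?\<phi> (path_class X (join_path p q))"
      by (simp add: mult_pi1 path_betweenD)
    also have "\<dots> = E p \<otimes>\<^bsub>G\<^esub> E q"
      using pq path_functorD(2)[OF E] by (simp add: \<phi> pathin_join path_betweenD)
    finally show "?\<phi> (a \<otimes>\<^bsub>pi1 X x\<^esub> b) = ?\<phi> a \<otimes>\<^bsub>G\<^esub> ?\<phi> b"
      using pq by (simp add: \<phi> path_betweenD)
  qed
qed

text \<open>The path to \<open>x\<close> itself is required to be constant, so that closing up a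
  loop at \<open>x\<close> by these paths does not change its class.\<close>

definition based_paths :: "'a topology \<Rightarrow> 'a \<Rightarrow> ('a \<Rightarrow> real \<Rightarrow> 'a) \<Rightarrow> bool" where
  "based_paths X x c \<longleftrightarrow> c x = (\<lambda>t. x) \<and> (\<forall>y\<in>topspace X. path_between X x y (c y))"

lemma based_pathsE:
  assumes "path_connected_space X" "x \<in> topspace X"
  obtains c where "based_paths X x c"
proof -
  have "\<forall>y\<in>topspace X. \<exists>p. path_between X x y p"
    using assms unfolding path_connected_space_def path_between_def by blast
  then obtain c where "\<forall>y\<in>topspace X. path_between X x y (c y)"
    by metis
  then have "based_paths X x (\<lambda>y. if y = x then (\<lambda>t. x) else c y)"
    using assms by (auto simp: based_paths_def path_between_const)
  then show ?thesis using that by blast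
qed

text \<open>Every path is closed up to a loop at \<open>x\<close> by the chosen paths
  \<open>c\<close>. For a concatenation, the path to the middle point is run backwards and then
  forwards, and cancels.\<close>

lemma hom_imp_path_functor:
  assumes x: "x \<in> topspace X" and G: "group G" and \<phi>: "\<phi> \<in> hom (pi1 X x) G" and c: "based_paths X x c"
  defines "E \<equiv> \<lambda>p. \<phi> (path_class X (join_path (c (p 0)) (join_path p (reverse_path (c (p 1))))))"
  shows "path_functor X G E" and "path_between X x x p \<Longrightarrow> E p = \<phi> (path_class X p)"
proof -
  interpret G: group G by fact
  interpret P: group "pi1 X x" using group_pi1 x .
  interpret \<phi>: group_hom "pi1 X x" G \<phi>
    by unfold_locales (rule \<phi>)
  have cb: "path_between X x y (c y)" if "y \<in> topspace X" for y
    using c that by (simp add: based_paths_def)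
  let ?J = "\<lambda>p. join_path (c (p 0)) (join_path p (reverse_path (c (p 1))))"
  have bet: "path_between X x x (?J p)" if "pathin X p" for p
    using that path_start_in_topspace[OF that] path_finish_in_topspace[OF that]
    by (intro path_between_join[OF cb] path_between_join[OF _ path_between_reverse[OF cb]])
      (auto simp: path_between_def)
  show "path_functor X G E"
    unfolding path_functor_def
  proof (intro conjI allI impI)
    show "E p \<in> carrier G" if "pathin X p" for p
      using path_class_in_pi1[OF bet[OF that]] by (simp add: E_def)
    show "E p = E q" if "path_homotopic X p q" for p q
    proof -
      have p: "pathin X p" "pathin X q" "q 0 = p 0" "q 1 = p 1"
        using path_homotopic_pathin path_homotopic_ends that by metis+
      note cc = cb[OF path_start_in_topspace[OF p(1)]] cb[OF path_finish_in_topspace[OF p(1)]]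
      have "path_homotopic X (?J p) (?J q)"
        using p cc path_betweenD[OF cc(1)] path_betweenD[OF cc(2)]
        by (intro path_homotopic_join that)
          (auto intro: path_homotopic_refl pathin_reverse)
      then show ?thesis
        unfolding E_def by (metis path_class_eqI)
    qed
    show "E (join_path p q) = E p \<otimes>\<^bsub>G\<^esub> E q" if p: "pathin X p" and q: "pathin X q" and pq: "p 1 = q 0" for p q
    proof -
      let ?a = "c (p 0)" and ?b = "c (q 0)" and ?d = "c (q 1)"
      have a: "path_between X x (p 0) ?a" and b: "path_between X x (q 0) ?b" and d: "path_between X x (q 1) ?d"
        using p q by (auto intro: cb path_start_in_topspace path_finish_in_topspace)
      note ps = path_betweenD[OF a] path_betweenD[OF b] path_betweenD[OF d] p q pq pathin_join pathin_reverse
      have *: "path_homotopic X (join_path p (join_path (reverse_path ?b) (join_path ?b (join_path q (reverse_path ?d)))))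
          (join_path p (join_path q (reverse_path ?d)))"
        by (rule path_homotopic_join[OF path_homotopic_refl[OF p] join_path_cancel]) (simp_all add: ps)
      have "path_homotopic X (join_path (?J p) (?J q)) (join_path ?a (join_path (join_path p (reverse_path ?b)) (?J q)))"
        unfolding pq by (intro join_path_assoc) (auto intro!: pathin_join pathin_reverse simp: ps)
      also have "path_homotopic X \<dots> (join_path ?a (join_path p (join_path (reverse_path ?b) (?J q))))"
        by (intro path_homotopic_join[OF path_homotopic_refl] join_path_assoc)
          (auto intro!: pathin_join pathin_reverse simp: ps)
      also have "path_homotopic X \<dots> (join_path ?a (join_path p (join_path q (reverse_path ?d))))"
        by (rule path_homotopic_join[OF path_homotopic_refl *]) (auto simp: ps)
      also have "path_homotopic X \<dots> (join_path ?a (join_path (join_path p q) (reverse_path ?d)))"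
        by (intro path_homotopic_join[OF path_homotopic_refl] path_homotopic_sym[OF join_path_assoc])
          (auto intro!: pathin_join pathin_reverse simp: ps)
      finally have "path_class X (?J (join_path p q)) = path_class X (join_path (?J p) (?J q))"
        using path_class_eqI by (metis join_path_ends)
      also have "\<dots> = path_class X (?J p) \<otimes>\<^bsub>pi1 X x\<^esub> path_class X (?J q)"
        using mult_pi1[OF path_betweenD(1)[OF bet[OF p]] path_betweenD(1)[OF bet[OF q]], of x]
          path_betweenD(3)[OF bet[OF p]] path_betweenD(2)[OF bet[OF q]] by simp
      finally show ?thesis
        using path_class_in_pi1[OF bet[OF p]] path_class_in_pi1[OF bet[OF q]] by (simp add: E_def)
    qed
  qed
  show "E p = \<phi> (path_class X p)" if "path_between X x x p" for p
  proof -
    have px: "pathin X p" "p 0 = x" "p 1 = x" "c x = (\<lambda>t. x)"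
      using that c by (auto simp: path_between_def based_paths_def)
    have r: "reverse_path (\<lambda>t. x) = (\<lambda>t. x)"
      by (simp add: reverse_path_def)
    have "path_homotopic X (join_path (\<lambda>t. x) (join_path p (\<lambda>t. x))) (join_path p (\<lambda>t. x))"
      using px x by (intro join_path_const_left pathin_join) auto
    also have "path_homotopic X \<dots> p"
      using px by (intro join_path_const_right) auto
    finally have "path_class X (?J p) = path_class X p"
      using px by (intro path_class_eqI) (simp add: r)
    then show ?thesis by (simp add: E_def)
  qed
qed

section \<open>Paths and singular simplices of dimension 1 and 2\<close>

definition vec3 :: "real \<Rightarrow> real \<Rightarrow> real \<Rightarrow> nat \<Rightarrow> real" where
  "vec3 a b c = (\<lambda>i. if i = 0 then a else if i = 1 then b else if i = 2 then c else 0)"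

definition simplex_path :: "((nat \<Rightarrow> real) \<Rightarrow> 'a) \<Rightarrow> real \<Rightarrow> 'a" where
  "simplex_path \<sigma> = (\<lambda>t. \<sigma> (vec3 (1 - t) t 0))"

text \<open>Coordinate 1 of a point of the 1-simplex is the parameter. Singular simplices are
  extensional on the standard simplex, hence the restriction.\<close>

definition path_simplex :: "(real \<Rightarrow> 'a) \<Rightarrow> (nat \<Rightarrow> real) \<Rightarrow> 'a" where
  "path_simplex p = restrict (\<lambda>v. p (v 1)) (standard_simplex 1)"

text \<open>A non-abelian 1-cocycle: faces 2, 0, 1 of a triangle are its edges 01, 12, 02. In this
  form a homomorphism of the fundamental groupoid can be compared with singular chains.\<close>

definition edge_functor ::
    "'a topology \<Rightarrow> ('g, 'm) monoid_scheme \<Rightarrow> (((nat \<Rightarrow> real) \<Rightarrow> 'a) \<Rightarrow> 'g) \<Rightarrow> bool" where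
  "edge_functor X G L \<longleftrightarrow> (\<forall>\<sigma>. singular_simplex 1 X \<sigma> \<longrightarrow> L \<sigma> \<in> carrier G) \<and>
     (\<forall>\<tau>. singular_simplex 2 X \<tau> \<longrightarrow>
        L (singular_face 2 2 \<tau>) \<otimes>\<^bsub>G\<^esub> L (singular_face 2 0 \<tau>) = L (singular_face 2 1 \<tau>))"

lemma vec3_in_simplex1: "t \<in> {0..1} \<Longrightarrow> vec3 (1 - t) t 0 \<in> standard_simplex 1"
  by (auto simp: vec3_def standard_simplex_def)

lemma vec3_in_simplex2:
  "0 \<le> a \<Longrightarrow> 0 \<le> b \<Longrightarrow> 0 \<le> c \<Longrightarrow> a + b + c = 1 \<Longrightarrow> vec3 a b c \<in> standard_simplex 2"
  by (auto simp: vec3_def standard_simplex_def numeral_2_eq_2)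

lemma simplex1_eq_vec3: "v \<in> standard_simplex 1 \<Longrightarrow> v = vec3 (1 - v 1) (v 1) 0"
  by (auto simp: vec3_def standard_simplex_def fun_eq_iff)

lemma simplical_face_vec3:
  "simplical_face 0 (vec3 a b 0) = vec3 0 a b"
  "simplical_face (Suc 0) (vec3 a b 0) = vec3 a 0 b"
  "simplical_face 2 (vec3 a b 0) = vec3 a b 0"
  by (auto simp: simplical_face_def vec3_def fun_eq_iff numeral_2_eq_2)

lemma convex_simplex: "convex_seqs (standard_simplex n)"
  by (simp add: convex_seqs_def convex_standard_simplex)

lemma pathin_vec3:
  assumes "continuous_on {0..1} a" "continuous_on {0..1} b" "continuous_on {0..1} c"
    and "\<And>t. t \<in> {0..1} \<Longrightarrow> vec3 (a t) (b t) (c t) \<in> K"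
  shows "pathin (subtopology real_seqs K) (\<lambda>t. vec3 (a t) (b t) (c t))"
proof -
  have "continuous_on {0..1} (\<lambda>t. vec3 (a t) (b t) (c t) i)" for i
    using assms(1-3) by (cases "i = 0"; cases "i = 1"; cases "i = 2") (simp_all add: vec3_def)
  then show ?thesis
    using assms(4) by (simp add: pathin_subtopology pathin_seqs)
qed

lemma pathin_simplex_path:
  assumes "singular_simplex 1 X \<sigma>"
  shows "pathin X (simplex_path \<sigma>)"
proof -
  have "pathin (subtopology real_seqs (standard_simplex 1)) (\<lambda>t. vec3 (1 - t) t 0)"
    using vec3_in_simplex1 by (intro pathin_vec3 continuous_intros) auto
  then show ?thesis
    using assms pathin_compose unfolding singular_simplex_def simplex_path_def
    by (fastforce simp: o_def)
qed

lemma simplex_path_path_simplex: "t \<in> {0..1} \<Longrightarrow> simplex_path (path_simplex p) t = p t"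
  using vec3_in_simplex1[of t] by (simp add: simplex_path_def path_simplex_def) (simp add: vec3_def)

lemma continuous_map_coord: "continuous_map (subtopology real_seqs K) euclideanreal (\<lambda>v. v i)"
  by (intro continuous_map_from_subtopology continuous_map_product_projection) simp

lemma singular_simplex_path_simplex:
  assumes "pathin X p"
  shows "singular_simplex 1 X (path_simplex p)"
proof -
  have "continuous_map (subtopology real_seqs (standard_simplex 1)) unit_interval (\<lambda>v. v 1)"
    using continuous_map_coord[of "standard_simplex 1" 1]
    by (auto simp: continuous_map_in_subtopology standard_simplex_def)
  then have "continuous_map (subtopology real_seqs (standard_simplex 1)) X (\<lambda>v. p (v 1))"
    using assms continuous_map_compose unfolding pathin_def by (fastforce simp: o_def)
  then show ?thesis
    unfolding singular_simplex_def path_simplex_def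
    by (auto intro: continuous_map_eq)
qed

text \<open>In the convex triangle, edge 01 followed by edge 12 is homotopic to the straight edge
  02.\<close>

lemma path_functor_edge:
  assumes "path_functor X G E"
  shows "edge_functor X G (\<lambda>\<sigma>. E (simplex_path \<sigma>))"
  unfolding edge_functor_def
proof (intro conjI allI impI)
  show "E (simplex_path \<sigma>) \<in> carrier G" if "singular_simplex 1 X \<sigma>" for \<sigma>
    using path_functorD(1)[OF assms pathin_simplex_path[OF that]] .
  fix \<tau> :: "(nat \<Rightarrow> real) \<Rightarrow> 'a" assume \<tau>: "singular_simplex 2 X \<tau>"
  have ss: "singular_simplex 1 X (singular_face 2 k \<tau>)" if "k \<le> 2" for k
    using singular_simplex_singular_face[OF \<tau> _ that] by simp
  let ?f = "\<lambda>k. simplex_path (singular_face 2 k \<tau>)"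
  have f: "?f 2 t = \<tau> (vec3 (1 - t) t 0)" "?f 0 t = \<tau> (vec3 0 (1 - t) t)" "?f 1 t = \<tau> (vec3 (1 - t) 0 t)"
    if "t \<in> {0..1}" for t
    using vec3_in_simplex1[OF that] by (simp_all add: simplex_path_def singular_face_def simplical_face_vec3)
  have pf: "pathin X (?f k)" if "k \<le> 2" for k
    using pathin_simplex_path[OF ss[OF that]] .
  have e: "?f 2 1 = ?f 0 0"
    using f[of 0] f[of 1] by simp
  let ?P = "\<lambda>a b c. pathin (subtopology real_seqs (standard_simplex 2)) (\<lambda>t. vec3 (a t) (b t) (c t))"
  have P: "?P (\<lambda>t. 1 - t) (\<lambda>t. t) (\<lambda>t. 0)" "?P (\<lambda>t. 0) (\<lambda>t. 1 - t) (\<lambda>t. t)" "?P (\<lambda>t. 1 - t) (\<lambda>t. 0) (\<lambda>t. t)"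
    by (intro pathin_vec3 continuous_intros vec3_in_simplex2; simp)+
  have h: "path_homotopic X (\<tau> \<circ> join_path (\<lambda>t. vec3 (1 - t) t 0) (\<lambda>t. vec3 0 (1 - t) t)) (\<tau> \<circ> (\<lambda>t. vec3 (1 - t) 0 t))"
    using \<tau> P convex_simplex
    by (intro path_homotopic_convex) (auto simp: singular_simplex_def intro!: pathin_join)
  have "path_homotopic X (join_path (?f 2) (?f 0)) (\<tau> \<circ> join_path (\<lambda>t. vec3 (1 - t) t 0) (\<lambda>t. vec3 0 (1 - t) t))"
    using pf e by (intro path_homotopic_eq pathin_join) (auto simp: join_path_def f)
  also note h
  also have "path_homotopic X (\<tau> \<circ> (\<lambda>t. vec3 (1 - t) 0 t)) (?f 1)"
    by (intro path_homotopic_sym[OF path_homotopic_eq] pf) (use f in auto)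
  finally have "E (join_path (?f 2) (?f 0)) = E (?f 1)"
    by (rule path_functorD(3)[OF assms])
  then show "E (?f 2) \<otimes>\<^bsub>G\<^esub> E (?f 0) = E (?f 1)"
    using path_functorD(2)[OF assms pf pf] e by simp
qed

text \<open>Allows a 2-simplex to be given by any continuous \<open>g\<close>, and its edges by
  paths known on the unit interval only; extensionality turns these into equal simplices.\<close>

lemma edge_functor_triangle:
  assumes L: "edge_functor X G L" and g: "continuous_map (subtopology real_seqs (standard_simplex 2)) X g"
    and p: "\<And>t. t \<in> {0..1} \<Longrightarrow> p t = g (vec3 (1 - t) t 0)"
    and q: "\<And>t. t \<in> {0..1} \<Longrightarrow> q t = g (vec3 0 (1 - t) t)"
    and r: "\<And>t. t \<in> {0..1} \<Longrightarrow> r t = g (vec3 (1 - t) 0 t)"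
  shows "L (path_simplex p) \<otimes>\<^bsub>G\<^esub> L (path_simplex q) = L (path_simplex r)"
proof -
  let ?\<tau> = "restrict g (standard_simplex 2)"
  have \<tau>: "singular_simplex 2 X ?\<tau>"
    using g unfolding singular_simplex_def by (auto intro: continuous_map_eq)
  have v: "v 1 \<in> {0..1}" if "v \<in> standard_simplex 1" for v
    using that by (simp add: standard_simplex_def)
  have f: "?\<tau> (simplical_face k v) = g (simplical_face k v)" if "v \<in> standard_simplex 1" "k \<le> 2" for k v
    using simplical_face_in_standard_simplex[of 2 k v] that by simp
  have eq: "restrict (\<lambda>v. u (v 1)) (standard_simplex 1) = singular_face 2 k ?\<tau>"
    if "k \<le> 2" "\<And>t. t \<in> {0..1} \<Longrightarrow> u t = g (simplical_face k (vec3 (1 - t) t 0))" for u k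
    unfolding singular_face_def
  proof (simp, rule restrict_ext)
    fix v assume "v \<in> standard_simplex (Suc 0)"
    then show "u (v (Suc 0)) = (?\<tau> \<circ> simplical_face k) v"
      using f[of v k] v[of v] that simplex1_eq_vec3[of v] by simp
  qed
  have "path_simplex p = singular_face 2 2 ?\<tau>" "path_simplex q = singular_face 2 0 ?\<tau>"
    "path_simplex r = singular_face 2 1 ?\<tau>"
    using eq[of 2 p] eq[of 0 q] eq[of 1 r] p q r
    by (simp_all add: path_simplex_def simplical_face_vec3)
  moreover have "L (singular_face 2 2 ?\<tau>) \<otimes>\<^bsub>G\<^esub> L (singular_face 2 0 ?\<tau>) = L (singular_face 2 1 ?\<tau>)"
    using L \<tau> unfolding edge_functor_def by blast
  ultimately show ?thesis by simp
qed

text \<open>The converse of \<open>path_functor_edge\<close>: constants, concatenations and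
  homotopies are all witnessed by triangles, so multiplicativity on 2-simplices is enough.\<close>

lemma edge_functor_path:
  assumes L: "edge_functor X G L" and G: "group G"
  shows "path_functor X G (\<lambda>p. L (path_simplex p))"
proof -
  interpret group G by fact
  let ?E = "\<lambda>p. L (path_simplex p)"
  have car: "?E p \<in> carrier G" if "pathin X p" for p
    using L singular_simplex_path_simplex[OF that] unfolding edge_functor_def by blast
  have const: "?E (\<lambda>t. x) = \<one>\<^bsub>G\<^esub>" if "x \<in> topspace X" for x
  proof -
    have "?E (\<lambda>t. x) \<otimes>\<^bsub>G\<^esub> ?E (\<lambda>t. x) = ?E (\<lambda>t. x)"
      using that by (intro edge_functor_triangle[OF L, of "\<lambda>_. x"]) auto
    then show ?thesis using car[of "\<lambda>t. x"] that by (simp add: l_cancel_one')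
  qed
  have c12: "continuous_map (subtopology real_seqs (standard_simplex 2)) euclideanreal (\<lambda>v. v i)" for i
    by (rule continuous_map_coord)
  have s2: "0 \<le> v 1" "0 \<le> v 2" "v 1 + v 2 \<le> 1" "v 1 / 2 + v 2 \<le> 1" "0 \<le> v 1 / 2 + v 2" "v 2 \<le> 1"
    if "v \<in> standard_simplex 2" for v
  proof -
    have "v 0 + v 1 + v 2 = 1" and ge: "0 \<le> v 0" "0 \<le> v 1" "0 \<le> v 2"
      using that by (auto simp: standard_simplex_def numeral_2_eq_2)
    then show "0 \<le> v 1" "0 \<le> v 2" "v 1 + v 2 \<le> 1" "v 1 / 2 + v 2 \<le> 1" "0 \<le> v 1 / 2 + v 2" "v 2 \<le> 1"
      by auto
  qed
  have s2': "0 \<le> v (Suc 0) \<and> 0 \<le> v 2 \<and> v (Suc 0) + v 2 \<le> 1" if "v \<in> standard_simplex 2" for v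
    using s2[OF that] by simp
  show ?thesis
    unfolding path_functor_def
  proof (intro conjI allI impI car)
    fix p q assume p: "pathin X p" and q: "pathin X q" and pq: "p 1 = q 0"
    \<comment> \<open>The triangle is collapsed onto the interval with its vertices going to 0, 1/2,
      1; its edges then become \<open>p\<close>, \<open>q\<close> and their concatenation.\<close>
    let ?g = "join_path p q \<circ> (\<lambda>v. v 1 / 2 + v 2)"
    have "continuous_map (subtopology real_seqs (standard_simplex 2)) unit_interval (\<lambda>v. v 1 / 2 + v 2)"
      using s2 by (auto simp: continuous_map_in_subtopology intro!: continuous_map_add continuous_map_real_divide c12)
    then have g: "continuous_map (subtopology real_seqs (standard_simplex 2)) X ?g"
      using pathin_join[OF p q pq] continuous_map_compose unfolding pathin_def by blast
    show "?E (join_path p q) = ?E p \<otimes>\<^bsub>G\<^esub> ?E q"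
    proof (rule edge_functor_triangle[OF L g, symmetric])
      fix t :: real assume t: "t \<in> {0..1}"
      show "p t = ?g (vec3 (1 - t) t 0)"
        using t by (simp add: vec3_def join_path_def)
      show "q t = ?g (vec3 0 (1 - t) t)"
      proof (cases "t = 0")
        case True
        then show ?thesis using pq by (simp add: vec3_def join_path_def)
      next
        case False
        have "?g (vec3 0 (1 - t) t) = join_path p q ((1 - t) / 2 + t)"
          by (simp add: vec3_def)
        also have "(1 - t) / 2 + t = (1 + t) / 2"
          by (simp add: field_simps)
        also have "join_path p q ((1 + t) / 2) = q t"
        proof -
          have "2 * ((1 + t) / 2) - 1 = t" by (simp add: field_simps)
          then show ?thesis
            using t False by (simp add: join_path_def del: times_divide_eq_right)
        qed
        finally show ?thesis by simp
      qed
      show "join_path p q t = ?g (vec3 (1 - t) 0 t)"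
        by (simp add: vec3_def)
    qed
  next
    fix p q assume hpq: "path_homotopic X p q"
    obtain h where h: "continuous_map unit_square X h"
      "\<And>t. h (0, t) = p t" "\<And>t. h (1, t) = q t"
      "\<And>s. s \<in> {0..1} \<Longrightarrow> h (s, 0) = p 0" "\<And>s. s \<in> {0..1} \<Longrightarrow> h (s, 1) = p 1"
      by (rule path_homotopicE[OF hpq]) (rule that; assumption)
    have pq: "pathin X p" "pathin X q"
      using path_homotopic_pathin hpq by metis+
    \<comment> \<open>The square is cut along its diagonal. In each triangle one side is an end of
      the homotopy and another is constant, so \<open>p\<close> and \<open>q\<close> both get the
      value of the diagonal.\<close>
    have 1: "continuous_map (subtopology real_seqs (standard_simplex 2)) unit_square (\<lambda>v. (v 2, v 1 + v 2))"
      and 2: "continuous_map (subtopology real_seqs (standard_simplex 2)) unit_square (\<lambda>v. (v 1 + v 2, v 2))"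
      unfolding continuous_map_pairwise o_def
      by (auto simp: continuous_map_in_subtopology dest!: s2' intro!: continuous_map_add c12)
    note ht = path_start_in_topspace[OF pq(1)] path_finish_in_topspace[OF pq(1)]
    have "?E p \<otimes>\<^bsub>G\<^esub> ?E (\<lambda>t. p 1) = ?E (\<lambda>t. h (t, t))"
      using edge_functor_triangle[OF L continuous_map_compose[OF 1 h(1)], of p "\<lambda>t. p 1" "\<lambda>t. h (t, t)"] h
      by (simp add: vec3_def)
    moreover have "?E (\<lambda>t. p 0) \<otimes>\<^bsub>G\<^esub> ?E q = ?E (\<lambda>t. h (t, t))"
      using edge_functor_triangle[OF L continuous_map_compose[OF 2 h(1)], of "\<lambda>t. p 0" q "\<lambda>t. h (t, t)"] h
      by (simp add: vec3_def)
    ultimately show "?E p = ?E q"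
      using car pq const[OF ht(1)] const[OF ht(2)] by simp
  qed
qed

section \<open>Extending cocycles\<close>

lemma homology_iso_surj:
  assumes f: "continuous_map X Y f" and H: "homology_iso X Y f" and z: "singular_relcycle p Y {} z"
  obtains y d where "singular_relcycle p X {} y" "singular_chain (Suc p) Y d"
    "z = chain_map p f y + chain_boundary (Suc p) d"
proof -
  have "hom_induced (int p) X {} Y {} f ` carrier (homology_group (int p) X) = carrier (homology_group (int p) Y)"
    using H unfolding homology_iso_def iso_def bij_betw_def by blast
  moreover have "homologous_rel_set p Y {} z \<in> carrier (homology_group (int p) Y)"
    using z by (simp add: carrier_relative_homology_group)
  ultimately have "homologous_rel_set p Y {} z \<in> hom_induced (int p) X {} Y {} f ` carrier (homology_group (int p) X)"
    by simp
  then obtain C where C: "C \<in> carrier (homology_group (int p) X)"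
    "homologous_rel_set p Y {} z = hom_induced (int p) X {} Y {} f C"
    by (rule imageE)
  from C(1) obtain y where "singular_relcycle p X {} y" "C = homologous_rel_set p X {} y"
    unfolding carrier_relative_homology_group by auto
  with C(2) have y: "singular_relcycle p X {} y"
    "hom_induced (int p) X {} Y {} f (homologous_rel_set p X {} y) = homologous_rel_set p Y {} z"
    by simp_all
  then have "homologous_rel p Y {} z (chain_map p f y)"
    using hom_induced_chain_map[OF f _ y(1), of "{}"] by (simp add: homologous_rel_set_eq homologous_rel_sym)
  then obtain d where "singular_chain (Suc p) Y d" "chain_boundary (Suc p) d = z - chain_map p f y"
    unfolding homologous_rel_def singular_boundary by blast
  then show ?thesis using that[OF y(1)] by simp
qed

lemma homology_iso_inj:
  assumes f: "continuous_map X Y f" and H: "homology_iso X Y f" and y: "singular_relcycle p X {} y"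
    and d: "singular_chain (Suc p) Y d" "chain_map p f y = chain_boundary (Suc p) d"
  obtains e where "singular_chain (Suc p) X e" "y = chain_boundary (Suc p) e"
proof -
  have inj: "inj_on (hom_induced (int p) X {} Y {} f) (carrier (homology_group (int p) X))"
    using H unfolding homology_iso_def iso_def bij_betw_def by blast
  have "homologous_rel p Y {} (chain_map p f y) (chain_map p f 0)"
    using d unfolding homologous_rel_def singular_boundary by auto
  then have eq: "hom_induced (int p) X {} Y {} f (homologous_rel_set p X {} y)
      = hom_induced (int p) X {} Y {} f (homologous_rel_set p X {} 0)"
    using hom_induced_chain_map[OF f _ y, of "{}"] hom_induced_chain_map[OF f _ singular_relcycle_0, of "{}" "{}" p]
    by (simp add: homologous_rel_set_eq)
  have "homologous_rel_set p X {} y = homologous_rel_set p X {} 0"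
    by (rule inj_onD[OF inj eq]) (use y in \<open>auto simp: carrier_relative_homology_group\<close>)
  then have "homologous_rel p X {} y 0"
    by (simp add: homologous_rel_set_eq)
  then show ?thesis
    using that unfolding homologous_rel_def singular_boundary by auto
qed

lemma singular_chain_induct [consumes 1, case_names zero diff of]:
  assumes "singular_chain p X c" "P 0"
    and "\<And>x y. singular_chain p X x \<Longrightarrow> singular_chain p X y \<Longrightarrow> P x \<Longrightarrow> P y \<Longrightarrow> P (x - y)"
    and "\<And>\<sigma>. singular_simplex p X \<sigma> \<Longrightarrow> P (frag_of \<sigma>)"
  shows "P c"
  using assms free_Abelian_group_induct[of c "singular_simplex_set p X" P]
  unfolding singular_chain_def by auto

lemma chain_hom:
  assumes b: "b \<in> hom (chain_group p X) K" and K: "group K"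
  shows "singular_chain p X x \<Longrightarrow> b x \<in> carrier K"
    and "b 0 = \<one>\<^bsub>K\<^esub>"
    and "singular_chain p X x \<Longrightarrow> singular_chain p X y \<Longrightarrow> b (x + y) = b x \<otimes>\<^bsub>K\<^esub> b y"
    and "singular_chain p X x \<Longrightarrow> singular_chain p X y \<Longrightarrow> b (x - y) = b x \<otimes>\<^bsub>K\<^esub> inv\<^bsub>K\<^esub> b y"
proof -
  interpret group_hom "chain_group p X" K b
    using b K by (simp add: group_hom_def group_hom_axioms_def)
  show cl: "b x \<in> carrier K" if "singular_chain p X x" for x
    using that hom_closed by simp
  show "b 0 = \<one>\<^bsub>K\<^esub>"
    using hom_one by simp
  show add: "b (x + y) = b x \<otimes>\<^bsub>K\<^esub> b y" if "singular_chain p X x" "singular_chain p X y" for x y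
    using that hom_mult[of x y] by simp
  show "b (x - y) = b x \<otimes>\<^bsub>K\<^esub> inv\<^bsub>K\<^esub> b y" if "singular_chain p X x" "singular_chain p X y" for x y
    using add[OF singular_chain_diff[OF that] that(2)] cl that singular_chain_diff[OF that]
    by (simp add: H.inv_solve_right)
qed

lemma chain_hom_exists:
  assumes "comm_group K" and "\<And>\<sigma>. singular_simplex p X \<sigma> \<Longrightarrow> u \<sigma> \<in> carrier K"
  obtains b where "b \<in> hom (chain_group p X) K" "\<And>\<sigma>. singular_simplex p X \<sigma> \<Longrightarrow> b (frag_of \<sigma>) = u \<sigma>"
proof -
  interpret comm_group K by fact
  have "u ` singular_simplex_set p X \<subseteq> carrier K"
    using assms(2) by auto
  from free_Abelian_group_universal[OF this] show ?thesis
    using that unfolding chain_group_def by (metis mem_Collect_eq)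
qed

definition point_simplex :: "'a \<Rightarrow> (nat \<Rightarrow> real) \<Rightarrow> 'a" where
  "point_simplex x = restrict (\<lambda>v. x) (standard_simplex 0)"

lemma chain_boundary_1:
  "chain_boundary 1 (frag_of \<sigma>) = frag_of (point_simplex (simplex_path \<sigma> 1)) - frag_of (point_simplex (simplex_path \<sigma> 0))"
proof -
  have "simplical_face 0 (\<lambda>j. if j = 0 then 1 else 0) = vec3 0 1 0"
    "simplical_face (Suc 0) (\<lambda>j. if j = 0 then 1 else 0) = vec3 1 0 0"
    by (auto simp: simplical_face_def vec3_def fun_eq_iff)
  then have "singular_face 1 0 \<sigma> = point_simplex (simplex_path \<sigma> 1)" "singular_face 1 1 \<sigma> = point_simplex (simplex_path \<sigma> 0)"
    by (simp_all add: singular_face_def point_simplex_def simplex_path_def standard_simplex_0 restrict_def fun_eq_iff[where 'b='a])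
  then show ?thesis
    by (simp add: chain_boundary_of)
qed

lemma chain_boundary_2:
  "chain_boundary 2 (frag_of \<tau>) = frag_of (singular_face 2 0 \<tau>) - frag_of (singular_face 2 1 \<tau>) + frag_of (singular_face 2 2 \<tau>)"
  by (simp add: chain_boundary_of numeral_2_eq_2)

lemma chain_boundary_3:
  "chain_boundary 3 (frag_of \<rho>) = frag_of (singular_face 3 0 \<rho>) - frag_of (singular_face 3 1 \<rho>)
     + frag_of (singular_face 3 2 \<rho>) - frag_of (singular_face 3 3 \<rho>)"
  by (simp add: chain_boundary_of numeral_2_eq_2 numeral_3_eq_3)

lemma chain_boundary_path_simplex:
  "chain_boundary 1 (frag_of (path_simplex p)) = frag_of (point_simplex (p 1)) - frag_of (point_simplex (p 0))"
  unfolding chain_boundary_1 by (simp add: simplex_path_path_simplex)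

text \<open>Subtracting the paths \<open>c\<close> over the boundary of a chain closes it up, so the
  cycles are a direct summand of the 1-chains. A homomorphism on cycles thereby extends to all
  chains, whatever the abelian target.\<close>

lemma one_cycle_projection:
  assumes c: "based_paths Y y0 c" and y0: "y0 \<in> topspace Y"
  obtains \<pi> where "\<And>w. singular_chain 1 Y w \<Longrightarrow> singular_relcycle 1 Y {} (\<pi> w)"
    "\<And>z. singular_relcycle 1 Y {} z \<Longrightarrow> \<pi> z = z" "\<And>v w. \<pi> (v + w) = \<pi> v + \<pi> w"
proof -
  \<comment> \<open>A 0-simplex is evaluated at \<open>vec3 1 0 0\<close>, its only vertex, to get
    its point; \<open>\<kappa>\<close> sends that point to the path from \<open>y0\<close>.\<close>
  define \<kappa> where "\<kappa> = frag_extend (\<lambda>\<rho>. frag_of (path_simplex (c (\<rho> (vec3 1 0 0)))))"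
  define \<pi> where "\<pi> w = w - \<kappa> (chain_boundary 1 w)" for w
  have "vec3 1 0 0 \<in> standard_simplex 0"
    by (auto simp: standard_simplex_0 vec3_def)
  then have \<kappa>_pt: "\<kappa> (frag_of (point_simplex y)) = frag_of (path_simplex (c y))" for y
    by (simp add: \<kappa>_def point_simplex_def)
  have \<kappa>_diff: "\<kappa> (v - w) = \<kappa> v - \<kappa> w" for v w
    by (simp add: \<kappa>_def frag_extend_diff)
  have cy: "path_between Y y0 y (c y)" if "y \<in> topspace Y" for y
    using c that by (simp add: based_paths_def)
  have "singular_relcycle 1 Y {} (\<pi> w)" if "singular_chain 1 Y w" for w
    using that
  proof (induction w rule: singular_chain_induct)
    case zero
    then show ?case by (simp add: \<pi>_def \<kappa>_def)
  next
    case (diff v w)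
    then have "singular_relcycle 1 Y {} (\<pi> v - \<pi> w)"
      by (intro singular_relcycle_diff)
    moreover have "\<pi> (v - w) = \<pi> v - \<pi> w"
      by (simp add: \<pi>_def \<kappa>_def chain_boundary_diff frag_extend_diff)
    ultimately show ?case by simp
  next
    case (of \<sigma>)
    let ?p = "simplex_path \<sigma>"
    have p: "pathin Y ?p" using pathin_simplex_path[OF of] .
    note c0 = cy[OF path_start_in_topspace[OF p]] and c1 = cy[OF path_finish_in_topspace[OF p]]
    have pi: "\<pi> (frag_of \<sigma>) = frag_of \<sigma> - (frag_of (path_simplex (c (?p 1))) - frag_of (path_simplex (c (?p 0))))"
      unfolding \<pi>_def chain_boundary_1 by (simp add: \<kappa>_diff \<kappa>_pt)
    have "singular_chain 1 Y (\<pi> (frag_of \<sigma>))"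
      unfolding pi using of c0 c1
      using path_betweenD(1)[OF c0] path_betweenD(1)[OF c1]
      by (intro singular_chain_diff; simp only: singular_chain_of singular_simplex_path_simplex)
    moreover have "chain_boundary 1 (\<pi> (frag_of \<sigma>)) = 0"
      unfolding pi chain_boundary_diff chain_boundary_1[of \<sigma>] chain_boundary_path_simplex
      using path_betweenD[OF c0] path_betweenD[OF c1] by simp
    ultimately show ?case by (simp add: singular_cycle)
  qed
  moreover have "\<pi> z = z" if "singular_relcycle 1 Y {} z" for z
    using that by (simp add: singular_cycle \<pi>_def \<kappa>_def)
  moreover have "\<pi> (v + w) = \<pi> v + \<pi> w" for v w
    by (simp add: \<pi>_def \<kappa>_def chain_boundary_add frag_extend_add)
  ultimately show ?thesis by (rule that)
qed

text \<open>A cocycle pair \<open>(c, a)\<close> of the mapping cone of \<open>f\<close> is a coboundary, up to cochains of \<open>X\<close>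
  that vanish on cycles.\<close>

lemma cocycle_extension:
  fixes K (structure)
  assumes f: "continuous_map X Y f" and H: "homology_iso X Y f" and Y: "path_connected_space Y"
    and y0: "y0 \<in> topspace Y"
    and K: "comm_group K" and a: "a \<in> hom (chain_group 1 X) K" and c: "c \<in> hom (chain_group 2 Y) K"
    and c3: "\<And>d. singular_chain 3 Y d \<Longrightarrow> c (chain_boundary 3 d) = \<one>"
    and ca: "\<And>e. singular_chain 2 X e \<Longrightarrow> c (chain_map 2 f e) = a (chain_boundary 2 e)"
  obtains b where "b \<in> hom (chain_group 1 Y) K"
    "\<And>d. singular_chain 2 Y d \<Longrightarrow> b (chain_boundary 2 d) = c d"
    "\<And>z. singular_relcycle 1 X {} z \<Longrightarrow> b (chain_map 1 f z) = a z"
proof -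
  interpret K: comm_group K by fact
  note ha = chain_hom[OF a K.is_group] and hc = chain_hom[OF c K.is_group]
  have bd: "chain_boundary (Suc 1) = chain_boundary 2" "Suc 1 = 2" "Suc 2 = 3"
    by (auto simp: numeral_2_eq_2 numeral_3_eq_3)
  \<comment> \<open>\<open>w\<close> is the value that the conditions on \<open>b\<close> force on
    the cycle \<open>z\<close>. Existence comes from surjectivity on \<open>H_1\<close>; uniqueness
    is reduced to the case \<open>z = 0\<close>.\<close>
  define P where "P z w \<longleftrightarrow> (\<exists>y d. singular_relcycle 1 X {} y \<and> singular_chain 2 Y d \<and>
    z = chain_map 1 f y + chain_boundary 2 d \<and> w = a y \<otimes> c d)" for z w
  have PI: "P (chain_map 1 f y + chain_boundary 2 d) (a y \<otimes> c d)"
    if "singular_relcycle 1 X {} y" "singular_chain 2 Y d" for y d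
    unfolding P_def using that by (intro exI conjI) auto
  have Pex: "\<exists>w. P z w" if z: "singular_relcycle 1 Y {} z" for z
  proof -
    obtain y d where "singular_relcycle 1 X {} y" "singular_chain 2 Y d"
      "z = chain_map 1 f y + chain_boundary 2 d"
      by (rule homology_iso_surj[OF f H z]) (rule that; simp only: bd)
    then show ?thesis using PI by blast
  qed
  have Pclosed: "w \<in> carrier K" if P1: "P z w" for z w
  proof -
    obtain y d where "singular_relcycle 1 X {} y" "singular_chain 2 Y d" "w = a y \<otimes> c d"
      using P1[unfolded P_def] by (elim exE conjE) (rule that; assumption)
    then show ?thesis using ha(1) hc(1) by (simp add: singular_cycle)
  qed
  have Padd: "P (z + z') (w \<otimes> w')" if P1: "P z w" and P2: "P z' w'" for z w z' w'
  proof -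
    obtain y d where yd: "singular_relcycle 1 X {} y" "singular_chain 2 Y d"
      "z = chain_map 1 f y + chain_boundary 2 d" "w = a y \<otimes> c d"
      using P1[unfolded P_def] by (elim exE conjE) (rule that; assumption)
    obtain y' d' where yd': "singular_relcycle 1 X {} y'" "singular_chain 2 Y d'"
      "z' = chain_map 1 f y' + chain_boundary 2 d'" "w' = a y' \<otimes> c d'"
      using P2[unfolded P_def] by (elim exE conjE) (rule that; assumption)
    have "w \<otimes> w' = a (y + y') \<otimes> c (d + d')"
      using yd yd' ha hc by (simp add: singular_cycle K.m_ac)
    moreover have "P (chain_map 1 f (y + y') + chain_boundary 2 (d + d')) (a (y + y') \<otimes> c (d + d'))"
      by (intro PI singular_relcycle_add singular_chain_add yd yd')
    moreover have "chain_map 1 f (y + y') + chain_boundary 2 (d + d') = z + z'"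
      unfolding yd(3) yd'(3) chain_map_add chain_boundary_add by (simp add: algebra_simps)
    ultimately show ?thesis by simp
  qed
  have Pneg: "P (- z) (inv w)" if P1: "P z w" for z w
  proof -
    obtain y d where yd: "singular_relcycle 1 X {} y" "singular_chain 2 Y d"
      "z = chain_map 1 f y + chain_boundary 2 d" "w = a y \<otimes> c d"
      using P1[unfolded P_def] by (elim exE conjE) (rule that; assumption)
    have "a (0 - y) = \<one> \<otimes> inv a y" "c (0 - d) = \<one> \<otimes> inv c d"
      using yd ha(4)[of 0 y] hc(4)[of 0 d] ha(2) hc(2) by (auto simp: singular_cycle)
    then have "inv w = a (- y) \<otimes> c (- d)"
      using yd ha(1) hc(1) by (simp add: singular_cycle K.inv_mult)
    moreover have "P (chain_map 1 f (- y) + chain_boundary 2 (- d)) (a (- y) \<otimes> c (- d))"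
      using yd by (intro PI) (simp_all add: singular_relcycle_minus singular_chain_minus)
    moreover have "chain_map 1 f (- y) + chain_boundary 2 (- d) = - z"
      unfolding yd(3) chain_map_minus chain_boundary_minus by simp
    ultimately show ?thesis by simp
  qed
  \<comment> \<open>Injectivity on \<open>H_1\<close> makes \<open>y\<close> the boundary of some
    \<open>e\<close>. Surjectivity on \<open>H_2\<close> rewrites the 2-cycle \<open>f e + d\<close>
    as \<open>f h\<close> plus a boundary, and \<open>c\<close> is trivial on both: by
    \<open>ca\<close>, since \<open>h\<close> is a cycle, and by \<open>c3\<close>.\<close>
  have P0: "w = \<one>" if P1: "P 0 w" for w
  proof -
    obtain y d where yd: "singular_relcycle 1 X {} y" "singular_chain 2 Y d"
      "0 = chain_map 1 f y + chain_boundary 2 d" "w = a y \<otimes> c d"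
      using P1[unfolded P_def] by (elim exE conjE) (rule that; assumption)
    have "singular_chain (Suc 1) Y (- d)" "chain_map 1 f y = chain_boundary (Suc 1) (- d)"
      unfolding bd using yd by (auto simp: singular_chain_minus chain_boundary_minus eq_neg_iff_add_eq_0)
    then obtain e where e: "singular_chain 2 X e" "y = chain_boundary 2 e"
      by (rule homology_iso_inj[OF f H yd(1)]) (rule that; simp only: bd)
    have fe: "singular_chain 2 Y (chain_map 2 f e)"
      using e(1) f by (rule singular_chain_chain_map)
    have "chain_boundary 2 (chain_map 2 f e + d) = 0"
      using chain_boundary_chain_map[OF e(1), of f] yd(3) e(2) by (simp add: chain_boundary_add)
    then have "singular_relcycle 2 Y {} (chain_map 2 f e + d)"
      using fe yd(2) by (simp add: singular_cycle singular_chain_add)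
    then obtain h k where hk: "singular_relcycle 2 X {} h" "singular_chain 3 Y k"
      "chain_map 2 f e + d = chain_map 2 f h + chain_boundary 3 k"
      by (rule homology_iso_surj[OF f H]) (rule that; simp only: bd)
    have k: "singular_chain 2 Y (chain_boundary 3 k)"
      using singular_chain_boundary[OF hk(2)] by simp
    have fh: "singular_chain 2 Y (chain_map 2 f h)"
      using hk(1) f by (auto simp: singular_cycle intro: singular_chain_chain_map)
    have "w = c (chain_map 2 f e + d)"
      using yd(4) e ca[OF e(1)] hc(3)[OF fe yd(2)] by simp
    also have "\<dots> = c (chain_map 2 f h) \<otimes> c (chain_boundary 3 k)"
      using hk(3) hc(3)[OF fh k] by simp
    also have "\<dots> = \<one>"
      using ca[of h] hk(1) c3[OF hk(2)] ha(2) by (simp add: singular_cycle)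
    finally show ?thesis .
  qed
  have Puniq: "w = w'" if "P z w" "P z w'" for z w w'
  proof -
    have "P (z + - z) (w \<otimes> inv w')"
      using Padd[OF that(1) Pneg[OF that(2)]] .
    then have "w \<otimes> inv w' = \<one>"
      using P0 by simp
    then show ?thesis
      using Pclosed[OF that(1)] Pclosed[OF that(2)] by (simp add: K.inv_solve_right')
  qed
  define b0 where "b0 z = (THE w. P z w)" for z
  have b0: "b0 z = w" if "P z w" for z w
    unfolding b0_def by (rule the_equality) (use that Puniq in auto)
  obtain c' where "based_paths Y y0 c'"
    by (rule based_pathsE[OF Y y0])
  then obtain \<pi> where
    \<pi>: "\<And>w. singular_chain 1 Y w \<Longrightarrow> singular_relcycle 1 Y {} (\<pi> w)"
    "\<And>z. singular_relcycle 1 Y {} z \<Longrightarrow> \<pi> z = z" "\<And>v w. \<pi> (v + w) = \<pi> v + \<pi> w"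
    by (rule one_cycle_projection[OF _ y0]) (rule that; assumption)
  \<comment> \<open>\<open>b0\<close> makes sense on cycles only; the projection extends it to
    chains and does not change it on cycles, where all prescribed values lie.\<close>
  have "b0 \<circ> \<pi> \<in> hom (chain_group 1 Y) K"
  proof (rule homI)
    fix v assume "v \<in> carrier (chain_group 1 Y)"
    then obtain w where "P (\<pi> v) w" using Pex[OF \<pi>(1)[of v]] by auto
    then show "(b0 \<circ> \<pi>) v \<in> carrier K" using Pclosed[of "\<pi> v" w] b0[of "\<pi> v" w] by simp
  next
    fix v v' assume "v \<in> carrier (chain_group 1 Y)" "v' \<in> carrier (chain_group 1 Y)"
    then obtain w w' where w: "P (\<pi> v) w" "P (\<pi> v') w'"
      using Pex[OF \<pi>(1)[of v]] Pex[OF \<pi>(1)[of v']] by auto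
    then show "(b0 \<circ> \<pi>) (v \<otimes>\<^bsub>chain_group 1 Y\<^esub> v') = (b0 \<circ> \<pi>) v \<otimes> (b0 \<circ> \<pi>) v'"
      using b0[OF w(1)] b0[OF w(2)] b0[OF Padd[OF w]] \<pi>(3) by simp
  qed
  moreover have "(b0 \<circ> \<pi>) (chain_boundary 2 d) = c d" if "singular_chain 2 Y d" for d
  proof -
    have "singular_relcycle 1 Y {} (chain_boundary 2 d)"
      using that singular_chain_boundary[OF that] chain_boundary_boundary[OF that] by (simp add: singular_cycle)
    moreover have P: "P (chain_boundary 2 d) (a 0 \<otimes> c d)"
      using PI[OF singular_relcycle_0 that] by simp
    ultimately show ?thesis
      using \<pi>(2) b0[OF P] ha(2) hc(1)[OF that] by simp
  qed
  moreover have "(b0 \<circ> \<pi>) (chain_map 1 f z) = a z" if "singular_relcycle 1 X {} z" for z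
  proof -
    have "singular_relcycle 1 Y {} (chain_map 1 f z)"
      using singular_relcycle_chain_map[OF that f, of "{}"] by simp
    moreover have P: "P (chain_map 1 f z) (a z \<otimes> c 0)"
      using PI[OF that singular_chain_0] by simp
    ultimately show ?thesis
      using \<pi>(2) b0[OF P] hc(2) ha(1)[of z] that by (simp add: singular_cycle)
  qed
  ultimately show ?thesis by (rule that)
qed

section \<open>Lifting through central extensions\<close>

lemma singular_face_face:
  assumes "i < j" "j \<le> 3"
  shows "singular_face 2 i (singular_face 3 j \<rho>) = singular_face 2 (j - 1) (singular_face 3 i \<rho>)"
proof -
  have "simplical_face j (simplical_face i v) = simplical_face i (simplical_face (j - 1) v)" for v :: "nat \<Rightarrow> real"
    using assms(1) by (auto simp: simplical_face_def fun_eq_iff)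
  moreover have "simplical_face k v \<in> standard_simplex 2" if "v \<in> standard_simplex 1" "k \<le> 2" for k v
    using simplical_face_in_standard_simplex[of 2 k v] that by simp
  ultimately show ?thesis
    unfolding singular_face_def using assms by (intro restrict_ext) simp
qed

lemma (in group) cancel_left:
  assumes "a \<in> carrier G" "b \<in> carrier G"
  shows "a \<otimes> (inv a \<otimes> b) = b" "inv a \<otimes> (a \<otimes> b) = b"
  using assms by (simp_all flip: m_assoc)

text \<open>The obstruction to lifting \<open>\<Psi>\<close> through the central extension is a 2-cocycle on \<open>Y\<close> that is
  trivialized on \<open>X\<close> by \<open>\<Phi>\<close>.\<close>

lemma central_lift:
  fixes \<Gamma> (structure)
  assumes f: "continuous_map X Y f" and H: "homology_iso X Y f" and Y: "path_connected_space Y"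
    and y0: "y0 \<in> topspace Y"
    and \<Gamma>: "group \<Gamma>" and Q: "group Q" and pr: "pr \<in> hom \<Gamma> Q" and surj: "pr ` carrier \<Gamma> = carrier Q"
    and central: "\<And>z x. z \<in> carrier \<Gamma> \<Longrightarrow> pr z = \<one>\<^bsub>Q\<^esub> \<Longrightarrow> x \<in> carrier \<Gamma> \<Longrightarrow> z \<otimes> x = x \<otimes> z"
    and \<Phi>: "edge_functor X \<Gamma> \<Phi>" and \<Psi>: "edge_functor Y Q \<Psi>"
    and comp: "\<And>\<sigma>. singular_simplex 1 X \<sigma> \<Longrightarrow> pr (\<Phi> \<sigma>) = \<Psi> (simplex_map 1 f \<sigma>)"
  obtains \<Lambda> where "edge_functor Y \<Gamma> \<Lambda>"
    "\<And>\<sigma>. singular_relcycle 1 X {} (frag_of \<sigma>) \<Longrightarrow> \<Lambda> (simplex_map 1 f \<sigma>) = \<Phi> \<sigma>"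
proof -
  interpret \<Gamma>: group \<Gamma> by fact
  interpret Q: group Q by fact
  interpret pr: group_hom \<Gamma> Q pr
    using pr by unfold_locales
  let ?Z = "kernel \<Gamma> Q pr"
  define K where "K = \<Gamma>\<lparr>carrier := ?Z\<rparr>"
  have Z: "z \<in> carrier K \<longleftrightarrow> z \<in> carrier \<Gamma> \<and> pr z = \<one>\<^bsub>Q\<^esub>" for z
    by (simp add: K_def kernel_def)
  have K_mult [simp]: "x \<otimes>\<^bsub>K\<^esub> y = x \<otimes> y" "\<one>\<^bsub>K\<^esub> = \<one>" for x y
    by (simp_all add: K_def)
  have sub: "subgroup ?Z \<Gamma>"
    by (rule pr.subgroup_kernel)
  interpret K: group K
    unfolding K_def using sub \<Gamma>.is_group by (rule subgroup.subgroup_is_group)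
  interpret K: comm_group K
    by (rule K.group_comm_groupI) (simp add: Z central)
  have K_inv: "inv\<^bsub>K\<^esub> z = inv z" if "z \<in> carrier K" for z
    using \<Gamma>.m_inv_consistent[OF sub] that unfolding K_def by simp
  have face: "singular_simplex 1 V (singular_face 2 k \<tau>)" if "singular_simplex 2 V \<tau>" "k \<le> 2" for k \<tau> and V :: "'v topology"
    using singular_simplex_singular_face[OF that(1) _ that(2)] by simp
  have \<Psi>c: "\<Psi> \<sigma> \<in> carrier Q" if "singular_simplex 1 Y \<sigma>" for \<sigma>
    using \<Psi> that unfolding edge_functor_def by blast
  have \<Phi>c: "\<Phi> \<sigma> \<in> carrier \<Gamma>" if "singular_simplex 1 X \<sigma>" for \<sigma>
    using \<Phi> that unfolding edge_functor_def by blast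
  have "\<exists>x\<in>carrier \<Gamma>. pr x = \<Psi> \<sigma>" if "singular_simplex 1 Y \<sigma>" for \<sigma>
    using \<Psi>c[OF that] surj by (metis imageE)
  then obtain L where L: "\<And>\<sigma>. singular_simplex 1 Y \<sigma> \<Longrightarrow> L \<sigma> \<in> carrier \<Gamma>"
    "\<And>\<sigma>. singular_simplex 1 Y \<sigma> \<Longrightarrow> pr (L \<sigma>) = \<Psi> \<sigma>"
    by metis
  \<comment> \<open>\<open>\<gamma>\<close> is the failure of the lift \<open>L\<close> to be
    multiplicative on a triangle, and \<open>\<alpha>\<close> is the deviation of \<open>L\<close>
    along \<open>f\<close> from \<open>\<Phi>\<close>. Both take values in the central kernel
    \<open>K\<close>, so they extend to cochains with abelian coefficients.\<close>
  define \<gamma> where "\<gamma> \<tau> = L (singular_face 2 2 \<tau>) \<otimes> L (singular_face 2 0 \<tau>) \<otimes> inv L (singular_face 2 1 \<tau>)" for \<tau>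
  define \<alpha> where "\<alpha> \<sigma> = L (simplex_map 1 f \<sigma>) \<otimes> inv \<Phi> \<sigma>" for \<sigma>
  have fs: "singular_simplex p Y (simplex_map p f \<sigma>)" if "singular_simplex p X \<sigma>" for p \<sigma>
    using singular_simplex_simplex_map[OF that f] .
  have \<gamma>: "\<gamma> \<tau> \<in> carrier K" if "singular_simplex 2 Y \<tau>" for \<tau>
  proof -
    have "\<Psi> (singular_face 2 2 \<tau>) \<otimes>\<^bsub>Q\<^esub> \<Psi> (singular_face 2 0 \<tau>) = \<Psi> (singular_face 2 1 \<tau>)"
      using \<Psi> that unfolding edge_functor_def by blast
    then show ?thesis
      using L face[OF that] \<Psi>c[OF face[OF that]] by (simp add: Z \<gamma>_def del: One_nat_def)
  qed
  have \<alpha>: "\<alpha> \<sigma> \<in> carrier K" if "singular_simplex 1 X \<sigma>" for \<sigma>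
    using that L[OF fs[OF that]] \<Phi>c[OF that] comp[OF that] \<Psi>c[OF fs[OF that]]
    by (simp add: Z \<alpha>_def del: One_nat_def)
  obtain c where c: "c \<in> hom (chain_group 2 Y) K" "\<And>\<tau>. singular_simplex 2 Y \<tau> \<Longrightarrow> c (frag_of \<tau>) = \<gamma> \<tau>"
    by (rule chain_hom_exists[OF K.comm_group_axioms, of 2 Y \<gamma>]) (use \<gamma> in auto)
  obtain a where a: "a \<in> hom (chain_group 1 X) K" "\<And>\<sigma>. singular_simplex 1 X \<sigma> \<Longrightarrow> a (frag_of \<sigma>) = \<alpha> \<sigma>"
    by (rule chain_hom_exists[OF K.comm_group_axioms, of 1 X \<alpha>]) (use \<alpha> in auto)
  note hc = chain_hom[OF c(1) K.is_group] and ha = chain_hom[OF a(1) K.is_group]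
  have c3: "c (chain_boundary 3 d) = \<one>\<^bsub>K\<^esub>" if "singular_chain 3 Y d" for d
    using that
  proof (induction d rule: singular_chain_induct)
    case zero
    then show ?case using hc(2) by simp
  next
    case (diff x y)
    have "singular_chain 2 Y (chain_boundary 3 x)" "singular_chain 2 Y (chain_boundary 3 y)"
      using singular_chain_boundary[OF diff(1)] singular_chain_boundary[OF diff(2)] by simp_all
    then have "c (chain_boundary 3 (x - y)) = \<one>\<^bsub>K\<^esub> \<otimes>\<^bsub>K\<^esub> inv\<^bsub>K\<^esub> \<one>\<^bsub>K\<^esub>"
      using hc(4) diff(3,4) by (metis chain_boundary_diff)
    then show ?case by (metis K.inv_one K.l_one K.one_closed)
  next
    case (of \<rho>)
    let ?F = "\<lambda>k. singular_face 3 k \<rho>" and ?E = "\<lambda>i k. singular_face 2 i (singular_face 3 k \<rho>)"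
    have F: "singular_simplex 2 Y (?F k)" if "k \<le> 3" for k
      using singular_simplex_singular_face[OF of _ that] by simp
    have ff: "?E 0 3 = ?E 2 0" "?E 1 3 = ?E 2 1" "?E 2 3 = ?E 2 2" "?E 0 2 = ?E 1 0" "?E 1 2 = ?E 1 1" "?E 0 1 = ?E 0 0"
      using singular_face_face[of 0 3 \<rho>] singular_face_face[of 1 3 \<rho>] singular_face_face[of 2 3 \<rho>]
        singular_face_face[of 0 2 \<rho>] singular_face_face[of 1 2 \<rho>] singular_face_face[of 0 1 \<rho>]
      by (simp_all add: numeral_2_eq_2 numeral_3_eq_3)
    have LE: "L (?E i k) \<in> carrier \<Gamma>" if "i \<le> 2" "k \<le> 3" for i k
      using L(1)[OF face[OF F[OF that(2)] that(1)]] .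
    have \<gamma>F: "\<gamma> (?F k) \<in> carrier K" "\<gamma> (?F k) \<in> carrier \<Gamma>" if "k \<le> 3" for k
      using \<gamma>[OF F[OF that]] Z by auto
    \<comment> \<open>The cocycle identity on a 3-simplex with vertices 0, 1, 2, 3: both products
      equal \<open>L(01) L(12) L(23) L(03)^-1\<close>. Centrality moves
      \<open>\<gamma> (?F 0)\<close> past \<open>L(01)\<close>.\<close>
    have "\<gamma> (?F 0) \<otimes> \<gamma> (?F 2) = L (?E 2 2) \<otimes> \<gamma> (?F 0) \<otimes> L (?E 0 2) \<otimes> inv L (?E 1 2)"
      unfolding \<gamma>_def[of "?F 2"] using central[of "\<gamma> (?F 0)" "L (?E 2 2)"] \<gamma>F[of 0] LE
      by (simp add: Z flip: \<Gamma>.m_assoc)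
    also have "\<dots> = \<gamma> (?F 3) \<otimes> \<gamma> (?F 1)"
      unfolding \<gamma>_def ff using LE by (simp add: \<Gamma>.m_assoc \<Gamma>.cancel_left)
    finally have *: "\<gamma> (?F 0) \<otimes>\<^bsub>K\<^esub> \<gamma> (?F 2) = \<gamma> (?F 3) \<otimes>\<^bsub>K\<^esub> \<gamma> (?F 1)"
      by simp
    have sc: "singular_chain 2 Y (frag_of (?F k))" if "k \<le> 3" for k
      using F[OF that] by (simp add: singular_chain_of)
    have "c (chain_boundary 3 (frag_of \<rho>)) = \<gamma> (?F 0) \<otimes>\<^bsub>K\<^esub> inv\<^bsub>K\<^esub> \<gamma> (?F 1) \<otimes>\<^bsub>K\<^esub> \<gamma> (?F 2) \<otimes>\<^bsub>K\<^esub> inv\<^bsub>K\<^esub> \<gamma> (?F 3)"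
      unfolding chain_boundary_3
      using F by (simp add: hc sc singular_chain_diff singular_chain_add c(2) del: K_mult One_nat_def)
    also have "\<dots> = (\<gamma> (?F 0) \<otimes>\<^bsub>K\<^esub> \<gamma> (?F 2)) \<otimes>\<^bsub>K\<^esub> inv\<^bsub>K\<^esub> (\<gamma> (?F 3) \<otimes>\<^bsub>K\<^esub> \<gamma> (?F 1))"
      using \<gamma>F(1) by (simp add: K.inv_mult K.m_ac del: K_mult)
    also have "\<dots> = \<one>\<^bsub>K\<^esub>"
      unfolding * using \<gamma>F(1) by (simp add: K.r_inv del: K_mult)
    finally show ?case .
  qed
  \<comment> \<open>Along \<open>f\<close> the lift \<open>L\<close> is \<open>\<alpha>\<close>
    times the multiplicative \<open>\<Phi>\<close>, so its failure \<open>\<gamma>\<close> is there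
    the coboundary of \<open>\<alpha>\<close>.\<close>
  have ca: "c (chain_map 2 f e) = a (chain_boundary 2 e)" if "singular_chain 2 X e" for e
    using that
  proof (induction e rule: singular_chain_induct)
    case zero
    then show ?case using hc(2) ha(2) by simp
  next
    case (diff x y)
    have "singular_chain 2 Y (chain_map 2 f x)" "singular_chain 2 Y (chain_map 2 f y)"
      using diff(1,2) f singular_chain_chain_map by blast+
    moreover have "singular_chain 1 X (chain_boundary 2 x)" "singular_chain 1 X (chain_boundary 2 y)"
      using singular_chain_boundary[OF diff(1)] singular_chain_boundary[OF diff(2)] by simp_all
    ultimately show ?case
      unfolding chain_map_diff chain_boundary_diff using hc(4) ha(4) diff(3,4) by metis
  next
    case (of \<tau>)
    let ?F = "\<lambda>k. singular_face 2 k \<tau>"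
    have F: "singular_simplex 1 X (?F k)" if "k \<le> 2" for k
      using face[OF of that] .
    have fF: "singular_face 2 k (simplex_map 2 f \<tau>) = simplex_map 1 f (?F k)" if "k \<le> 2" for k
      using that singular_face_simplex_map[of 2 k f \<tau>]
      by (simp add: simplex_map_def singular_face_def fun_eq_iff restrict_def)
    have cl: "L (simplex_map 1 f (?F k)) \<in> carrier \<Gamma>" "\<Phi> (?F k) \<in> carrier \<Gamma>" "\<alpha> (?F k) \<in> carrier K" "\<alpha> (?F k) \<in> carrier \<Gamma>" if "k \<le> 2" for k
      using L(1)[OF fs[OF F[OF that]]] \<Phi>c[OF F[OF that]] \<alpha>[OF F[OF that]] Z by auto
    have La: "L (simplex_map 1 f (?F k)) = \<alpha> (?F k) \<otimes> \<Phi> (?F k)" if "k \<le> 2" for k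
      using cl[OF that] by (simp add: \<alpha>_def \<Gamma>.m_assoc)
    have \<Phi>F: "\<Phi> (?F 2) \<otimes> \<Phi> (?F 0) = \<Phi> (?F 1)"
      using \<Phi> of unfolding edge_functor_def by blast
    have cen: "\<Phi> (?F j) \<otimes> \<alpha> (?F k) = \<alpha> (?F k) \<otimes> \<Phi> (?F j)" if "j \<le> 2" "k \<le> 2" for j k
      using central[of "\<alpha> (?F k)" "\<Phi> (?F j)"] cl[OF that(1)] cl[OF that(2)] Z by simp
    have sc: "singular_chain 1 X (frag_of (?F k))" if "k \<le> 2" for k
      using F[OF that] by (simp add: singular_chain_of)
    have "c (chain_map 2 f (frag_of \<tau>)) = \<gamma> (simplex_map 2 f \<tau>)"
      using c(2)[OF fs[OF of]] by simp
    also have "\<dots> = \<alpha> (?F 2) \<otimes> \<Phi> (?F 2) \<otimes> (\<alpha> (?F 0) \<otimes> \<Phi> (?F 0)) \<otimes> inv (\<alpha> (?F 1) \<otimes> \<Phi> (?F 1))"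
      by (simp add: \<gamma>_def fF La del: One_nat_def)
    also have "\<alpha> (?F 2) \<otimes> \<Phi> (?F 2) \<otimes> (\<alpha> (?F 0) \<otimes> \<Phi> (?F 0))
        = \<alpha> (?F 2) \<otimes> (\<Phi> (?F 2) \<otimes> \<alpha> (?F 0)) \<otimes> \<Phi> (?F 0)"
      using cl by (simp add: \<Gamma>.m_assoc)
    also have "\<dots> = \<alpha> (?F 2) \<otimes> \<alpha> (?F 0) \<otimes> \<Phi> (?F 1)"
      using cl \<Phi>F by (simp add: cen \<Gamma>.m_assoc)
    also have "\<alpha> (?F 2) \<otimes> \<alpha> (?F 0) \<otimes> \<Phi> (?F 1) \<otimes> inv (\<alpha> (?F 1) \<otimes> \<Phi> (?F 1))
        = \<alpha> (?F 2) \<otimes> \<alpha> (?F 0) \<otimes> inv \<alpha> (?F 1)"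
      using cl by (simp add: \<Gamma>.m_assoc \<Gamma>.inv_mult_group \<Gamma>.cancel_left)
    also have "\<dots> = \<alpha> (?F 2) \<otimes>\<^bsub>K\<^esub> \<alpha> (?F 0) \<otimes>\<^bsub>K\<^esub> inv\<^bsub>K\<^esub> \<alpha> (?F 1)"
      using cl by (simp add: K_inv)
    also have "\<dots> = a (chain_boundary 2 (frag_of \<tau>))"
      unfolding chain_boundary_2
      using F cl by (simp add: ha sc singular_chain_diff a(2) K.m_ac del: K_mult One_nat_def)
    finally show ?case .
  qed
  obtain b where b: "b \<in> hom (chain_group 1 Y) K"
    "\<And>d. singular_chain 2 Y d \<Longrightarrow> b (chain_boundary 2 d) = c d"
    "\<And>z. singular_relcycle 1 X {} z \<Longrightarrow> b (chain_map 1 f z) = a z"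
    by (rule cocycle_extension[OF f H Y y0 K.comm_group_axioms a(1) c(1) c3 ca]) (assumption, assumption, rule that)
  note hb = chain_hom[OF b(1) K.is_group]
  \<comment> \<open>Dividing by \<open>b\<close> removes the defect \<open>\<gamma>\<close>. Along
    \<open>f\<close> the cochain \<open>b\<close> is known to equal \<open>\<alpha>\<close> on
    cycles, so \<open>\<Phi>\<close> is recovered on the 1-simplices that close up.\<close>
  define \<Lambda> where "\<Lambda> \<sigma> = inv b (frag_of \<sigma>) \<otimes> L \<sigma>" for \<sigma>
  have bK: "b (frag_of \<sigma>) \<in> carrier K" "b (frag_of \<sigma>) \<in> carrier \<Gamma>" if "singular_simplex 1 Y \<sigma>" for \<sigma>
    using hb(1)[of "frag_of \<sigma>"] that Z by (auto simp: singular_chain_of)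
  have "edge_functor Y \<Gamma> \<Lambda>"
    unfolding edge_functor_def
  proof (intro conjI allI impI)
    show "\<Lambda> \<sigma> \<in> carrier \<Gamma>" if "singular_simplex 1 Y \<sigma>" for \<sigma>
      using L(1)[OF that] bK[OF that] by (simp add: \<Lambda>_def)
    fix \<tau> :: "(nat \<Rightarrow> real) \<Rightarrow> 'b" assume \<tau>: "singular_simplex 2 Y \<tau>"
    let ?F = "\<lambda>k. singular_face 2 k \<tau>" and ?b = "\<lambda>k. b (frag_of (singular_face 2 k \<tau>))"
    have F: "singular_simplex 1 Y (?F k)" if "k \<le> 2" for k
      using face[OF \<tau> that] .
    have sc: "singular_chain 1 Y (frag_of (?F k))" if "k \<le> 2" for k
      using F[OF that] by (simp add: singular_chain_of)
    have cl: "L (?F k) \<in> carrier \<Gamma>" "?b k \<in> carrier K" "?b k \<in> carrier \<Gamma>" if "k \<le> 2" for k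
      using L(1)[OF F[OF that]] bK[OF F[OF that]] by auto
    have cen: "inv ?b j \<otimes> x = x \<otimes> inv ?b j" if "j \<le> 2" "x \<in> carrier \<Gamma>" for j x
      using central[of "inv ?b j" x] cl[OF that(1)] Z that(2) by simp
    have "\<gamma> \<tau> = b (chain_boundary 2 (frag_of \<tau>))"
      using b(2)[of "frag_of \<tau>"] c(2)[OF \<tau>] \<tau> by (simp add: singular_chain_of)
    also have "\<dots> = ?b 0 \<otimes>\<^bsub>K\<^esub> inv\<^bsub>K\<^esub> ?b 1 \<otimes>\<^bsub>K\<^esub> ?b 2"
      unfolding chain_boundary_2 by (simp add: hb sc singular_chain_diff del: K_mult One_nat_def)
    also have "\<dots> = ?b 2 \<otimes>\<^bsub>K\<^esub> ?b 0 \<otimes>\<^bsub>K\<^esub> inv\<^bsub>K\<^esub> ?b 1"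
      using cl by (simp add: K.m_ac del: K_mult)
    finally have "\<gamma> \<tau> = ?b 2 \<otimes> ?b 0 \<otimes> inv ?b 1"
      using cl by (simp add: K_inv)
    moreover have "L (?F 2) \<otimes> L (?F 0) = \<gamma> \<tau> \<otimes> L (?F 1)"
      using cl by (simp add: \<gamma>_def \<Gamma>.m_assoc)
    ultimately have LL: "L (?F 2) \<otimes> L (?F 0) = ?b 2 \<otimes> ?b 0 \<otimes> inv ?b 1 \<otimes> L (?F 1)"
      by simp
    have "\<Lambda> (?F 2) \<otimes> \<Lambda> (?F 0) = inv ?b 2 \<otimes> (L (?F 2) \<otimes> inv ?b 0) \<otimes> L (?F 0)"
      using cl by (simp add: \<Lambda>_def \<Gamma>.m_assoc)
    also have "\<dots> = inv ?b 2 \<otimes> inv ?b 0 \<otimes> (L (?F 2) \<otimes> L (?F 0))"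
      unfolding cen[of 0 "L (?F 2)", OF _ cl(1)[of 2], simplified, symmetric]
      using cl by (simp add: \<Gamma>.m_assoc)
    also have "\<dots> = inv ?b 0 \<otimes> inv ?b 2 \<otimes> (L (?F 2) \<otimes> L (?F 0))"
      using cl cen[of 0 "inv ?b 2"] by simp
    also have "\<dots> = inv ?b 1 \<otimes> L (?F 1)"
      unfolding LL using cl by (simp add: \<Gamma>.m_assoc \<Gamma>.cancel_left)
    finally show "\<Lambda> (?F 2) \<otimes> \<Lambda> (?F 0) = \<Lambda> (?F 1)"
      by (simp add: \<Lambda>_def)
  qed
  moreover have "\<Lambda> (simplex_map 1 f \<sigma>) = \<Phi> \<sigma>" if z: "singular_relcycle 1 X {} (frag_of \<sigma>)" for \<sigma>
  proof -
    have \<sigma>: "singular_simplex 1 X \<sigma>"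
      using z unfolding singular_cycle singular_chain_of by blast
    have "b (frag_of (simplex_map 1 f \<sigma>)) = \<alpha> \<sigma>"
      using b(3)[OF z] a(2)[OF \<sigma>] by (simp del: One_nat_def)
    then show ?thesis
      using L(1)[OF fs[OF \<sigma>]] \<Phi>c[OF \<sigma>]
      by (simp add: \<Lambda>_def \<alpha>_def \<Gamma>.inv_mult_group \<Gamma>.m_assoc \<Gamma>.cancel_left del: One_nat_def)
  qed
  ultimately show ?thesis by (rule that)
qed

section \<open>The lower central series\<close>

context group
begin

lemma comm_elt_closed [simp]:
  "a \<in> carrier G \<Longrightarrow> b \<in> carrier G \<Longrightarrow> comm_elt G a b \<in> carrier G"
  by (simp add: comm_elt_def)

lemma conj_comm_elt:
  assumes "x \<in> carrier G" "a \<in> carrier G" "b \<in> carrier G"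
  shows "x \<otimes> comm_elt G a b \<otimes> inv x = comm_elt G (x \<otimes> a \<otimes> inv x) (x \<otimes> b \<otimes> inv x)"
proof -
  have c: "inv x \<otimes> (x \<otimes> y) = y" if "y \<in> carrier G" for y
    using assms that by (simp flip: m_assoc)
  show ?thesis
    using assms by (simp add: comm_elt_def m_assoc inv_mult_group c)
qed

text \<open>\<open>[a,b] = (ab)(ba)^-1\<close>, and both products acquire the same central factor
  \<open>w z\<close>.\<close>

lemma comm_elt_central:
  assumes cl: "z \<in> carrier G" "x \<in> carrier G" "w \<in> carrier G" "y \<in> carrier G"
    and z: "\<And>v. v \<in> carrier G \<Longrightarrow> z \<otimes> v = v \<otimes> z" and w: "\<And>v. v \<in> carrier G \<Longrightarrow> w \<otimes> v = v \<otimes> w"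
  shows "comm_elt G (z \<otimes> x) (w \<otimes> y) = comm_elt G x y"
proof -
  let ?c = "w \<otimes> z"
  have 1: "z \<otimes> x \<otimes> (w \<otimes> y) = ?c \<otimes> (x \<otimes> y)"
    using cl w[of "z \<otimes> x"] by (simp flip: m_assoc)
  have "w \<otimes> y \<otimes> (z \<otimes> x) = w \<otimes> (y \<otimes> z) \<otimes> x"
    using cl by (simp add: m_assoc)
  also have "\<dots> = ?c \<otimes> (y \<otimes> x)"
    using cl by (simp add: z[OF cl(4), symmetric] m_assoc)
  finally have 2: "w \<otimes> y \<otimes> (z \<otimes> x) = ?c \<otimes> (y \<otimes> x)" .
  have c: "?c \<otimes> r = r \<otimes> ?c" if "r \<in> carrier G" for r
    using cl that z[OF that] w[OF that] by (metis m_assoc)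
  have "a \<otimes> b \<otimes> inv a \<otimes> inv b = (a \<otimes> b) \<otimes> inv (b \<otimes> a)" if "a \<in> carrier G" "b \<in> carrier G" for a b
    using that by (simp add: inv_mult_group m_assoc)
  from this[of "z \<otimes> x" "w \<otimes> y"]
  have "comm_elt G (z \<otimes> x) (w \<otimes> y) = (?c \<otimes> (x \<otimes> y)) \<otimes> inv (?c \<otimes> (y \<otimes> x))"
    unfolding comm_elt_def 1 2 using cl by simp
  also have "\<dots> = (x \<otimes> y \<otimes> ?c) \<otimes> inv (y \<otimes> x \<otimes> ?c)"
    using cl c by simp
  also have "\<dots> = x \<otimes> y \<otimes> (?c \<otimes> inv ?c) \<otimes> inv (y \<otimes> x)"
    using cl by (simp add: inv_mult_group m_assoc del: r_inv)
  also have "\<dots> = comm_elt G x y"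
    unfolding r_inv[OF m_closed[OF cl(3,1)]] using cl by (simp add: comm_elt_def inv_mult_group m_assoc)
  finally show ?thesis .
qed

text \<open>Conjugation maps the generating commutators to generating commutators, by
  \<open>conj_comm_elt\<close> and normality of the preceding term.\<close>

lemma lcs_normal: "lcs G k \<lhd> G"
proof (induction k)
  case (Suc n)
  show ?case
  proof (cases n)
    case 0
    then show ?thesis by (simp add: normal_self)
  next
    case k: (Suc k)
  let ?S = "{comm_elt G a b | a b. a \<in> carrier G \<and> b \<in> lcs G (Suc k)}"
  interpret N: normal "lcs G (Suc k)" G using Suc k by simp
  have "x \<otimes> h \<otimes> inv x \<in> ?S" if h: "h \<in> ?S" and x: "x \<in> carrier G" for x h
  proof -
    obtain a b where ab: "h = comm_elt G a b" "a \<in> carrier G" "b \<in> lcs G (Suc k)"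
      using h by blast
    have "x \<otimes> b \<otimes> inv x \<in> lcs G (Suc k)"
      using N.inv_op_closed2 x ab(3) .
    moreover have "x \<otimes> h \<otimes> inv x = comm_elt G (x \<otimes> a \<otimes> inv x) (x \<otimes> b \<otimes> inv x)"
      using ab x by (simp add: conj_comm_elt)
    moreover have "x \<otimes> a \<otimes> inv x \<in> carrier G"
      using ab x by simp
    ultimately show ?thesis by blast
  qed
  moreover have "?S \<subseteq> carrier G"
    by auto
  ultimately have "generate G ?S \<lhd> G"
    by (intro normal_generateI)
  then show ?thesis using k by simp
  qed
qed (simp add: normal_self)

lemma lcs_subgroup: "subgroup (lcs G k) G"
  using lcs_normal normal_imp_subgroup by blast

lemma lcs_closed: "x \<in> lcs G k \<Longrightarrow> x \<in> carrier G"
  using lcs_subgroup subgroup.mem_carrier by metis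

lemma comm_elt_in_lcs:
  assumes "1 \<le> k" "a \<in> carrier G" "b \<in> lcs G k"
  shows "comm_elt G a b \<in> lcs G (Suc k)"
  using assms by (cases k) (auto intro!: generate.incl)

text \<open>\<open>[a,b] = (a b a^-1) b^-1\<close> is a product of two elements of a normal subgroup
  that contains \<open>b\<close>.\<close>

lemma lcs_Suc_subset: "lcs G (Suc k) \<subseteq> lcs G k"
proof (cases k)
  case (Suc m)
  interpret N: normal "lcs G k" G by (rule lcs_normal)
  have "{comm_elt G a b | a b. a \<in> carrier G \<and> b \<in> lcs G k} \<subseteq> lcs G k"
    using N.inv_op_closed2 by (auto simp: comm_elt_def)
  then show ?thesis
    using generate_subgroup_incl[OF _ N.subgroup_axioms] Suc by simp
qed simp

lemma coset_eqI:
  assumes "N \<lhd> G" "x \<in> carrier G" "z \<in> N"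
  shows "N #> (z \<otimes> x) = N #> x" "N #> (x \<otimes> z) = N #> x"
proof -
  interpret N: normal N G by fact
  show "N #> (z \<otimes> x) = N #> x"
    using assms by (metis N.mem_carrier N.rcos_const N.subset coset_mult_assoc is_group)
  have "x \<otimes> z = (x \<otimes> z \<otimes> inv x) \<otimes> x"
    using assms N.mem_carrier by (simp add: m_assoc)
  then show "N #> (x \<otimes> z) = N #> x"
    using assms N.inv_op_closed2[OF assms(2,3)]
    by (metis N.mem_carrier N.rcos_const N.subset coset_mult_assoc is_group)
qed

lemma group_nil_quot: "group (nil_quot G k)"
  using lcs_normal by (rule normal.factorgroup_is_group)

lemma coset_hom: "(\<lambda>x. lcs G k #> x) \<in> hom G (nil_quot G k)"
  using lcs_normal by (rule normal.r_coset_hom_Mod)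

lemma coset_eq_iff:
  assumes "N \<lhd> G" "x \<in> carrier G" "y \<in> carrier G"
  shows "N #> x = N #> y \<longleftrightarrow> (\<exists>z\<in>N. x = z \<otimes> y)"
proof -
  interpret N: normal N G by fact
  show ?thesis
  proof
    assume "N #> x = N #> y"
    then have "x \<in> N #> y"
      using rcos_self[OF assms(2) N.subgroup_axioms] by simp
    then show "\<exists>z\<in>N. x = z \<otimes> y"
      by (auto simp: r_coset_def)
  next
    assume "\<exists>z\<in>N. x = z \<otimes> y"
    then show "N #> x = N #> y"
      using coset_eqI(1)[OF assms(1,3)] by auto
  qed
qed

text \<open>Since \<open>[x,z] z x = x z\<close>. This is what makes
  \<open>G/G_{k+1} -> G/G_k\<close> a central extension.\<close>

lemma coset_commute:
  assumes "1 \<le> k" "z \<in> lcs G k" "x \<in> carrier G"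
  shows "lcs G (Suc k) #> (z \<otimes> x) = lcs G (Suc k) #> (x \<otimes> z)"
proof -
  have z: "z \<in> carrier G" using lcs_closed assms(2) .
  have "comm_elt G x z \<otimes> (z \<otimes> x) = x \<otimes> z"
    using assms(3) z by (simp add: comm_elt_def m_assoc) (simp flip: m_assoc)
  then show ?thesis
    using coset_eqI(1)[OF lcs_normal, of "z \<otimes> x" "comm_elt G x z" "Suc k"]
      comm_elt_in_lcs[OF assms(1,3,2)] assms(3) z by simp
qed

text \<open>Multiplying cosets by \<open>M\<close> is the projection \<open>G/N -> G/M\<close>; the
  projections between successive nilpotent quotients in Stallings' theorem are written in this
  form.\<close>

lemma coset_set_mult:
  assumes "N \<lhd> G" "M \<lhd> G" "N \<subseteq> M" "x \<in> carrier G"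
  shows "M <#> (N #> x) = M #> x"
proof -
  interpret N: normal N G by fact
  interpret M: normal M G by fact
  have "M <#> (N #> x) = (M <#> N) #> x"
    using setmult_rcos_assoc[OF M.subset N.subset assms(4)] by simp
  also have "M <#> N = M"
    using assms(3) M.m_closed N.one_closed M.mem_carrier
    by (force simp: set_mult_def)
  finally show ?thesis .
qed

end

lemma hom_comm_elt:
  assumes "group_hom G H f" "a \<in> carrier G" "b \<in> carrier G"
  shows "f (comm_elt G a b) = comm_elt H (f a) (f b)"
proof -
  interpret group_hom G H f by fact
  show ?thesis using assms(2,3) by (simp add: comm_elt_def)
qed

lemma hom_lcs:
  assumes "group_hom G H f" "x \<in> lcs G k"
  shows "f x \<in> lcs H k"
proof -
  interpret group_hom G H f by fact
  have "f ` lcs G k \<subseteq> lcs H k"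
  proof (induction k)
    case (Suc n)
    show ?case
    proof (cases n)
      case 0
      then show ?thesis by auto
    next
      case k: (Suc k)
    let ?S = "{comm_elt G a b | a b. a \<in> carrier G \<and> b \<in> lcs G (Suc k)}"
    have S: "?S \<subseteq> carrier G"
      using G.lcs_closed by auto
    have "f ` generate G ?S = generate H (f ` ?S)"
      using generate_img[OF S] by simp
    moreover have "f ` ?S \<subseteq> {comm_elt H a b | a b. a \<in> carrier H \<and> b \<in> lcs H (Suc k)}"
      using Suc k G.lcs_closed by (fastforce simp: hom_comm_elt[OF assms(1)])
    ultimately show ?thesis
      using H.mono_generate k by simp
    qed
  qed auto
  then show ?thesis using assms(2) by blast
qed

text \<open>\<open>f\<close> respects the lower central series, so the image of a coset lies in a
  single coset, and multiplication by \<open>lcs H q\<close> fills that coset.\<close>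

lemma nil_quot_map_coset:
  assumes "group_hom G H f" "x \<in> carrier G"
  shows "nil_quot_map H q f (lcs G q #>\<^bsub>G\<^esub> x) = lcs H q #>\<^bsub>H\<^esub> f x"
proof -
  interpret group_hom G H f by fact
  interpret N: normal "lcs H q" H by (rule H.lcs_normal)
  have fx: "f x \<in> carrier H" using assms(2) by simp
  have img: "f ` (lcs G q #>\<^bsub>G\<^esub> x) \<subseteq> lcs H q #>\<^bsub>H\<^esub> f x"
    using hom_lcs[OF assms(1)] G.lcs_closed assms(2) by (force simp: r_coset_def)
  have "f x \<in> f ` (lcs G q #>\<^bsub>G\<^esub> x)"
    using G.rcos_self[OF assms(2) G.lcs_subgroup] by blast
  then have "lcs H q #>\<^bsub>H\<^esub> f x \<subseteq> lcs H q <#>\<^bsub>H\<^esub> f ` (lcs G q #>\<^bsub>G\<^esub> x)"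
    unfolding r_coset_def[of H] set_mult_def by blast
  moreover have "lcs H q <#>\<^bsub>H\<^esub> f ` (lcs G q #>\<^bsub>G\<^esub> x) \<subseteq> lcs H q <#>\<^bsub>H\<^esub> (lcs H q #>\<^bsub>H\<^esub> f x)"
    using img by (auto simp: set_mult_def)
  ultimately show ?thesis
    using H.coset_set_mult[OF H.lcs_normal H.lcs_normal order.refl fx, of q]
    by (simp add: nil_quot_map_def)
qed

lemma nil_quot_map_hom:
  assumes "group_hom G H f"
  shows "nil_quot_map H q f \<in> hom (nil_quot G q) (nil_quot H q)"
proof -
  interpret group_hom G H f by fact
  interpret NG: normal "lcs G q" G by (rule G.lcs_normal)
  interpret NH: normal "lcs H q" H by (rule H.lcs_normal)
  show ?thesis
  proof (rule homI)
    fix C assume "C \<in> carrier (nil_quot G q)"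
    then obtain x where "x \<in> carrier G" "C = lcs G q #>\<^bsub>G\<^esub> x"
      by (auto simp: carrier_FactGroup)
    then show "nil_quot_map H q f C \<in> carrier (nil_quot H q)"
      by (auto simp: nil_quot_map_coset[OF assms] carrier_FactGroup)
  next
    fix C D assume "C \<in> carrier (nil_quot G q)" "D \<in> carrier (nil_quot G q)"
    then obtain x y where "x \<in> carrier G" "C = lcs G q #>\<^bsub>G\<^esub> x" "y \<in> carrier G" "D = lcs G q #>\<^bsub>G\<^esub> y"
      by (auto simp: carrier_FactGroup)
    then show "nil_quot_map H q f (C \<otimes>\<^bsub>nil_quot G q\<^esub> D) = nil_quot_map H q f C \<otimes>\<^bsub>nil_quot H q\<^esub> nil_quot_map H q f D"
      by (simp add: NG.rcos_sum NH.rcos_sum nil_quot_map_coset[OF assms])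
  qed
qed

lemma nil_quot_map_comp:
  assumes f: "group_hom F A f" and g: "group_hom A B g" and h: "group_hom F B h"
    and C: "C \<in> carrier (nil_quot F q)" and gf: "\<And>x. x \<in> carrier F \<Longrightarrow> g (f x) = h x"
  shows "nil_quot_map B q g (nil_quot_map A q f C) = nil_quot_map B q h C"
proof -
  interpret group_hom F A f by fact
  obtain x where "x \<in> carrier F" "C = lcs F q #>\<^bsub>F\<^esub> x"
    using C by (auto simp: carrier_FactGroup)
  then show ?thesis
    using gf by (simp add: nil_quot_map_coset[OF f] nil_quot_map_coset[OF g] nil_quot_map_coset[OF h])
qed

text \<open>A subgroup generating a nilpotent group modulo commutators is the whole group: modulo \<open>G\<^sub>k\<^sub>+\<^sub>1\<close> the
  elements of \<open>G\<^sub>k\<close> are central, so commutators of \<open>G\<close> are commutators of elements of the image.\<close>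

lemma surj_mod_lcs:
  fixes A (structure)
  assumes h: "group_hom F A h"
    and gen: "\<And>a. a \<in> carrier A \<Longrightarrow> \<exists>x\<in>carrier F. \<exists>z\<in>lcs A 2. a = z \<otimes> h x"
    and "1 \<le> k" "a \<in> carrier A"
  shows "\<exists>x\<in>carrier F. \<exists>z\<in>lcs A k. a = z \<otimes> h x"
  using \<open>1 \<le> k\<close> \<open>a \<in> carrier A\<close>
proof (induction k arbitrary: a rule: dec_induct)
  case base
  interpret group_hom F A h by fact
  show ?case
    using base by (intro bexI[of _ "\<one>\<^bsub>F\<^esub>"] bexI[of _ a]) simp_all
next
  case (step k)
  interpret group_hom F A h by fact
  interpret N: normal "lcs A (Suc k)" A by (rule H.lcs_normal)
  let ?N = "lcs A (Suc k)" and ?Q = "nil_quot A (Suc k)"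
  interpret q: group_hom A ?Q "\<lambda>x. ?N #> x"
    by (intro group_hom.intro group_hom_axioms.intro H.coset_hom H.group_nil_quot H.is_group)
  \<comment> \<open>\<open>S\<close> consists of the elements that come from \<open>F\<close> modulo
    the next term of the series. Once it contains all commutators it contains
    \<open>lcs A 2\<close>, and \<open>gen\<close> then makes it everything.\<close>
  define S where "S = {a \<in> carrier A. \<exists>x\<in>carrier F. ?N #> a = ?N #> h x}"
  have "subgroup S A"
  proof
    show "\<one> \<in> S"
      unfolding S_def by (auto intro!: bexI[of _ "\<one>\<^bsub>F\<^esub>"])
    fix a b assume "a \<in> S" "b \<in> S"
    then obtain x y where "a \<in> carrier A" "b \<in> carrier A" "x \<in> carrier F" "y \<in> carrier F"
      "?N #> a = ?N #> h x" "?N #> b = ?N #> h y"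
      unfolding S_def by blast
    then show "a \<otimes> b \<in> S"
      unfolding S_def using q.hom_mult by (auto intro!: bexI[of _ "x \<otimes>\<^bsub>F\<^esub> y"] simp del: mult_FactGroup)
  next
    fix a assume "a \<in> S"
    then obtain x where "a \<in> carrier A" "x \<in> carrier F" "?N #> a = ?N #> h x"
      unfolding S_def by blast
    then show "inv a \<in> S"
      unfolding S_def using q.hom_inv[of a] q.hom_inv[of "h x"] by (auto intro!: bexI[of _ "inv\<^bsub>F\<^esub> x"])
  qed (auto simp: S_def)
  moreover have "{comm_elt A a b | a b. a \<in> carrier A \<and> b \<in> carrier A} \<subseteq> S"
  proof clarify
    fix a b assume ab: "a \<in> carrier A" "b \<in> carrier A"
    obtain x z where a: "x \<in> carrier F" "z \<in> lcs A k" "a = z \<otimes> h x"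
      using step.IH[OF ab(1)] by blast
    obtain y w where b: "y \<in> carrier F" "w \<in> lcs A k" "b = w \<otimes> h y"
      using step.IH[OF ab(2)] by blast
    let ?q = "\<lambda>x. ?N #> x"
    have zw: "z \<in> carrier A" "w \<in> carrier A"
      using a(2) b(2) H.lcs_closed by auto
    have central: "?q u \<otimes>\<^bsub>?Q\<^esub> ?q v = ?q v \<otimes>\<^bsub>?Q\<^esub> ?q u" if "u \<in> lcs A k" "v \<in> carrier A" for u v
      using H.coset_commute[OF _ that] step.hyps(1) that H.lcs_closed[OF that(1)] q.hom_mult by metis
    have cz: "?q z \<otimes>\<^bsub>?Q\<^esub> v = v \<otimes>\<^bsub>?Q\<^esub> ?q z" "?q w \<otimes>\<^bsub>?Q\<^esub> v = v \<otimes>\<^bsub>?Q\<^esub> ?q w" if "v \<in> carrier ?Q" for v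
      using that central[OF a(2)] central[OF b(2)] by (auto simp: carrier_FactGroup)
    have "?q (comm_elt A a b) = comm_elt ?Q (?q z \<otimes>\<^bsub>?Q\<^esub> ?q (h x)) (?q w \<otimes>\<^bsub>?Q\<^esub> ?q (h y))"
      using hom_comm_elt[OF q.group_hom_axioms ab] a b zw by (simp add: q.hom_mult del: mult_FactGroup)
    also have "\<dots> = comm_elt ?Q (?q (h x)) (?q (h y))"
      using a b zw cz by (intro q.H.comm_elt_central) (simp_all del: mult_FactGroup)
    also have "\<dots> = ?q (h (comm_elt F x y))"
      using a b hom_comm_elt[OF q.group_hom_axioms] hom_comm_elt[OF h] by simp
    finally show "comm_elt A a b \<in> S"
      unfolding S_def using ab a(1) b(1) by auto
  qed
  ultimately have A2: "lcs A 2 \<subseteq> S"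
    using H.generate_subgroup_incl by (simp add: numeral_2_eq_2)
  obtain x z where a: "x \<in> carrier F" "z \<in> lcs A 2" "a = z \<otimes> h x"
    using gen[OF step.prems] by blast
  moreover have "h x \<in> S"
    using a(1) by (auto simp: S_def)
  ultimately have "a \<in> S"
    using A2 subgroup.m_closed[OF \<open>subgroup S A\<close>] by blast
  then show ?case
    using H.coset_eq_iff[OF H.lcs_normal] by (auto simp: S_def)
qed

section \<open>Stallings' theorem\<close>

lemma lcs_surj:
  assumes "group_hom G H f" "f ` carrier G = carrier H"
  shows "lcs H k \<subseteq> f ` lcs G k"
proof -
  interpret group_hom G H f by fact
  show ?thesis
  proof (induction k)
    case (Suc n)
    show ?case
    proof (cases n)
      case 0
      then show ?thesis using assms(2) by simp
    next
      case k: (Suc k)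
      let ?S = "{comm_elt G a b | a b. a \<in> carrier G \<and> b \<in> lcs G (Suc k)}"
      have S: "?S \<subseteq> carrier G"
        using G.lcs_closed by auto
      have "{comm_elt H a b | a b. a \<in> carrier H \<and> b \<in> lcs H (Suc k)} \<subseteq> f ` ?S"
      proof clarify
        fix a b assume "a \<in> carrier H" "b \<in> lcs H (Suc k)"
        then obtain x y where xy: "x \<in> carrier G" "a = f x" "y \<in> lcs G (Suc k)" "b = f y"
          using assms(2) Suc k by blast
        then have "comm_elt H a b = f (comm_elt G x y)"
          using hom_comm_elt[OF assms(1)] G.lcs_closed by simp
        moreover have "comm_elt G x y \<in> ?S"
          using xy by blast
        ultimately show "comm_elt H a b \<in> f ` ?S"
          by simp
      qed
      then have "generate H {comm_elt H a b | a b. a \<in> carrier H \<and> b \<in> lcs H (Suc k)} \<subseteq> generate H (f ` ?S)"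
        by (rule H.mono_generate)
      also have "\<dots> = f ` generate G ?S"
        using generate_img[OF S] by simp
      finally show ?thesis using k by simp
    qed
  qed (use assms(2) in simp)
qed

text \<open>The k-th term of a quotient is the image of the k-th term, here the image of
  \<open>G_k\<close> in \<open>G/G_k\<close>. In the injectivity arguments this kills differences
  that lie in the lower central series.\<close>

lemma (in group) lcs_nil_quot: "lcs (nil_quot G k) k \<subseteq> {\<one>\<^bsub>nil_quot G k\<^esub>}"
proof -
  interpret q: group_hom G "nil_quot G k" "\<lambda>x. lcs G k #> x"
    by (intro group_hom.intro group_hom_axioms.intro coset_hom group_nil_quot is_group)
  have "lcs (nil_quot G k) k \<subseteq> (\<lambda>x. lcs G k #> x) ` lcs G k"
    by (rule lcs_surj[OF q.group_hom_axioms]) (simp add: carrier_FactGroup)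
  then show ?thesis
    using coset_join2[OF lcs_closed lcs_subgroup] by auto
qed

text \<open>A gauge transformation: on loops it is a mere conjugation, while on other paths it
  changes the value freely. It turns agreement on loops into agreement on paths.\<close>

lemma path_functor_conj:
  fixes G (structure)
  assumes E: "path_functor X G E" and G: "group G" and d: "\<And>x. x \<in> topspace X \<Longrightarrow> d x \<in> carrier G"
  shows "path_functor X G (\<lambda>p. inv d (p 0) \<otimes> E p \<otimes> d (p 1))"
proof -
  interpret group G by fact
  note cl = path_functorD(1)[OF E] d[OF path_start_in_topspace] d[OF path_finish_in_topspace]
  show ?thesis
    unfolding path_functor_def
  proof (intro conjI allI impI)
    show "inv d (p 0) \<otimes> E p \<otimes> d (p 1) \<in> carrier G" if "pathin X p" for p
      using cl[OF that] by simp
    show "inv d (join_path p q 0) \<otimes> E (join_path p q) \<otimes> d (join_path p q 1)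
        = inv d (p 0) \<otimes> E p \<otimes> d (p 1) \<otimes> (inv d (q 0) \<otimes> E q \<otimes> d (q 1))"
      if "pathin X p" "pathin X q" "p 1 = q 0" for p q
      using cl[OF that(1)] cl[OF that(2)] path_functorD(2)[OF E that] that(3)
      by (simp add: m_assoc cancel_left)
    show "inv d (p 0) \<otimes> E p \<otimes> d (p 1) = inv d (q 0) \<otimes> E q \<otimes> d (q 1)" if "path_homotopic X p q" for p q
      using path_functorD(3)[OF E that] path_homotopic_ends[OF that] by simp
  qed
qed

lemma path_functor_image:
  assumes "path_functor Y G E" "continuous_map X Y f"
  shows "path_functor X G (\<lambda>p. E (f \<circ> p))"
  unfolding path_functor_def
proof (intro conjI allI impI)
  show "E (f \<circ> p) = E (f \<circ> q)" if "path_homotopic X p q" for p q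
    using path_functorD(3)[OF assms(1) path_homotopic_image[OF that assms(2)]] .
qed (use path_functorD[OF assms(1)] pathin_compose[OF _ assms(2)] in \<open>simp_all add: comp_join_path\<close>)

lemma simplex_path_simplex_map:
  "t \<in> {0..1} \<Longrightarrow> simplex_path (simplex_map 1 f \<sigma>) t = f (simplex_path \<sigma> t)"
  using vec3_in_simplex1 by (simp add: simplex_path_def simplex_map_def)

lemma path_simplex_comp: "path_simplex (f \<circ> p) = simplex_map 1 f (path_simplex p)"
  by (auto simp: path_simplex_def simplex_map_def)

text \<open>Recovers the value on a path from the closed-up loop and the two connecting paths, so
  that a hypothesis about loops can be applied.\<close>

lemma path_functor_based:
  fixes G (structure)
  assumes E: "path_functor Y G E" and G: "group G" and f: "continuous_map X Y f"
    and c: "based_paths X x c" and p: "pathin X p"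
  shows "E (f \<circ> p) = inv E (f \<circ> c (p 0)) \<otimes>
      E (f \<circ> join_path (c (p 0)) (join_path p (reverse_path (c (p 1))))) \<otimes> E (f \<circ> c (p 1))"
proof -
  interpret group G by fact
  have F: "path_functor X G (\<lambda>p. E (f \<circ> p))"
    using path_functor_image[OF E f] .
  have "path_between X x (p 0) (c (p 0))" "path_between X x (p 1) (c (p 1))"
    using c path_start_in_topspace[OF p] path_finish_in_topspace[OF p] by (auto simp: based_paths_def)
  note c01 = path_betweenD[OF this(1)] path_betweenD[OF this(2)]
  have cl: "E (f \<circ> p) \<in> carrier G" "E (f \<circ> c (p 0)) \<in> carrier G" "E (f \<circ> c (p 1)) \<in> carrier G"
    using path_functorD(1)[OF F] c01 p by auto
  have "E (f \<circ> join_path (c (p 0)) (join_path p (reverse_path (c (p 1)))))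
      = E (f \<circ> c (p 0)) \<otimes> (E (f \<circ> p) \<otimes> E (f \<circ> reverse_path (c (p 1))))"
    using path_functorD(2)[OF F] c01 p by (simp add: pathin_join pathin_reverse)
  moreover have "E (f \<circ> reverse_path (c (p 1))) = inv E (f \<circ> c (p 1))"
    using path_functor_reverse[OF F G] c01 by simp
  ultimately show ?thesis
    using cl by (simp add: m_assoc cancel_left)
qed

lemma based_loop:
  assumes c: "based_paths X x c" and p: "pathin X p"
  shows "path_between X x x (join_path (c (p 0)) (join_path p (reverse_path (c (p 1)))))"
proof -
  have "path_between X x (p 0) (c (p 0))" "path_between X x (p 1) (c (p 1))"
    using c path_start_in_topspace[OF p] path_finish_in_topspace[OF p] by (auto simp: based_paths_def)
  then show ?thesis
    using p by (intro path_between_join[of X x "p 0"] path_between_join[of X "p 0" "p 1"] path_between_reverse)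
      (auto simp: path_between_def)
qed

text \<open>\<open>central_lift\<close> asks for compatibility on all 1-simplices, whereas the
  extensions of \<open>\<phi>\<close> and \<open>\<psi>\<close> to paths rest on unrelated base
  paths in \<open>X\<close> and \<open>Y\<close>. Lifting the discrepancy to \<open>\<Gamma>\<close>
  and conjugating by it repairs this.\<close>

lemma hom_central_lift:
  fixes \<Gamma> (structure)
  assumes f: "continuous_map X Y f" and H: "homology_iso X Y f"
    and X: "path_connected_space X" and Y: "path_connected_space Y"
    and x0: "x0 \<in> topspace X" and y0: "y0 = f x0"
    and \<Gamma>: "group \<Gamma>" and Q: "group Q" and pr: "pr \<in> hom \<Gamma> Q" and surj: "pr ` carrier \<Gamma> = carrier Q"
    and central: "\<And>z x. z \<in> carrier \<Gamma> \<Longrightarrow> pr z = \<one>\<^bsub>Q\<^esub> \<Longrightarrow> x \<in> carrier \<Gamma> \<Longrightarrow> z \<otimes> x = x \<otimes> z"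
    and \<phi>: "\<phi> \<in> hom (pi1 X x0) \<Gamma>" and \<psi>: "\<psi> \<in> hom (pi1 Y y0) Q"
    and comp: "\<And>a. a \<in> carrier (pi1 X x0) \<Longrightarrow> \<psi> (pi1_map Y f a) = pr (\<phi> a)"
  obtains \<psi>' where "\<psi>' \<in> hom (pi1 Y y0) \<Gamma>" "\<And>a. a \<in> carrier (pi1 X x0) \<Longrightarrow> \<psi>' (pi1_map Y f a) = \<phi> a"
proof -
  interpret \<Gamma>: group \<Gamma> by fact
  interpret Q: group Q by fact
  interpret pr: group_hom \<Gamma> Q pr
    using pr by unfold_locales
  have y0': "y0 \<in> topspace Y"
    using f x0 y0 by (auto simp: continuous_map_def)
  obtain c where c: "based_paths X x0 c"
    by (rule based_pathsE[OF X x0])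
  obtain c' where c': "based_paths Y y0 c'"
    by (rule based_pathsE[OF Y y0'])
  obtain U where U: "path_functor X \<Gamma> U"
    "\<And>p. U p = \<phi> (path_class X (join_path (c (p 0)) (join_path p (reverse_path (c (p 1))))))"
    "\<And>p. path_between X x0 x0 p \<Longrightarrow> U p = \<phi> (path_class X p)"
    using hom_imp_path_functor[OF x0 \<Gamma> \<phi> c] by blast
  obtain V where V: "path_functor Y Q V" "\<And>p. path_between Y y0 y0 p \<Longrightarrow> V p = \<psi> (path_class Y p)"
    using hom_imp_path_functor[OF y0' Q \<psi> c'] by blast
  have cx: "path_between X x0 x (c x)" if "x \<in> topspace X" for x
    using c that by (simp add: based_paths_def)
  have fcl: "V (f \<circ> c x) \<in> carrier Q" if "x \<in> topspace X" for x
    using path_functorD(1)[OF V(1)] pathin_compose[OF path_betweenD(1)[OF cx[OF that]] f] .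
  \<comment> \<open>Lifts of the values of \<open>V\<close> on the images of the base paths. The
    lift at \<open>x0\<close> is the unit, so that the correction leaves loops at \<open>x0\<close>
    alone.\<close>
  have "\<exists>g\<in>carrier \<Gamma>. pr g = V (f \<circ> c x) \<and> (x = x0 \<longrightarrow> g = \<one>)" if x: "x \<in> topspace X" for x
  proof (cases "x = x0")
    case True
    have "f \<circ> c x0 = (\<lambda>t. y0)"
      using c y0 by (simp add: based_paths_def o_def)
    then show ?thesis
      using True path_functor_const[OF V(1) Q y0'] by (intro bexI[of _ "\<one>"]) simp_all
  next
    case False
    then show ?thesis
      using fcl[OF x] surj by (metis imageE)
  qed
  then obtain d where d: "\<And>x. x \<in> topspace X \<Longrightarrow> d x \<in> carrier \<Gamma>" "\<And>x. x \<in> topspace X \<Longrightarrow> pr (d x) = V (f \<circ> c x)"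
    "d x0 = \<one>"
    using x0 by metis
  define E where "E p = inv d (p 0) \<otimes> U p \<otimes> d (p 1)" for p
  have E: "path_functor X \<Gamma> E"
    unfolding E_def using path_functor_conj[OF U(1) \<Gamma> d(1)] .
  have prE: "pr (E p) = V (f \<circ> p)" if p: "pathin X p" for p
  proof -
    let ?J = "join_path (c (p 0)) (join_path p (reverse_path (c (p 1))))"
    note J = based_loop[OF c p]
    have "V (f \<circ> ?J) = pr (U p)"
      using V(2)[OF path_between_image[OF J f, folded y0]] comp[OF path_class_in_pi1[OF J]]
        pi1_map_path_class[OF path_betweenD(1)[OF J] f] U(2)[of p] by simp
    then show ?thesis
      using path_functor_based[OF V(1) Q f c p] d path_functorD(1)[OF U(1) p]
        path_start_in_topspace[OF p] path_finish_in_topspace[OF p] by (simp add: E_def)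
  qed
  note edU = path_functor_edge[OF E] and edV = path_functor_edge[OF V(1)]
  have compE: "pr (E (simplex_path \<sigma>)) = V (simplex_path (simplex_map 1 f \<sigma>))" if "singular_simplex 1 X \<sigma>" for \<sigma>
  proof -
    note p = pathin_simplex_path[OF that]
    have "path_homotopic Y (f \<circ> simplex_path \<sigma>) (simplex_path (simplex_map 1 f \<sigma>))"
      using simplex_path_simplex_map[of _ f \<sigma>] by (intro path_homotopic_eq pathin_compose[OF p f]) auto
    then show ?thesis
      using prE[OF p] path_functorD(3)[OF V(1)] by simp
  qed
  obtain \<Lambda> where \<Lambda>: "edge_functor Y \<Gamma> \<Lambda>"
    "\<And>\<sigma>. singular_relcycle 1 X {} (frag_of \<sigma>) \<Longrightarrow> \<Lambda> (simplex_map 1 f \<sigma>) = E (simplex_path \<sigma>)"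
    by (rule central_lift[OF f H Y y0' \<Gamma> Q pr surj central edU edV compE]) (assumption, assumption, assumption, assumption, rule that)
  obtain \<psi>' where \<psi>': "\<psi>' \<in> hom (pi1 Y y0) \<Gamma>"
    "\<And>p. path_between Y y0 y0 p \<Longrightarrow> \<psi>' (path_class Y p) = \<Lambda> (path_simplex p)"
    by (rule path_functor_imp_hom[OF edge_functor_path[OF \<Lambda>(1) \<Gamma>], of y0]) (rule that)
  have "\<psi>' (pi1_map Y f a) = \<phi> a" if a: "a \<in> carrier (pi1 X x0)" for a
  proof -
    obtain p where p: "path_between X x0 x0 p" "a = path_class X p"
      by (rule pi1_E[OF a])
    note pb = path_betweenD[OF p(1)]
    have "singular_relcycle 1 X {} (frag_of (path_simplex p))"
      using singular_simplex_path_simplex[OF pb(1)] chain_boundary_path_simplex[of p] pb(2,3)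
      by (simp add: singular_cycle singular_chain_of)
    then have "\<psi>' (path_class Y (f \<circ> p)) = E (simplex_path (path_simplex p))"
      using \<psi>'(2)[OF path_between_image[OF p(1) f, folded y0]] \<Lambda>(2) by (simp add: path_simplex_comp)
    also have "\<dots> = E p"
      using path_functorD(3)[OF E path_homotopic_eq[OF pb(1)], of "simplex_path (path_simplex p)"]
      by (simp add: simplex_path_path_simplex)
    also have "\<dots> = \<phi> a"
      using U(3)[OF p(1)] p(2) pb d(3) path_functorD(1)[OF U(1) pb(1)] by (simp add: E_def)
    finally show ?thesis
      using p(2) pi1_map_path_class[OF pb(1) f] by simp
  qed
  with \<psi>'(1) show ?thesis by (rule that)
qed

text \<open>\<open>\<Gamma>\<close> is kept general: Stallings' theorem takes
  \<open>\<pi>\<^sub>1(X)\<close> with the identity, the product of cylinders takes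
  \<open>\<pi>\<^sub>1(M)\<close> with the map induced by \<open>i_-\<close>.\<close>

lemma stallings_extension:
  fixes \<Gamma> (structure)
  assumes f: "continuous_map X Y f" and H: "homology_iso X Y f"
    and X: "path_connected_space X" and Y: "path_connected_space Y"
    and x0: "x0 \<in> topspace X" and y0: "y0 = f x0"
    and \<Gamma>: "group \<Gamma>" and \<phi>: "\<phi> \<in> hom (pi1 X x0) \<Gamma>" and "1 \<le> k"
  shows "\<exists>\<psi>\<in>hom (pi1 Y y0) (nil_quot \<Gamma> k). \<forall>a\<in>carrier (pi1 X x0).
    \<psi> (pi1_map Y f a) = lcs \<Gamma> k #> \<phi> a"
  using \<open>1 \<le> k\<close>
proof (induction k rule: dec_induct)
  case base
  interpret \<Gamma>: group \<Gamma> by fact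
  interpret P: group "pi1 X x0" using group_pi1[OF x0] .
  \<comment> \<open>The quotient by the first term has a single coset, the whole group.\<close>
  have "(\<lambda>_. carrier \<Gamma>) \<in> hom (pi1 Y y0) (nil_quot \<Gamma> 1)"
    using \<Gamma>.normal_self by (auto simp: hom_def FactGroup_def RCOSETS_def set_mult_def r_coset_def intro!: bexI[of _ "\<one>"])
  moreover have "lcs \<Gamma> 1 #> \<phi> a = carrier \<Gamma>" if "a \<in> carrier (pi1 X x0)" for a
    using \<Gamma>.coset_join2[of "\<phi> a" "carrier \<Gamma>"] \<Gamma>.subgroup_self that \<phi> by (auto simp: hom_def)
  ultimately show ?case by auto
next
  case (step k)
  interpret \<Gamma>: group \<Gamma> by fact
  interpret \<phi>: group_hom "pi1 X x0" \<Gamma> \<phi>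
    using group_pi1[OF x0] \<Gamma> \<phi> by (simp add: group_hom_def group_hom_axioms_def)
  let ?G = "nil_quot \<Gamma> (Suc k)" and ?Q = "nil_quot \<Gamma> k"
  let ?pr = "\<lambda>C. lcs \<Gamma> k <#> C"
  interpret N: normal "lcs \<Gamma> k" \<Gamma> by (rule \<Gamma>.lcs_normal)
  interpret M: normal "lcs \<Gamma> (Suc k)" \<Gamma> by (rule \<Gamma>.lcs_normal)
  have pr: "?pr (lcs \<Gamma> (Suc k) #> x) = lcs \<Gamma> k #> x" if "x \<in> carrier \<Gamma>" for x
    using \<Gamma>.coset_set_mult[OF \<Gamma>.lcs_normal \<Gamma>.lcs_normal \<Gamma>.lcs_Suc_subset that] .
  obtain \<psi> where \<psi>: "\<psi> \<in> hom (pi1 Y y0) ?Q"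
    "\<And>a. a \<in> carrier (pi1 X x0) \<Longrightarrow> \<psi> (pi1_map Y f a) = lcs \<Gamma> k #> \<phi> a"
    using step.IH by blast
  have "?pr \<in> hom ?G ?Q"
  proof (rule homI)
    fix C assume "C \<in> carrier ?G"
    then show "?pr C \<in> carrier ?Q"
      using pr by (auto simp: carrier_FactGroup)
  next
    fix C D assume "C \<in> carrier ?G" "D \<in> carrier ?G"
    then obtain x y where "x \<in> carrier \<Gamma>" "y \<in> carrier \<Gamma>" "C = lcs \<Gamma> (Suc k) #> x" "D = lcs \<Gamma> (Suc k) #> y"
      by (auto simp: carrier_FactGroup)
    then show "?pr (C \<otimes>\<^bsub>?G\<^esub> D) = ?pr C \<otimes>\<^bsub>?Q\<^esub> ?pr D"
      by (simp add: M.rcos_sum N.rcos_sum pr)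
  qed
  moreover have "?pr ` carrier ?G = carrier ?Q"
    by (auto simp: carrier_FactGroup pr image_image cong: image_cong_simp)
  moreover have "z \<otimes>\<^bsub>?G\<^esub> x = x \<otimes>\<^bsub>?G\<^esub> z" if zx: "z \<in> carrier ?G" "?pr z = \<one>\<^bsub>?Q\<^esub>" "x \<in> carrier ?G" for z x
  proof -
    obtain u v where uv: "u \<in> carrier \<Gamma>" "z = lcs \<Gamma> (Suc k) #> u" "v \<in> carrier \<Gamma>" "x = lcs \<Gamma> (Suc k) #> v"
      using zx(1,3) by (auto simp: carrier_FactGroup)
    have "u \<in> lcs \<Gamma> k"
      using zx(2) uv(1,2) \<Gamma>.coset_join1[OF _ uv(1) \<Gamma>.lcs_subgroup] by (simp add: pr)
    then show ?thesis
      using \<Gamma>.coset_commute[OF step.hyps(1) _ uv(3)] uv by (simp add: M.rcos_sum)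
  qed
  moreover have "(\<lambda>a. lcs \<Gamma> (Suc k) #> \<phi> a) \<in> hom (pi1 X x0) ?G"
    using hom_compose[OF \<phi> \<Gamma>.coset_hom] by (simp add: o_def)
  moreover have "\<psi> (pi1_map Y f a) = ?pr (lcs \<Gamma> (Suc k) #> \<phi> a)" if "a \<in> carrier (pi1 X x0)" for a
    using \<psi>(2)[OF that] that by (simp add: pr)
  ultimately obtain \<psi>' where "\<psi>' \<in> hom (pi1 Y y0) ?G"
    "\<And>a. a \<in> carrier (pi1 X x0) \<Longrightarrow> \<psi>' (pi1_map Y f a) = lcs \<Gamma> (Suc k) #> \<phi> a"
    by (rule hom_central_lift[OF f H X Y x0 y0 \<Gamma>.group_nil_quot \<Gamma>.group_nil_quot _ _ _ _ \<psi>(1)])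
      (assumption | rule that)+
  then show ?case by blast
qed

text \<open>Over an abelian group, a homomorphism extends to 1-chains and kills boundaries.\<close>

lemma hom_abelian_trivial:
  fixes K (structure)
  assumes f: "continuous_map X Y f" and H: "homology_iso X Y f"
    and X: "path_connected_space X" and Y: "path_connected_space Y"
    and x0: "x0 \<in> topspace X" and y0: "y0 = f x0"
    and K: "comm_group K" and \<psi>: "\<psi> \<in> hom (pi1 Y y0) K"
    and triv: "\<And>a. a \<in> carrier (pi1 X x0) \<Longrightarrow> \<psi> (pi1_map Y f a) = \<one>"
    and a: "a \<in> carrier (pi1 Y y0)"
  shows "\<psi> a = \<one>"
proof -
  interpret K: comm_group K by fact
  have y0': "y0 \<in> topspace Y"
    using f x0 y0 by (auto simp: continuous_map_def)
  obtain c where c: "based_paths X x0 c"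
    by (rule based_pathsE[OF X x0])
  obtain c' where c': "based_paths Y y0 c'"
    by (rule based_pathsE[OF Y y0'])
  obtain E where E: "path_functor Y K E" "\<And>p. path_between Y y0 y0 p \<Longrightarrow> E p = \<psi> (path_class Y p)"
    using hom_imp_path_functor[OF y0' K.is_group \<psi> c'] by blast
  note ed = path_functor_edge[OF E(1)]
  have Ecl: "E (simplex_path \<sigma>) \<in> carrier K" if "singular_simplex 1 Y \<sigma>" for \<sigma>
    using ed that unfolding edge_functor_def by blast
  have cx: "path_between X x0 x (c x)" if "x \<in> topspace X" for x
    using c that by (simp add: based_paths_def)
  have fcl: "E (f \<circ> c x) \<in> carrier K" if "x \<in> topspace X" for x
    using path_functorD(1)[OF E(1)] pathin_compose[OF path_betweenD(1)[OF cx[OF that]] f] .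
  have v0: "vec3 1 0 0 \<in> standard_simplex 0"
    by (auto simp: standard_simplex_0 vec3_def)
  obtain b where b: "b \<in> hom (chain_group 1 Y) K" "\<And>\<sigma>. singular_simplex 1 Y \<sigma> \<Longrightarrow> b (frag_of \<sigma>) = E (simplex_path \<sigma>)"
    by (rule chain_hom_exists[OF K, of 1 Y "\<lambda>\<sigma>. E (simplex_path \<sigma>)"]) (use Ecl in auto)
  \<comment> \<open>The 0-cochain of values of \<open>E\<close> on the images of the base paths of
    \<open>X\<close>; a 0-simplex is again evaluated at its only vertex.\<close>
  obtain D where D: "D \<in> hom (chain_group 0 X) K" "\<And>\<rho>. singular_simplex 0 X \<rho> \<Longrightarrow> D (frag_of \<rho>) = E (f \<circ> c (\<rho> (vec3 1 0 0)))"
  proof (rule chain_hom_exists[OF K, of 0 X "\<lambda>\<rho>. E (f \<circ> c (\<rho> (vec3 1 0 0)))"])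
    show "E (f \<circ> c (\<rho> (vec3 1 0 0))) \<in> carrier K" if "singular_simplex 0 X \<rho>" for \<rho>
      using that v0 by (intro fcl) (auto simp: singular_simplex_def continuous_map_def)
  qed (rule that)
  note hb = chain_hom[OF b(1) K.is_group] and hD = chain_hom[OF D(1) K.is_group]
  have pt: "singular_simplex 0 X (point_simplex x)" "D (frag_of (point_simplex x)) = E (f \<circ> c x)"
    if "x \<in> topspace X" for x
  proof -
    show "singular_simplex 0 X (point_simplex x)"
      using that unfolding singular_simplex_def point_simplex_def
      by (auto intro: continuous_map_eq[of _ _ "\<lambda>_. x"])
    then show "D (frag_of (point_simplex x)) = E (f \<circ> c x)"
      using D(2) v0 by (simp add: point_simplex_def)
  qed
  have bd: "b (chain_boundary 2 e) = \<one>" if "singular_chain 2 Y e" for e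
    using that
  proof (induction e rule: singular_chain_induct)
    case zero
    then show ?case using hb(2) by simp
  next
    case (diff x y)
    have "singular_chain 1 Y (chain_boundary 2 x)" "singular_chain 1 Y (chain_boundary 2 y)"
      using singular_chain_boundary[OF diff(1)] singular_chain_boundary[OF diff(2)] by simp_all
    then have "b (chain_boundary 2 (x - y)) = \<one> \<otimes> inv \<one>"
      using hb(4) diff(3,4) by (metis chain_boundary_diff)
    then show ?case by simp
  next
    case (of \<tau>)
    let ?F = "\<lambda>k. singular_face 2 k \<tau>"
    have F: "singular_simplex 1 Y (?F k)" if "k \<le> 2" for k
      using singular_simplex_singular_face[OF of _ that] by simp
    then have sc: "singular_chain 1 Y (frag_of (?F k))" if "k \<le> 2" for k
      using that by (simp add: singular_chain_of)
    have tri: "E (simplex_path (?F 2)) \<otimes> E (simplex_path (?F 0)) = E (simplex_path (?F 1))"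
      using ed of unfolding edge_functor_def by blast
    have "b (chain_boundary 2 (frag_of \<tau>)) =
        E (simplex_path (?F 0)) \<otimes> inv E (simplex_path (?F 1)) \<otimes> E (simplex_path (?F 2))"
      unfolding chain_boundary_2
      using F by (simp add: hb sc singular_chain_diff b(2) del: One_nat_def)
    also have "\<dots> = (E (simplex_path (?F 2)) \<otimes> E (simplex_path (?F 0))) \<otimes> inv E (simplex_path (?F 1))"
      using Ecl F by (simp add: K.m_ac del: One_nat_def)
    also have "\<dots> = \<one>"
      unfolding tri using Ecl F[of 1] by (simp add: K.r_inv)
    finally show ?case .
  qed
  \<comment> \<open>\<open>\<psi>\<close> kills the loops coming from \<open>X\<close>, so along
    \<open>f\<close> the cochain \<open>b\<close> is the coboundary of \<open>D\<close>; hence it is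
    trivial on images of cycles.\<close>
  have bf: "b (chain_map 1 f w) = D (chain_boundary 1 w)" if "singular_chain 1 X w" for w
    using that
  proof (induction w rule: singular_chain_induct)
    case zero
    then show ?case using hb(2) hD(2) by simp
  next
    case (diff x y)
    have "singular_chain 1 Y (chain_map 1 f x)" "singular_chain 1 Y (chain_map 1 f y)"
      using diff(1,2) f singular_chain_chain_map by blast+
    moreover have "singular_chain 0 X (chain_boundary 1 x)" "singular_chain 0 X (chain_boundary 1 y)"
      using singular_chain_boundary[OF diff(1)] singular_chain_boundary[OF diff(2)] by simp_all
    ultimately show ?case
      unfolding chain_map_diff chain_boundary_diff using hb(4) hD(4) diff(3,4) by metis
  next
    case (of \<sigma>)
    let ?p = "simplex_path \<sigma>"
    have p: "pathin X ?p" using pathin_simplex_path[OF of] .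
    note e = path_start_in_topspace[OF p] path_finish_in_topspace[OF p]
    note J = based_loop[OF c p]
    have "path_homotopic Y (f \<circ> ?p) (simplex_path (simplex_map 1 f \<sigma>))"
      using simplex_path_simplex_map[of _ f \<sigma>] by (intro path_homotopic_eq pathin_compose[OF p f]) auto
    then have "b (chain_map 1 f (frag_of \<sigma>)) = E (f \<circ> ?p)"
      using b(2)[OF singular_simplex_simplex_map[OF of f]] path_functorD(3)[OF E(1)] by (simp del: One_nat_def)
    also have "\<dots> = inv E (f \<circ> c (?p 0)) \<otimes> E (f \<circ> c (?p 1))"
      using path_functor_based[OF E(1) K.is_group f c p] fcl[OF e(1)] fcl[OF e(2)]
        E(2)[OF path_between_image[OF J f, folded y0]] triv[OF path_class_in_pi1[OF J]]
        pi1_map_path_class[OF path_betweenD(1)[OF J] f] by simp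
    also have "\<dots> = D (chain_boundary 1 (frag_of \<sigma>))"
      unfolding chain_boundary_1
      using pt[OF e(1)] pt[OF e(2)] fcl[OF e(1)] fcl[OF e(2)] by (simp add: hD singular_chain_of K.m_comm)
    finally show ?case .
  qed
  obtain p where p: "path_between Y y0 y0 p" "a = path_class Y p"
    by (rule pi1_E[OF a])
  note pb = path_betweenD[OF p(1)]
  have z: "singular_relcycle 1 Y {} (frag_of (path_simplex p))"
    using singular_simplex_path_simplex[OF pb(1)] chain_boundary_path_simplex[of p] pb(2,3)
    by (simp add: singular_cycle singular_chain_of)
  obtain y e where ye: "singular_relcycle 1 X {} y" "singular_chain 2 Y e"
    "frag_of (path_simplex p) = chain_map 1 f y + chain_boundary 2 e"
    by (rule homology_iso_surj[OF f H z]) (rule that; simp add: numeral_2_eq_2)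
  have yX: "singular_chain 1 X y" "chain_boundary 1 y = 0"
    using ye(1) by (auto simp: singular_cycle)
  have fy: "singular_chain 1 Y (chain_map 1 f y)" "singular_chain 1 Y (chain_boundary 2 e)"
    using singular_chain_chain_map[OF yX(1) f] singular_chain_boundary[OF ye(2)] by simp_all
  have "\<psi> a = E p"
    using E(2)[OF p(1)] p(2) by simp
  also have "\<dots> = E (simplex_path (path_simplex p))"
    using path_functorD(3)[OF E(1) path_homotopic_eq[OF pb(1)], of "simplex_path (path_simplex p)"]
    by (simp add: simplex_path_path_simplex)
  also have "\<dots> = b (frag_of (path_simplex p))"
    using b(2)[OF singular_simplex_path_simplex[OF pb(1)]] by simp
  also have "\<dots> = \<one>"
    unfolding ye(3) hb(3)[OF fy] bd[OF ye(2)] bf[OF yX(1)] yX(2) hD(2) by simp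
  finally show ?thesis .
qed

text \<open>The abelianisation of \<open>\<pi>\<^sub>1(Y)\<close> is divided by the image of
  \<open>\<pi>\<^sub>1(X)\<close>. The resulting homomorphism is trivial on \<open>X\<close>, hence
  trivial by \<open>hom_abelian_trivial\<close>; so the image is everything modulo commutators, and
  \<open>surj_mod_lcs\<close> passes to all \<open>k\<close>.\<close>

lemma stallings_surjective:
  assumes f: "continuous_map X Y f" and H: "homology_iso X Y f"
    and X: "path_connected_space X" and Y: "path_connected_space Y"
    and x0: "x0 \<in> topspace X" and y0: "y0 = f x0"
    and "1 \<le> k" "a \<in> carrier (pi1 Y y0)"
  shows "\<exists>x\<in>carrier (pi1 X x0). \<exists>z\<in>lcs (pi1 Y y0) k. a = z \<otimes>\<^bsub>pi1 Y y0\<^esub> pi1_map Y f x"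
proof -
  let ?A = "pi1 Y y0" and ?F = "pi1 X x0"
  have y0': "y0 \<in> topspace Y"
    using f x0 y0 by (auto simp: continuous_map_def)
  interpret A: group ?A using group_pi1[OF y0'] .
  interpret h: group_hom ?F ?A "pi1_map Y f"
    using group_pi1[OF x0] A.is_group pi1_map_hom[OF f y0] by (simp add: group_hom_def group_hom_axioms_def)
  interpret N: normal "lcs ?A 2" ?A by (rule A.lcs_normal)
  let ?B = "nil_quot ?A 2"
  interpret q: group_hom ?A ?B "\<lambda>x. lcs ?A 2 #>\<^bsub>?A\<^esub> x"
    by (intro group_hom.intro group_hom_axioms.intro A.coset_hom A.group_nil_quot A.is_group)
  interpret B: comm_group ?B
  proof (rule q.H.group_comm_groupI)
    fix C D assume "C \<in> carrier ?B" "D \<in> carrier ?B"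
    then obtain x y where xy: "x \<in> carrier ?A" "y \<in> carrier ?A" "C = lcs ?A 2 #>\<^bsub>?A\<^esub> x" "D = lcs ?A 2 #>\<^bsub>?A\<^esub> y"
      by (auto simp: carrier_FactGroup)
    then show "C \<otimes>\<^bsub>?B\<^esub> D = D \<otimes>\<^bsub>?B\<^esub> C"
    proof -
      have "lcs ?A 2 #>\<^bsub>?A\<^esub> (x \<otimes>\<^bsub>?A\<^esub> y) = lcs ?A 2 #>\<^bsub>?A\<^esub> (y \<otimes>\<^bsub>?A\<^esub> x)"
        using A.coset_commute[of 1 x y, unfolded Suc_1] xy(1,2) by simp
      then show ?thesis
        unfolding xy(3,4) mult_FactGroup N.rcos_sum[OF xy(1,2)] N.rcos_sum[OF xy(2,1)] .
    qed
  qed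
  let ?h = "\<lambda>x. lcs ?A 2 #>\<^bsub>?A\<^esub> pi1_map Y f x"
  interpret qh: group_hom ?F ?B ?h
    using hom_compose[OF h.homh A.coset_hom[of 2]] h.G.is_group q.H.is_group
    by (simp add: group_hom_def group_hom_axioms_def o_def)
  define I where "I = ?h ` carrier ?F"
  have I: "subgroup I ?B"
    unfolding I_def by (rule qh.img_is_subgroup)
  interpret I: normal I ?B
    using I by (simp add: B.normal_iff_subgroup)
  interpret K: comm_group "?B Mod I"
    using I by (rule B.abelian_FactGroup)
  let ?\<psi> = "\<lambda>a. I #>\<^bsub>?B\<^esub> (lcs ?A 2 #>\<^bsub>?A\<^esub> a)"
  have \<psi>: "?\<psi> \<in> hom ?A (?B Mod I)"
    using hom_compose[OF A.coset_hom I.r_coset_hom_Mod] by (simp add: o_def)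
  have triv: "?\<psi> (pi1_map Y f x) = \<one>\<^bsub>?B Mod I\<^esub>" if "x \<in> carrier ?F" for x
    using that q.H.coset_join2[OF _ I, of "?h x"] by (simp add: I_def)
  have "\<exists>x\<in>carrier ?F. \<exists>z\<in>lcs ?A 2. b = z \<otimes>\<^bsub>?A\<^esub> pi1_map Y f x" if b: "b \<in> carrier ?A" for b
  proof -
    have "?\<psi> b = I"
      using hom_abelian_trivial[OF f H X Y x0 y0 K.comm_group_axioms \<psi> triv b] by simp
    then have "lcs ?A 2 #>\<^bsub>?A\<^esub> b \<in> I"
      using q.H.coset_join1[OF _ _ I] q.hom_closed[OF b] by blast
    then obtain x where "x \<in> carrier ?F" "lcs ?A 2 #>\<^bsub>?A\<^esub> b = lcs ?A 2 #>\<^bsub>?A\<^esub> pi1_map Y f x"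
      by (auto simp: I_def)
    then show ?thesis
      using A.coset_eq_iff[OF A.lcs_normal b] h.hom_closed by blast
  qed
  then show ?thesis
    using surj_mod_lcs[OF h.group_hom_axioms _ assms(7,8)] by blast
qed

text \<open>For injectivity the identity of \<open>\<pi>\<^sub>1(X)\<close> is extended to
  \<open>\<psi>\<close> on \<open>\<pi>\<^sub>1(Y)\<close>. If two images differ by an element of
  the k-th term, then \<open>\<psi>\<close> sends this element to the trivial k-th term of the
  quotient, and the two classes coincide.\<close>

theorem stallings:
  assumes f: "continuous_map X Y f" and H: "homology_iso X Y f"
    and X: "path_connected_space X" and Y: "path_connected_space Y"
    and x0: "x0 \<in> topspace X" and y0: "y0 = f x0" and k: "1 \<le> k"
  shows "nil_quot_map (pi1 Y y0) k (pi1_map Y f) \<in> iso (nil_quot (pi1 X x0) k) (nil_quot (pi1 Y y0) k)"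
proof -
  let ?A = "pi1 Y y0" and ?F = "pi1 X x0"
  let ?m = "nil_quot_map ?A k (pi1_map Y f)"
  have y0': "y0 \<in> topspace Y"
    using f x0 y0 by (auto simp: continuous_map_def)
  interpret A: group ?A using group_pi1[OF y0'] .
  interpret h: group_hom ?F ?A "pi1_map Y f"
    using group_pi1[OF x0] A.is_group pi1_map_hom[OF f y0] by (simp add: group_hom_def group_hom_axioms_def)
  have m: "?m (lcs ?F k #>\<^bsub>?F\<^esub> x) = lcs ?A k #>\<^bsub>?A\<^esub> pi1_map Y f x" if "x \<in> carrier ?F" for x
    using nil_quot_map_coset[OF h.group_hom_axioms that] .
  have idh: "(\<lambda>x. x) \<in> hom ?F ?F"
    by (simp add: hom_def)
  from stallings_extension[OF f H X Y x0 y0 h.G.is_group idh k] obtain \<psi>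
    where \<psi>: "\<psi> \<in> hom ?A (nil_quot ?F k)"
      "\<And>a. a \<in> carrier ?F \<Longrightarrow> \<psi> (pi1_map Y f a) = lcs ?F k #>\<^bsub>?F\<^esub> a"
    by blast
  interpret \<psi>: group_hom ?A "nil_quot ?F k" \<psi>
    using \<psi>(1) A.is_group h.G.group_nil_quot by (simp add: group_hom_def group_hom_axioms_def)
  have "inj_on ?m (carrier (nil_quot ?F k))"
  proof (rule inj_onI)
    fix C D assume "C \<in> carrier (nil_quot ?F k)" "D \<in> carrier (nil_quot ?F k)" and eq: "?m C = ?m D"
    then obtain x y where xy: "x \<in> carrier ?F" "C = lcs ?F k #>\<^bsub>?F\<^esub> x" "y \<in> carrier ?F" "D = lcs ?F k #>\<^bsub>?F\<^esub> y"
      by (auto simp: carrier_FactGroup)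
    then have "lcs ?A k #>\<^bsub>?A\<^esub> pi1_map Y f x = lcs ?A k #>\<^bsub>?A\<^esub> pi1_map Y f y"
      using eq m by simp
    then obtain z where z: "z \<in> lcs ?A k" "pi1_map Y f x = z \<otimes>\<^bsub>?A\<^esub> pi1_map Y f y"
      using A.coset_eq_iff[OF A.lcs_normal] xy by auto
    have "\<psi> z \<in> lcs (nil_quot ?F k) k"
      using hom_lcs[OF \<psi>.group_hom_axioms z(1)] .
    moreover have "lcs (nil_quot ?F k) k \<subseteq> {\<one>\<^bsub>nil_quot ?F k\<^esub>}"
      by (rule h.G.lcs_nil_quot)
    ultimately have "\<psi> z = \<one>\<^bsub>nil_quot ?F k\<^esub>" by blast
    then have "\<psi> (pi1_map Y f x) = \<psi> (pi1_map Y f y)"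
      using z xy A.lcs_closed[OF z(1)] by (simp del: one_FactGroup mult_FactGroup)
    then show "C = D"
      using \<psi>(2) xy by simp
  qed
  moreover have "?m ` carrier (nil_quot ?F k) = carrier (nil_quot ?A k)"
  proof
    show "?m ` carrier (nil_quot ?F k) \<subseteq> carrier (nil_quot ?A k)"
      by (auto simp: carrier_FactGroup m)
    show "carrier (nil_quot ?A k) \<subseteq> ?m ` carrier (nil_quot ?F k)"
    proof
      fix C assume "C \<in> carrier (nil_quot ?A k)"
      then obtain a where a: "a \<in> carrier ?A" "C = lcs ?A k #>\<^bsub>?A\<^esub> a"
        by (auto simp: carrier_FactGroup)
      then obtain x where "x \<in> carrier ?F" "C = lcs ?A k #>\<^bsub>?A\<^esub> pi1_map Y f x"
        using stallings_surjective[OF f H X Y x0 y0 k a(1)] A.coset_eqI(1)[OF A.lcs_normal] by force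
      then show "C \<in> ?m ` carrier (nil_quot ?F k)"
        by (auto simp: carrier_FactGroup m[symmetric])
    qed
  qed
  ultimately show ?thesis
    using nil_quot_map_hom[OF h.group_hom_axioms] by (simp add: iso_def bij_betw_def)
qed

section \<open>Locally constant systems\<close>

text \<open>A principal covering of \<open>B\<close> with group \<open>G\<close>, given by local trivializations: for a chart
  \<open>(V, \<tau>)\<close> the functions \<open>c \<otimes> \<tau>\<close> are the sections over \<open>V\<close>.\<close>

locale local_system = group G for G :: "('g, 'm) monoid_scheme" (structure) +
  fixes B :: "'b topology" and charts :: "('b set \<times> ('b \<Rightarrow> 'g)) set"
  assumes chart_open: "(V, \<tau>) \<in> charts \<Longrightarrow> openin B V"
    and chart_closed: "(V, \<tau>) \<in> charts \<Longrightarrow> z \<in> V \<Longrightarrow> \<tau> z \<in> carrier G"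
    and chart_cover: "z \<in> topspace B \<Longrightarrow> \<exists>V \<tau>. (V, \<tau>) \<in> charts \<and> z \<in> V"
    and chart_ratio: "(V, \<tau>) \<in> charts \<Longrightarrow> (V', \<tau>') \<in> charts \<Longrightarrow>
      openin B {z \<in> V \<inter> V'. \<tau> z \<otimes> inv \<tau>' z = a}"
begin

text \<open>Near \<open>k\<close> the function is \<open>c \<otimes> \<tau> (h k')\<close> with a
  constant \<open>c\<close>; the ratio says so without naming \<open>c\<close>. A function with this
  property everywhere describes a lift of \<open>h\<close> to the covering.\<close>

definition flat_at :: "'c topology \<Rightarrow> ('c \<Rightarrow> 'b) \<Rightarrow> ('c \<Rightarrow> 'g) \<Rightarrow> 'c \<Rightarrow> 'b set \<Rightarrow> ('b \<Rightarrow> 'g) \<Rightarrow> bool" where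
  "flat_at K h f k V \<tau> \<longleftrightarrow> (\<exists>U. openin K U \<and> k \<in> U \<and> h ` U \<subseteq> V \<and>
     (\<forall>k'\<in>U. f k' \<otimes> inv \<tau> (h k') = f k \<otimes> inv \<tau> (h k)))"

lemma flat_atI:
  assumes "openin K U" "k \<in> U" "\<And>j. j \<in> U \<Longrightarrow> h j \<in> V"
    and "\<And>j. j \<in> U \<Longrightarrow> f j \<otimes> inv \<tau> (h j) = f k \<otimes> inv \<tau> (h k)"
  shows "flat_at K h f k V \<tau>"
  unfolding flat_at_def by (rule exI[of _ U], intro conjI ballI image_subsetI assms)

lemma flat_atE:
  assumes "flat_at K h f k V \<tau>"
  obtains U where "openin K U" "k \<in> U" "\<And>j. j \<in> U \<Longrightarrow> h j \<in> V"
    "\<And>j. j \<in> U \<Longrightarrow> f j \<otimes> inv \<tau> (h j) = f k \<otimes> inv \<tau> (h k)"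
proof -
  obtain U where "openin K U" "k \<in> U" "h ` U \<subseteq> V" "\<forall>j\<in>U. f j \<otimes> inv \<tau> (h j) = f k \<otimes> inv \<tau> (h k)"
    using assms unfolding flat_at_def by (elim exE conjE)
  then show ?thesis by (intro that[of U]) (assumption | erule bspec, assumption | blast)+
qed

definition flat_section :: "'c topology \<Rightarrow> ('c \<Rightarrow> 'b) \<Rightarrow> ('c \<Rightarrow> 'g) \<Rightarrow> bool" where
  "flat_section K h f \<longleftrightarrow> continuous_map K B h \<and> (\<forall>k\<in>topspace K. f k \<in> carrier G) \<and>
     (\<forall>k\<in>topspace K. \<exists>V \<tau>. (V, \<tau>) \<in> charts \<and> flat_at K h f k V \<tau>)"

lemma flat_section_closed: "flat_section K h f \<Longrightarrow> k \<in> topspace K \<Longrightarrow> f k \<in> carrier G"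
  by (simp add: flat_section_def)

text \<open>A change of chart multiplies the ratio by \<open>\<tau> \<otimes> inv \<tau>'\<close>,
  which \<open>chart_ratio\<close> makes locally constant.\<close>

lemma flat_section_at:
  assumes f: "flat_section K h f" and k: "k \<in> topspace K" and V': "(V', \<tau>') \<in> charts" "h k \<in> V'"
  shows "flat_at K h f k V' \<tau>'"
proof -
  have h: "continuous_map K B h" and cl: "\<And>k. k \<in> topspace K \<Longrightarrow> f k \<in> carrier G"
    using f by (auto simp: flat_section_def)
  obtain V \<tau> where V: "(V, \<tau>) \<in> charts" "flat_at K h f k V \<tau>"
    using f k unfolding flat_section_def by blast
  obtain U where U: "openin K U" "k \<in> U" "\<And>j. j \<in> U \<Longrightarrow> h j \<in> V"
    "\<And>j. j \<in> U \<Longrightarrow> f j \<otimes> inv \<tau> (h j) = f k \<otimes> inv \<tau> (h k)"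
    by (rule flat_atE[OF V(2)]) (rule that)
  let ?W = "{z \<in> V \<inter> V'. \<tau> z \<otimes> inv \<tau>' z = \<tau> (h k) \<otimes> inv \<tau>' (h k)}"
  let ?U = "U \<inter> {k' \<in> topspace K. h k' \<in> ?W}"
  have "openin K ?U"
    using U(1) openin_continuous_map_preimage[OF h chart_ratio[OF V(1) V'(1)]] by (rule openin_Int)
  moreover have kU: "k \<in> ?U"
    using k U(2) U(3)[OF U(2)] V'(2) by simp
  moreover have "h j \<in> V'" if "j \<in> ?U" for j
    using that by simp
  moreover have "f k' \<otimes> inv \<tau>' (h k') = f k \<otimes> inv \<tau>' (h k)" if k': "k' \<in> ?U" for k'
  proof -
    have "f j \<otimes> inv \<tau>' (h j) = (f j \<otimes> inv \<tau> (h j)) \<otimes> (\<tau> (h j) \<otimes> inv \<tau>' (h j))" if "j \<in> ?U" for j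
    proof -
      have "f j \<in> carrier G" "\<tau> (h j) \<in> carrier G" "\<tau>' (h j) \<in> carrier G"
        using that cl[of j] chart_closed[OF V(1), of "h j"] chart_closed[OF V'(1), of "h j"] by auto
      then show ?thesis by (simp add: m_assoc cancel_left)
    qed
    note this[OF k'] this[OF kU]
    moreover have "\<tau> (h k') \<otimes> inv \<tau>' (h k') = \<tau> (h k) \<otimes> inv \<tau>' (h k)" "k' \<in> U"
      using k' by auto
    ultimately show ?thesis
      using U(4)[of k'] by metis
  qed
  ultimately show ?thesis
    by (rule flat_atI)
qed

lemma flat_section_cong:
  assumes f: "flat_section K h f" and eq: "\<And>k. k \<in> topspace K \<Longrightarrow> h k = h' k"
  shows "flat_section K h' f"
proof -
  have "flat_at K h' f k V \<tau>" if fl: "flat_at K h f k V \<tau>" for k V \<tau>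
  proof -
    obtain U where U: "openin K U" "k \<in> U" "\<And>j. j \<in> U \<Longrightarrow> h j \<in> V"
      "\<And>j. j \<in> U \<Longrightarrow> f j \<otimes> inv \<tau> (h j) = f k \<otimes> inv \<tau> (h k)"
      by (rule flat_atE[OF fl]) (rule that)
    have h': "h' j = h j" if "j \<in> U" for j
      using eq[of j] openin_subset[OF U(1)] that by auto
    show ?thesis
      using U(1,2)
    proof (rule flat_atI)
      fix j assume j: "j \<in> U"
      show "h' j \<in> V" using U(3)[OF j] h'[OF j] by simp
      show "f j \<otimes> inv \<tau> (h' j) = f k \<otimes> inv \<tau> (h' k)"
        unfolding h'[OF j] h'[OF U(2)] by (rule U(4)[OF j])
    qed
  qed
  then show ?thesis
    using f continuous_map_eq[of K B h h'] eq unfolding flat_section_def by blast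
qed

lemma flat_section_pullback:
  assumes f: "flat_section K h f" and g: "continuous_map J K g"
  shows "flat_section J (h \<circ> g) (f \<circ> g)"
proof -
  have gk: "g j \<in> topspace K" if "j \<in> topspace J" for j
    using g that by (auto simp: continuous_map_def)
  have "flat_at J (h \<circ> g) (f \<circ> g) j V \<tau>" if fl: "flat_at K h f (g j) V \<tau>" and j: "j \<in> topspace J" for j V \<tau>
  proof -
    obtain U where U: "openin K U" "g j \<in> U" "\<And>i. i \<in> U \<Longrightarrow> h i \<in> V"
      "\<And>i. i \<in> U \<Longrightarrow> f i \<otimes> inv \<tau> (h i) = f (g j) \<otimes> inv \<tau> (h (g j))"
      by (rule flat_atE[OF fl]) (rule that)
    have "openin J {j \<in> topspace J. g j \<in> U}"
      using openin_continuous_map_preimage[OF g U(1)] .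
    then show ?thesis
      by (rule flat_atI) (use U(2) j in \<open>auto intro: U(3,4)\<close>)
  qed
  moreover have "continuous_map J B (h \<circ> g)"
    using f continuous_map_compose[OF g] unfolding flat_section_def by blast
  moreover have "\<exists>V \<tau>. (V, \<tau>) \<in> charts \<and> flat_at K h f (g j) V \<tau>" "(f \<circ> g) j \<in> carrier G" if "j \<in> topspace J" for j
    using f gk[OF that] unfolding flat_section_def by auto
  ultimately show ?thesis
    unfolding flat_section_def by blast
qed

text \<open>Left translation is the deck action: constants stand to the left of charts, so the ratio
  is only multiplied by \<open>c\<close>.\<close>

lemma flat_section_translate:
  assumes f: "flat_section K h f" and c: "c \<in> carrier G"
  shows "flat_section K h (\<lambda>k. c \<otimes> f k)"
proof -
  have "flat_at K h (\<lambda>k. c \<otimes> f k) k V \<tau>" if fl: "flat_at K h f k V \<tau>" and V: "(V, \<tau>) \<in> charts" for k V \<tau>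
  proof -
    obtain U where U: "openin K U" "k \<in> U" "\<And>j. j \<in> U \<Longrightarrow> h j \<in> V"
      "\<And>j. j \<in> U \<Longrightarrow> f j \<otimes> inv \<tau> (h j) = f k \<otimes> inv \<tau> (h k)"
      by (rule flat_atE[OF fl]) (rule that)
    have cl: "f j \<in> carrier G" "\<tau> (h j) \<in> carrier G" if "j \<in> U" for j
      using flat_section_closed[OF f, of j] openin_subset[OF U(1)] that chart_closed[OF V U(3)[OF that]] by auto
    show ?thesis
      using U(1-3)
    proof (rule flat_atI)
      fix j assume j: "j \<in> U"
      have "c \<otimes> (f j \<otimes> inv \<tau> (h j)) = c \<otimes> (f k \<otimes> inv \<tau> (h k))"
        unfolding U(4)[OF j] ..
      then show "c \<otimes> f j \<otimes> inv \<tau> (h j) = c \<otimes> f k \<otimes> inv \<tau> (h k)"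
        using cl[OF j] cl[OF U(2)] c by (simp add: m_assoc)
    qed
  qed
  then show ?thesis
    using f c unfolding flat_section_def by blast
qed

lemma locally_constant_imp_constant:
  assumes K: "connected_space K" and loc: "\<And>k. k \<in> topspace K \<Longrightarrow> \<exists>U. openin K U \<and> k \<in> U \<and> (\<forall>k'\<in>U. F k' = F k)"
    and kk: "k \<in> topspace K" "k' \<in> topspace K"
  shows "F k = F k'"
proof -
  have op: "openin K {j \<in> topspace K. P (F j)}" for P
  proof (subst openin_subopen, clarify)
    fix j assume j: "j \<in> topspace K" "P (F j)"
    obtain U where U: "openin K U" "j \<in> U" "\<forall>k'\<in>U. F k' = F j"
      using loc[OF j(1)] by blast
    have "i \<in> topspace K" "P (F i)" if "i \<in> U" for i
      using bspec[OF U(3) that] openin_subset[OF U(1)] that j(2) by auto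
    then have "U \<subseteq> {j \<in> topspace K. P (F j)}"
      by blast
    then show "\<exists>T. openin K T \<and> j \<in> T \<and> T \<subseteq> {j \<in> topspace K. P (F j)}"
      using U(1,2) by blast
  qed
  have "topspace K - {j \<in> topspace K. F j = F k} = {j \<in> topspace K. F j \<noteq> F k}"
    by blast
  then have "closedin K {j \<in> topspace K. F j = F k}"
    unfolding closedin_def using op[of "\<lambda>a. a \<noteq> F k"] by simp
  then have "{j \<in> topspace K. F j = F k} = {} \<or> {j \<in> topspace K. F j = F k} = topspace K"
    using K op[of "\<lambda>a. a = F k"] unfolding connected_space_clopen_in by blast
  moreover have "k \<in> {j \<in> topspace K. F j = F k}" using kk by simp
  ultimately have "k' \<in> {j \<in> topspace K. F j = F k}"
    using kk(2) by blast
  then show ?thesis by simp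
qed

text \<open>In a common chart the quotient of \<open>f'\<close> by \<open>f\<close> is a quotient of
  two locally constant ratios.\<close>

lemma flat_section_unique:
  assumes K: "connected_space K" and f: "flat_section K h f" and f': "flat_section K h f'"
    and k: "k \<in> topspace K" "k' \<in> topspace K"
  shows "f' k \<otimes> inv f k = f' k' \<otimes> inv f k'"
  using K _ k
proof (rule locally_constant_imp_constant)
  fix k assume k: "k \<in> topspace K"
  then have "h k \<in> topspace B"
    using f by (auto simp: flat_section_def continuous_map_def)
  then obtain V \<tau> where V: "(V, \<tau>) \<in> charts" "h k \<in> V"
    using chart_cover by blast
  obtain U where U: "openin K U" "k \<in> U" "\<And>j. j \<in> U \<Longrightarrow> h j \<in> V"
      "\<And>j. j \<in> U \<Longrightarrow> f j \<otimes> inv \<tau> (h j) = f k \<otimes> inv \<tau> (h k)"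
    by (rule flat_atE[OF flat_section_at[OF f k V]]) (rule that)
  obtain U' where U': "openin K U'" "k \<in> U'" "\<And>j. j \<in> U' \<Longrightarrow> h j \<in> V"
      "\<And>j. j \<in> U' \<Longrightarrow> f' j \<otimes> inv \<tau> (h j) = f' k \<otimes> inv \<tau> (h k)"
    by (rule flat_atE[OF flat_section_at[OF f' k V]]) (rule that)
  have eq: "f' j \<otimes> inv f j = (f' j \<otimes> inv \<tau> (h j)) \<otimes> inv (f j \<otimes> inv \<tau> (h j))" if "j \<in> U" for j
  proof -
    have "f j \<in> carrier G" "f' j \<in> carrier G" "\<tau> (h j) \<in> carrier G"
      using flat_section_closed[OF f, of j] flat_section_closed[OF f', of j] openin_subset[OF U(1)] that
        chart_closed[OF V(1) U(3)[OF that]] by auto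
    then show ?thesis by (simp add: m_assoc inv_mult_group cancel_left)
  qed
  have "f' j \<otimes> inv f j = f' k \<otimes> inv f k" if "j \<in> U \<inter> U'" for j
    unfolding eq[OF IntD1[OF that]] eq[OF U(2)] U(4)[OF IntD1[OF that]] U'(4)[OF IntD2[OF that]] ..
  then show "\<exists>U. openin K U \<and> k \<in> U \<and> (\<forall>k'\<in>U. f' k' \<otimes> inv f k' = f' k \<otimes> inv f k)"
    using U U' openin_Int by (intro exI[of _ "U \<inter> U'"]) blast
qed

section \<open>Existence of flat sections over squares\<close>

lemma flat_section_chart:
  assumes "(V, \<tau>) \<in> charts" "continuous_map K B h" "h ` topspace K \<subseteq> V"
  shows "flat_section K h (\<tau> \<circ> h)"
proof -
  have cl: "\<tau> (h k) \<in> carrier G" if "k \<in> topspace K" for k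
    using assms that chart_closed by blast
  have "flat_at K h (\<tau> \<circ> h) k V \<tau>" if "k \<in> topspace K" for k
    by (rule flat_atI[of K "topspace K"]) (use assms(3) that cl in auto)
  then show ?thesis
    unfolding flat_section_def using assms cl by auto
qed

lemma flat_section_const:
  assumes "continuous_map K B (\<lambda>k. z)" "c \<in> carrier G"
  shows "flat_section K (\<lambda>k. z) (\<lambda>k. c)"
proof -
  have "\<exists>V \<tau>. (V, \<tau>) \<in> charts \<and> flat_at K (\<lambda>k. z) (\<lambda>k. c) k V \<tau>" if k: "k \<in> topspace K" for k
  proof -
    have "z \<in> topspace B" using assms(1) k by (auto simp: continuous_map_def)
    then obtain V \<tau> where "(V, \<tau>) \<in> charts" "z \<in> V" using chart_cover by blast
    moreover have "flat_at K (\<lambda>k. z) (\<lambda>k. c) k V \<tau>"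
      by (rule flat_atI[of K "topspace K"]) (use k \<open>z \<in> V\<close> in auto)
    ultimately show ?thesis by blast
  qed
  then show ?thesis
    unfolding flat_section_def using assms by blast
qed

text \<open>On the connected overlap the two sections differ by one left factor; translating
  \<open>g\<close> by it makes them agree there, and the pasted function is a section.\<close>

lemma flat_section_glue:
  assumes A: "closedin K A" and C: "closedin K C" and AC: "A \<union> C = topspace K"
    and conn: "connectedin K (A \<inter> C)" and ne: "A \<inter> C \<noteq> {}" and h: "continuous_map K B h"
    and f: "flat_section (subtopology K A) h f" and g: "flat_section (subtopology K C) h g"
  shows "\<exists>f. flat_section K h f"
proof -
  obtain k0 where k0: "k0 \<in> A \<inter> C" using ne by blast
  have sub: "A \<subseteq> topspace K" "C \<subseteq> topspace K"
    using A C closedin_subset by auto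
  have cl: "k \<in> A \<Longrightarrow> f k \<in> carrier G" "k \<in> C \<Longrightarrow> g k \<in> carrier G" for k
    using flat_section_closed[OF f] flat_section_closed[OF g] sub by auto
  define g' where "g' k = (f k0 \<otimes> inv g k0) \<otimes> g k" for k
  have g': "flat_section (subtopology K C) h g'"
    unfolding g'_def using flat_section_translate[OF g] cl k0 by simp
  have restr: "flat_section (subtopology K (A \<inter> C)) h s" if "flat_section (subtopology K D) h s" "A \<inter> C \<subseteq> D" for D s
    using flat_section_pullback[OF that(1), of "subtopology K (A \<inter> C)" "\<lambda>k. k"] that(2)
    by (simp add: o_def continuous_map_in_subtopology continuous_map_from_subtopology subset_iff image_subset_iff_funcset)
  have eq: "f k = g' k" if k: "k \<in> A \<inter> C" for k
  proof -
    have cS: "connected_space (subtopology K (A \<inter> C))"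
      using conn by (simp add: connectedin_def)
    have "f k \<otimes> inv g' k = f k0 \<otimes> inv g' k0"
      by (rule flat_section_unique[OF cS restr[OF g'] restr[OF f]]) (use k k0 sub in auto)
    also have "\<dots> = \<one>"
      using cl k0 by (simp add: g'_def m_assoc)
    finally show ?thesis
      using cl k flat_section_closed[OF g', of k] sub by (metis IntE Int_absorb1 inv_closed inv_equality inv_inv topspace_subtopology_subset)
  qed
  define s where "s k = (if k \<in> A then f k else g' k)" for k
  have sA: "s k = f k" if "k \<in> A" for k using that by (simp add: s_def)
  have sC: "s k = g' k" if "k \<in> C" for k using that eq by (simp add: s_def)
  \<comment> \<open>The section condition is checked on each closed piece \<open>D\<close>
    separately; at a point off \<open>D\<close> the complement of \<open>D\<close> is a
    neighbourhood on which nothing is to be shown.\<close>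
  have loc: "\<exists>W. openin K W \<and> k \<in> W \<and> (\<forall>j\<in>W \<inter> D. h j \<in> V \<and> s j \<otimes> inv \<tau> (h j) = s k \<otimes> inv \<tau> (h k))"
    if D: "D \<subseteq> topspace K" "closedin K D" "flat_section (subtopology K D) h t" "\<And>k. k \<in> D \<Longrightarrow> s k = t k"
      and V: "(V, \<tau>) \<in> charts" "h k \<in> V" and k: "k \<in> topspace K" for D t V \<tau> k
  proof (cases "k \<in> D")
    case True
    then have fl: "flat_at (subtopology K D) h t k V \<tau>"
      using flat_section_at[OF D(3) _ V] D(1) by auto
    obtain U where U: "openin (subtopology K D) U" "k \<in> U" "\<And>j. j \<in> U \<Longrightarrow> h j \<in> V"
      "\<And>j. j \<in> U \<Longrightarrow> t j \<otimes> inv \<tau> (h j) = t k \<otimes> inv \<tau> (h k)"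
      by (rule flat_atE[OF fl]) (rule that)
    obtain W where W: "openin K W" "U = W \<inter> D"
      using U(1) by (auto simp: openin_subtopology)
    have "h j \<in> V \<and> s j \<otimes> inv \<tau> (h j) = s k \<otimes> inv \<tau> (h k)" if "j \<in> W \<inter> D" for j
      using that U(3)[of j] U(4)[of j] W(2) D(4)[OF True] D(4)[of j] by simp
    then show ?thesis
      using W U(2) by blast
  next
    case False
    then show ?thesis
      using D(2) k by (intro exI[of _ "topspace K - D"]) (auto simp: closedin_def)
  qed
  have "\<exists>V \<tau>. (V, \<tau>) \<in> charts \<and> flat_at K h s k V \<tau>" if k: "k \<in> topspace K" for k
  proof -
    have "h k \<in> topspace B" using h k by (auto simp: continuous_map_def)
    then obtain V \<tau> where V: "(V, \<tau>) \<in> charts" "h k \<in> V" using chart_cover by blast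
    obtain W where W: "openin K W" "k \<in> W" "\<forall>j\<in>W \<inter> A. h j \<in> V \<and> s j \<otimes> inv \<tau> (h j) = s k \<otimes> inv \<tau> (h k)"
      using loc[OF sub(1) A f sA V k] by blast
    obtain W' where W': "openin K W'" "k \<in> W'" "\<forall>j\<in>W' \<inter> C. h j \<in> V \<and> s j \<otimes> inv \<tau> (h j) = s k \<otimes> inv \<tau> (h k)"
      using loc[OF sub(2) C g' sC V k] by blast
    have both: "h j \<in> V \<and> s j \<otimes> inv \<tau> (h j) = s k \<otimes> inv \<tau> (h k)" if "j \<in> W \<inter> W'" for j
      using that AC openin_subset[OF W(1)] W(3) W'(3) by blast
    have "flat_at K h s k V \<tau>"
      using openin_Int[OF W(1) W'(1)] by (rule flat_atI) (use W(2) W'(2) both in blast)+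
    then show ?thesis using V(1) by blast
  qed
  moreover have "s k \<in> carrier G" if "k \<in> topspace K" for k
    using that AC cl flat_section_closed[OF g'] sub by (auto simp: s_def)
  ultimately have "flat_section K h s"
    using h unfolding flat_section_def by blast
  then show ?thesis by blast
qed

lemma flat_section_union:
  fixes A C :: "'c::topological_space set"
  assumes "closed A" "closed C" "connected (A \<inter> C)" "A \<inter> C \<noteq> {}" and h: "continuous_map (top_of_set (A \<union> C)) B h"
    and "\<exists>f. flat_section (top_of_set A) h f" "\<exists>f. flat_section (top_of_set C) h f"
  shows "\<exists>f. flat_section (top_of_set (A \<union> C)) h f"
proof -
  have "subtopology (top_of_set (A \<union> C)) A = top_of_set A" "subtopology (top_of_set (A \<union> C)) C = top_of_set C"
    by (simp_all add: subtopology_subtopology Int_absorb1)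
  moreover have "closedin (top_of_set (A \<union> C)) A" "closedin (top_of_set (A \<union> C)) C"
    using assms(1,2) by (auto intro: closed_subset)
  moreover have "connectedin (top_of_set (A \<union> C)) (A \<inter> C)"
    using assms(3) by (simp add: connectedin_subtopology le_infI1)
  ultimately show ?thesis
    using assms by (elim exE, intro flat_section_glue[of "top_of_set (A \<union> C)" A C]) auto
qed

text \<open>A Lebesgue number subdivides the square into cells lying in single charts. Cells are
  joined to rows and rows to the square, always along a segment, which is connected.\<close>

lemma flat_section_square:
  assumes h: "continuous_map (top_of_set ({0..1} \<times> {0..1::real})) B (h :: real \<times> real \<Rightarrow> 'b)"
  shows "\<exists>f. flat_section (top_of_set ({0..1} \<times> {0..1})) h f"
proof -
  let ?I = "{0..1} \<times> {0..1::real} :: (real \<times> real) set"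
  have hsub: "continuous_map (top_of_set A) B h" if "A \<subseteq> ?I" for A
    using continuous_map_from_subtopology_mono[OF h that] .
  define \<C> where "\<C> = {U. open U \<and> (\<exists>V \<tau>. (V, \<tau>) \<in> charts \<and> h ` (U \<inter> ?I) \<subseteq> V)}"
  have cover: "?I \<subseteq> \<Union>\<C>"
  proof
    fix x assume x: "x \<in> ?I"
    then have "h x \<in> topspace B" using h by (auto simp: continuous_map_def)
    then obtain V \<tau> where V: "(V, \<tau>) \<in> charts" "h x \<in> V" using chart_cover by blast
    have "openin (top_of_set ?I) {y \<in> ?I. h y \<in> V}"
      using openin_continuous_map_preimage[OF h chart_open[OF V(1)]] by simp
    then obtain U where "open U" "{y \<in> ?I. h y \<in> V} = ?I \<inter> U"
      unfolding openin_open by blast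
    then have "U \<in> \<C>" "x \<in> U"
      unfolding \<C>_def using V x by blast+
    then show "x \<in> \<Union>\<C>" by blast
  qed
  obtain \<delta> where \<delta>: "0 < \<delta>" "\<And>T. T \<subseteq> ?I \<Longrightarrow> diameter T < \<delta> \<Longrightarrow> \<exists>U\<in>\<C>. T \<subseteq> U"
  proof (rule Lebesgue_number_lemma[OF _ _ cover])
    show "compact ?I" by (simp add: compact_Times)
    have "(0, 0) \<in> \<Union>\<C>" by (rule subsetD[OF cover]) simp
    then show "\<C> \<noteq> {}" by blast
    show "open U" if "U \<in> \<C>" for U
      using that by (simp add: \<C>_def)
  qed (rule that)
  \<comment> \<open>Cells of side \<open>1 / n\<close> have diameter at most \<open>2 / n\<close>,
    by adding the two coordinate distances.\<close>
  obtain n :: nat where n': "2 / \<delta> < real n"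
    using reals_Archimedean2 by blast
  have n: "0 < n" "2 / real n < \<delta>"
  proof -
    have "0 < 2 / \<delta>" using \<delta>(1) by simp
    then have "0 < real n" using n' by linarith
    then show "0 < n" "2 / real n < \<delta>"
      using n' \<delta>(1) by (simp_all add: field_simps)
  qed
  define P where "P A \<longleftrightarrow> (\<exists>f. flat_section (top_of_set A) h f)" for A :: "(real \<times> real) set"
  let ?J = "\<lambda>i::nat. {real i / n .. real (Suc i) / n}"
  have le: "real (Suc i) / n \<le> 1" if "i < n" for i
    using that n by (simp add: field_simps)
  have Jsub: "?J i \<subseteq> {0..1}" if "i < n" for i
  proof
    fix x assume "x \<in> ?J i"
    moreover have "0 \<le> real i / n" by simp
    ultimately show "x \<in> {0..1}"
      using le[OF that] unfolding atLeastAtMost_iff by (meson order_trans)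
  qed
  have P_square: "P (?J i \<times> ?J j)" if "i < n" "j < n" for i j
  proof -
    have sub: "?J i \<times> ?J j \<subseteq> ?I"
      by (intro Sigma_mono Jsub that)
    have "diameter (?J i \<times> ?J j) \<le> 2 / n"
    proof (rule diameter_le)
      fix x y assume xy: "x \<in> ?J i \<times> ?J j" "y \<in> ?J i \<times> ?J j"
      have "norm (x - y) \<le> norm (fst x - fst y) + norm (snd x - snd y)"
        by (metis fst_diff norm_Pair_le prod.collapse snd_diff)
      also have "\<dots> \<le> 1 / n + 1 / n"
        using xy by (intro add_mono) (auto simp: abs_le_iff add_divide_distrib)
      finally show "norm (x - y) \<le> 2 / n" by simp
    qed simp
    then obtain U where "U \<in> \<C>" "?J i \<times> ?J j \<subseteq> U"
      using \<delta>(2)[OF sub] n(2) by auto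
    then obtain V \<tau> where V: "(V, \<tau>) \<in> charts" "h ` (?J i \<times> ?J j) \<subseteq> V"
      unfolding \<C>_def using sub by blast
    show ?thesis
      unfolding P_def by (rule exI, rule flat_section_chart[OF V(1) hsub[OF sub]]) (use V(2) in simp)
  qed
  have P_Un: "P (A \<union> C)" if "P A" "P C" "closed A" "closed C" "connected (A \<inter> C)" "A \<inter> C \<noteq> {}" "A \<union> C \<subseteq> ?I" for A C
    using flat_section_union[of A C h] hsub that unfolding P_def by blast
  have cells: "{0..real i / n} \<union> ?J i = {0..real (Suc i) / n}" "{0..real i / n} \<inter> ?J i = {real i / n}" for i
  proof -
    have i: "0 \<le> real i / n" "real i / n \<le> real (Suc i) / n"
      by (simp_all add: divide_right_mono)
    show "{0..real i / n} \<union> ?J i = {0..real (Suc i) / n}"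
      by (rule ivl_disj_un_two_touch(4)[OF i])
    show "{0..real i / n} \<inter> ?J i = {real i / n}"
      using i by (auto simp del: of_nat_Suc)
  qed
  have P_row: "P ({0..real (Suc i) / n} \<times> ?J j)" if "i < n" "j < n" for i j
    using that(1)
  proof (induction i)
    case 0
    then show ?case using P_square[of 0 j] that(2) by simp
  next
    case (Suc i)
    have un: "{0..real (Suc (Suc i)) / n} \<times> ?J j = {0..real (Suc i) / n} \<times> ?J j \<union> ?J (Suc i) \<times> ?J j"
      using cells(1)[of "Suc i"] by blast
    have int: "({0..real (Suc i) / n} \<times> ?J j) \<inter> (?J (Suc i) \<times> ?J j) = {real (Suc i) / n} \<times> ?J j"
      using cells(2)[of "Suc i"] by blast
    have "{0..real (Suc (Suc i)) / n} \<times> ?J j \<subseteq> ?I"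
      by (intro Sigma_mono Jsub that) (use le[OF Suc.prems] in auto)
    moreover have "connected ({real (Suc i) / n} \<times> ?J j)" "{real (Suc i) / n} \<times> ?J j \<noteq> {}"
      using n by (auto intro!: connected_Times simp: divide_right_mono)
    ultimately show ?case
      using Suc P_square[of "Suc i" j] that(2) unfolding un
      by (intro P_Un) (simp_all only: int, auto intro!: closed_Times)
  qed
  have P_col: "P ({0..1} \<times> {0..real (Suc j) / n})" if "j < n" for j
    using that
  proof (induction j)
    case 0
    then show ?case using P_row[of "n - 1" 0] n by simp
  next
    case (Suc j)
    have un: "{0..1} \<times> {0..real (Suc (Suc j)) / n} = {0..1} \<times> {0..real (Suc j) / n} \<union> {0..1} \<times> ?J (Suc j)"
      using cells(1)[of "Suc j"] by blast
    have int: "({0..1} \<times> {0..real (Suc j) / n}) \<inter> ({0..1} \<times> ?J (Suc j)) = {0..1::real} \<times> {real (Suc j) / n}"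
      using cells(2)[of "Suc j"] by blast
    have "{0..1} \<times> {0..real (Suc (Suc j)) / n} \<subseteq> ?I"
      using le[OF Suc.prems] by auto
    moreover have "P ({0..1} \<times> ?J (Suc j))"
      using P_row[of "n - 1" "Suc j"] n Suc.prems by simp
    moreover have "connected ({0..1::real} \<times> {real (Suc j) / n})" "{0..1::real} \<times> {real (Suc j) / n} \<noteq> {}"
      by (auto intro!: connected_Times)
    ultimately show ?case
      using Suc unfolding un by (intro P_Un) (simp_all only: int, auto intro!: closed_Times)
  qed
  show ?thesis
    using P_col[of "n - 1"] n unfolding P_def by simp
qed

section \<open>Monodromy of the local system along paths\<close>

lemma flat_section_path:
  assumes "pathin B p"
  shows "\<exists>f. flat_section unit_interval p f"
proof -
  have "continuous_map (top_of_set ({0..1::real} \<times> {0..1::real})) unit_interval snd"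
    by (auto simp: continuous_map_in_subtopology intro!: continuous_intros)
  then have "continuous_map (top_of_set ({0..1::real} \<times> {0..1::real})) B (p \<circ> snd)"
    using assms continuous_map_compose unfolding pathin_def by blast
  then obtain f where f: "flat_section (top_of_set ({0..1::real} \<times> {0..1::real})) (p \<circ> snd) f"
    by (rule exE[OF flat_section_square])
  have "continuous_map unit_interval (top_of_set ({0..1::real} \<times> {0..1::real})) (\<lambda>t. (0, t))"
    by (auto simp: continuous_map_in_subtopology intro!: continuous_intros)
  from flat_section_pullback[OF f this] show ?thesis
    by (auto simp: o_def)
qed

text \<open>Left translations of the section cancel in this expression, so by uniqueness the value
  does not depend on the choice.\<close>

definition transport :: "(real \<Rightarrow> 'b) \<Rightarrow> 'g" where
  "transport p = (let f = SOME f. flat_section unit_interval p f in inv f 0 \<otimes> f 1)"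

lemma transport_eq:
  assumes f: "flat_section unit_interval p f"
  shows "transport p = inv f 0 \<otimes> f 1"
proof -
  define g where "g = (SOME f. flat_section unit_interval p f)"
  have g: "flat_section unit_interval p g"
    unfolding g_def using f by (rule someI[of "flat_section unit_interval p"])
  have conn: "connected_space unit_interval"
    using connectedin_def[of euclideanreal "{0..1}"] by simp
  have cl: "f 0 \<in> carrier G" "f 1 \<in> carrier G" "g 0 \<in> carrier G" "g 1 \<in> carrier G"
    using flat_section_closed[OF f] flat_section_closed[OF g] by auto
  have "g 0 \<otimes> inv f 0 = g 1 \<otimes> inv f 1"
    using flat_section_unique[OF conn f g] by simp
  then have "g 0 = g 1 \<otimes> inv f 1 \<otimes> f 0"
    using cl by (simp add: inv_solve_right')
  then have "inv g 0 \<otimes> g 1 = inv f 0 \<otimes> f 1"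
    using cl by (simp add: inv_mult_group m_assoc cancel_left)
  then show ?thesis
    by (simp add: transport_def g_def Let_def)
qed

text \<open>A section over a concatenation restricts to sections over its halves, and a section over
  the square of a homotopy compares the two end paths.\<close>

lemma path_functor_transport: "path_functor B G transport"
  unfolding path_functor_def
proof (intro conjI allI impI)
  show "transport p \<in> carrier G" if "pathin B p" for p
    using flat_section_path[OF that] transport_eq flat_section_closed[of unit_interval p] by force
next
  fix p q assume p: "pathin B p" and q: "pathin B q" and pq: "p 1 = q 0"
  obtain f where f: "flat_section unit_interval (join_path p q) f"
    using flat_section_path[OF pathin_join[OF p q pq]] by blast
  have c: "continuous_map unit_interval unit_interval (\<lambda>t. t / 2)" "continuous_map unit_interval unit_interval (\<lambda>t. (1 + t) / 2)"
    by (auto simp: continuous_map_in_subtopology intro!: continuous_intros)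
  have "flat_section unit_interval p (f \<circ> (\<lambda>t. t / 2))"
    by (rule flat_section_cong[OF flat_section_pullback[OF f c(1)]]) (simp add: join_path_def)
  moreover have "flat_section unit_interval q (f \<circ> (\<lambda>t. (1 + t) / 2))"
  proof (rule flat_section_cong[OF flat_section_pullback[OF f c(2)]])
    fix t assume t: "t \<in> topspace unit_interval"
    have "2 * ((1 + t) / 2) - 1 = t" by (simp add: field_simps)
    then show "(join_path p q \<circ> (\<lambda>t. (1 + t) / 2)) t = q t"
      using pq t by (cases "t = 0") (simp_all add: join_path_def del: times_divide_eq_right, simp)
  qed
  moreover have "f 0 \<in> carrier G" "f (1/2) \<in> carrier G" "f 1 \<in> carrier G"
    using flat_section_closed[OF f] by auto
  ultimately show "transport (join_path p q) = transport p \<otimes> transport q"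
    by (simp add: transport_eq[OF f] transport_eq m_assoc cancel_left)
next
  fix p q assume hpq: "path_homotopic B p q"
  obtain h where h: "continuous_map unit_square B h"
    "\<And>t. h (0, t) = p t" "\<And>t. h (1, t) = q t"
    "\<And>s. s \<in> {0..1} \<Longrightarrow> h (s, 0) = p 0" "\<And>s. s \<in> {0..1} \<Longrightarrow> h (s, 1) = p 1"
    by (rule path_homotopicE[OF hpq]) (rule that; assumption)
  have "continuous_map (top_of_set ({0..1} \<times> {0..1})) B h"
    using h(1) by simp
  then obtain f where f: "flat_section (top_of_set ({0..1} \<times> {0..1})) h f"
    using flat_section_square by blast
  have c: "continuous_map unit_interval (top_of_set ({0..1} \<times> {0..1})) (\<lambda>t. (a, t))"
    "continuous_map unit_interval (top_of_set ({0..1} \<times> {0..1})) (\<lambda>t. (t, a))" if "a \<in> {0..1}" for a :: real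
    using that by (auto simp: continuous_map_in_subtopology intro!: continuous_intros)
  have f4: "f (0, 0) \<in> carrier G" "f (0, 1) \<in> carrier G" "f (1, 0) \<in> carrier G" "f (1, 1) \<in> carrier G"
    using flat_section_closed[OF f] by auto
  have "flat_section unit_interval p (f \<circ> (\<lambda>t. (0, t)))"
    by (rule flat_section_cong[OF flat_section_pullback[OF f c(1)]]) (auto simp: h)
  moreover have "flat_section unit_interval q (f \<circ> (\<lambda>t. (1, t)))"
    by (rule flat_section_cong[OF flat_section_pullback[OF f c(1)]]) (auto simp: h)
  \<comment> \<open>Along a side where the homotopy is constant, any section has the same transport
    as a constant one, hence equal values at the two corners.\<close>
  moreover have side: "f (0, a) = f (1, a)" if a: "a \<in> {0, 1}" for a
  proof -
    have eq: "h (s, a) = h (0, a)" if "s \<in> {0..1}" for s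
      using a h(2,4,5) that by auto
    have s: "flat_section unit_interval (\<lambda>s. h (0, a)) (f \<circ> (\<lambda>t. (t, a)))"
    proof (rule flat_section_cong[OF flat_section_pullback[OF f c(2)]])
      show "a \<in> {0..1}" using a by auto
      show "(h \<circ> (\<lambda>t. (t, a))) t = h (0, a)" if "t \<in> topspace unit_interval" for t
        using eq[of t] that by simp
    qed
    then have "continuous_map unit_interval B (\<lambda>s. h (0, a))"
      by (simp add: flat_section_def)
    from transport_eq[OF flat_section_const[OF this one_closed]] transport_eq[OF s]
    have "inv f (0, a) \<otimes> f (1, a) = \<one>" by simp
    then show ?thesis
      using f4 a by (metis empty_iff insert_iff inv_closed inv_equality inv_inv)
  qed
  ultimately show "transport p = transport q"
    using side[of 0] side[of 1] by (simp add: transport_eq)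
qed

end

section \<open>Path functors on glued spaces\<close>

text \<open>For a partial bijection each further step of a zigzag undoes the preceding one, so
  classes have at most two points.\<close>

lemma glue_equiv_iff:
  assumes "\<And>x y y'. (x, y) \<in> R \<Longrightarrow> (x, y') \<in> R \<Longrightarrow> y = y'" "\<And>x x' y. (x, y) \<in> R \<Longrightarrow> (x', y) \<in> R \<Longrightarrow> x = x'"
  shows "(p, q) \<in> glue_equiv R \<longleftrightarrow> p = q \<or> (\<exists>x y. (x, y) \<in> R \<and> (p = Inl x \<and> q = Inr y \<or> p = Inr y \<and> q = Inl x))"
    (is "_ \<longleftrightarrow> ?rel p q")
proof
  show "?rel p q" if "(p, q) \<in> glue_equiv R"
    using that unfolding glue_equiv_def Let_def
  proof (induction rule: rtrancl_induct)
    case (step q r)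
    from step.hyps(2) obtain x y where xy: "(x, y) \<in> R" "q = Inl x \<and> r = Inr y \<or> q = Inr y \<and> r = Inl x"
      by auto
    from step.IH show ?case
    proof
      assume "p = q"
      with xy show ?thesis by blast
    next
      assume "\<exists>x y. (x, y) \<in> R \<and> (p = Inl x \<and> q = Inr y \<or> p = Inr y \<and> q = Inl x)"
      then obtain x' y' where x'y': "(x', y') \<in> R" "p = Inl x' \<and> q = Inr y' \<or> p = Inr y' \<and> q = Inl x'"
        by blast
      then have "p = r"
        using xy assms by (metis Inl_Inr_False Inl_inject Inr_inject)
      then show ?thesis by simp
    qed
  qed simp
  show "(p, q) \<in> glue_equiv R" if "?rel p q"
    using that unfolding glue_equiv_def Let_def by (blast intro: r_into_rtrancl)
qed

lemma glue_point_eq_iff: "glue_point R p = glue_point R q \<longleftrightarrow> (p, q) \<in> glue_equiv R"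
proof -
  let ?E = "{(Inl x, Inr y) | x y. (x, y) \<in> R}"
  have E: "glue_equiv R = (?E \<union> ?E\<inverse>)\<^sup>*"
    by (simp add: glue_equiv_def Let_def)
  have "sym (glue_equiv R)"
    unfolding E by (rule sym_rtrancl) (auto simp: sym_def)
  moreover have "trans (glue_equiv R)" "refl (glue_equiv R)"
    unfolding E by (simp_all add: trans_rtrancl refl_rtrancl)
  ultimately show ?thesis
    unfolding glue_point_def sym_def trans_def refl_on_def by blast
qed

lemma glue_left_eq_right: "(x, y) \<in> R \<Longrightarrow> glue_left R x = glue_right R y"
  unfolding glue_left_def glue_right_def glue_point_eq_iff by (auto simp: glue_equiv_def Let_def)

lemma topspace_glue: "topspace (glue X Y R) = glue_left R ` topspace X \<union> glue_right R ` topspace Y"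
proof
  show "topspace (glue X Y R) \<subseteq> glue_left R ` topspace X \<union> glue_right R ` topspace Y"
    using openin_topspace[of "glue X Y R"] unfolding openin_glue by blast
  have "openin (glue X Y R) (glue_left R ` topspace X \<union> glue_right R ` topspace Y)"
    unfolding openin_glue
  proof (intro conjI)
    have "{x \<in> topspace X. glue_left R x \<in> glue_left R ` topspace X \<union> glue_right R ` topspace Y} = topspace X"
      "{y \<in> topspace Y. glue_right R y \<in> glue_left R ` topspace X \<union> glue_right R ` topspace Y} = topspace Y"
      by auto
    then show "openin X {x \<in> topspace X. glue_left R x \<in> glue_left R ` topspace X \<union> glue_right R ` topspace Y}"
      "openin Y {y \<in> topspace Y. glue_right R y \<in> glue_left R ` topspace X \<union> glue_right R ` topspace Y}"
      by simp_all
  qed simp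
  then show "glue_left R ` topspace X \<union> glue_right R ` topspace Y \<subseteq> topspace (glue X Y R)"
    by (rule openin_subset)
qed

lemma continuous_map_glue_left: "continuous_map X (glue X Y R) (glue_left R)"
  unfolding continuous_map_def by (auto simp: topspace_glue openin_glue)

lemma continuous_map_glue_right: "continuous_map Y (glue X Y R) (glue_right R)"
  unfolding continuous_map_def by (auto simp: topspace_glue openin_glue)

text \<open>The homotopies may leave \<open>U\<close>: what is wanted is that a path functor takes
  one value on all paths in \<open>U\<close> with given ends.\<close>

definition locally_simply_connected :: "'a topology \<Rightarrow> bool" where
  "locally_simply_connected X \<longleftrightarrow> (\<forall>x N. openin X N \<longrightarrow> x \<in> N \<longrightarrow>
     (\<exists>U. openin X U \<and> x \<in> U \<and> U \<subseteq> N \<and> path_connectedin X U \<and>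
       (\<forall>p q. pathin X p \<longrightarrow> pathin X q \<longrightarrow> p ` {0..1} \<subseteq> U \<longrightarrow> q ` {0..1} \<subseteq> U \<longrightarrow>
          p 0 = q 0 \<longrightarrow> p 1 = q 1 \<longrightarrow> path_homotopic X p q)))"

lemma locally_simply_connected_imp_locally_path_connected:
  assumes "locally_simply_connected X"
  shows "locally_path_connected_space X"
  unfolding locally_path_connected_space
proof (intro allI impI, elim conjE)
  fix N x assume "openin X N" "x \<in> N"
  from assms[unfolded locally_simply_connected_def, rule_format, OF this]
  obtain U where "openin X U" "x \<in> U" "U \<subseteq> N" "path_connectedin X U"
    by (elim exE conjE) (rule that)
  then show "\<exists>U. openin X U \<and> path_connectedin X U \<and> x \<in> U \<and> U \<subseteq> N"
    by (intro exI[of _ U] conjI)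
qed

lemma path_image_join: "join_path p q ` {0..1} \<subseteq> p ` {0..1} \<union> q ` {0..1}"
  by (auto simp: join_path_def)

text \<open>A primitive of \<open>\<Phi>\<close> over \<open>U\<close>. Over a locally
  path-connected space two primitives differ by a locally constant left factor, which is what charts
  of a local system require.\<close>

definition potential :: "'a topology \<Rightarrow> ('g, 'm) monoid_scheme \<Rightarrow> ((real \<Rightarrow> 'a) \<Rightarrow> 'g) \<Rightarrow> 'a set \<Rightarrow> ('a \<Rightarrow> 'g) \<Rightarrow> bool" where
  "potential X G \<Phi> U \<alpha> \<longleftrightarrow> (\<forall>x\<in>U. \<alpha> x \<in> carrier G) \<and>
     (\<forall>p. pathin X p \<longrightarrow> p ` {0..1} \<subseteq> U \<longrightarrow> \<Phi> p = inv\<^bsub>G\<^esub> \<alpha> (p 0) \<otimes>\<^bsub>G\<^esub> \<alpha> (p 1))"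

lemma potential_empty: "potential X G \<Phi> {} \<alpha>"
  by (simp add: potential_def)

lemma potential_mono: "potential X G \<Phi> U \<alpha> \<Longrightarrow> V \<subseteq> U \<Longrightarrow> potential X G \<Phi> V \<alpha>"
  unfolding potential_def by blast

text \<open>\<open>\<alpha> y\<close> is the value of \<open>\<Phi>\<close> on a path in
  \<open>U\<close> from \<open>x\<close> to \<open>y\<close>, and local simple connectivity makes
  the choice immaterial. The unit value at \<open>x\<close> lets primitives on the two pieces be
  matched at a common point.\<close>

lemma potential_exists:
  assumes X: "locally_simply_connected X" and G: "group G" and \<Phi>: "path_functor X G \<Phi>"
    and N: "openin X N" "x \<in> N"
  obtains U \<alpha> where "openin X U" "x \<in> U" "U \<subseteq> N" "path_connectedin X U" "potential X G \<Phi> U \<alpha>" "\<alpha> x = \<one>\<^bsub>G\<^esub>"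
proof -
  interpret group G by fact
  obtain U where U: "openin X U" "x \<in> U" "U \<subseteq> N" "path_connectedin X U"
    and "\<forall>p q. pathin X p \<longrightarrow> pathin X q \<longrightarrow> p ` {0..1} \<subseteq> U \<longrightarrow> q ` {0..1} \<subseteq> U \<longrightarrow>
        p 0 = q 0 \<longrightarrow> p 1 = q 1 \<longrightarrow> path_homotopic X p q"
    using X[unfolded locally_simply_connected_def, rule_format, OF N] by (elim exE conjE) (rule that)
  note U5 = this(5)[rule_format]
  have "\<exists>p. pathin X p \<and> p ` {0..1} \<subseteq> U \<and> p 0 = x \<and> p 1 = y" if "y \<in> U" for y
    using U(2,4) that unfolding path_connectedin by (metis image_subset_iff_funcset)
  then obtain c where c: "\<And>y. y \<in> U \<Longrightarrow> pathin X (c y)" "\<And>y. y \<in> U \<Longrightarrow> c y ` {0..1} \<subseteq> U"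
    "\<And>y. y \<in> U \<Longrightarrow> c y 0 = x" "\<And>y. y \<in> U \<Longrightarrow> c y 1 = y"
    by metis
  have cl: "\<Phi> (c y) \<in> carrier G" if "y \<in> U" for y
    using path_functorD(1)[OF \<Phi> c(1)[OF that]] .
  have "\<Phi> p = inv\<^bsub>G\<^esub> \<Phi> (c (p 0)) \<otimes>\<^bsub>G\<^esub> \<Phi> (c (p 1))" if p: "pathin X p" "p ` {0..1} \<subseteq> U" for p
  proof -
    have e: "p 0 \<in> U" "p 1 \<in> U" using p(2) by auto
    have j: "c (p 0) 1 = p 0" using c(4)[OF e(1)] .
    have "path_homotopic X (join_path (c (p 0)) p) (c (p 1))"
    proof (rule U5)
      show "pathin X (join_path (c (p 0)) p)" using c(1)[OF e(1)] p(1) j by (rule pathin_join)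
      show "join_path (c (p 0)) p ` {0..1} \<subseteq> U"
        using path_image_join[of "c (p 0)" p] c(2)[OF e(1)] p(2) by blast
    qed (use c[OF e(1)] c[OF e(2)] in auto)
    then have "\<Phi> (c (p 0)) \<otimes>\<^bsub>G\<^esub> \<Phi> p = \<Phi> (c (p 1))"
      using path_functorD(3)[OF \<Phi>] path_functorD(2)[OF \<Phi> c(1)[OF e(1)] p(1) j] by simp
    then show ?thesis
      using cl[OF e(1)] path_functorD(1)[OF \<Phi> p(1)] cancel_left(2) by metis
  qed
  then have "potential X G \<Phi> U (\<lambda>y. \<Phi> (c y))"
    using cl by (auto simp: potential_def)
  moreover have "\<Phi> (c x) = \<one>\<^bsub>G\<^esub>"
  proof -
    have "x \<in> topspace X" using U(1,2) openin_subset by blast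
    have "path_homotopic X (c x) (\<lambda>t. x)"
      using U(2) c[OF U(2)] \<open>x \<in> topspace X\<close> by (intro U5) auto
    then show ?thesis
      using path_functorD(3)[OF \<Phi>] path_functor_const[OF \<Phi> G \<open>x \<in> topspace X\<close>] by simp
  qed
  ultimately show ?thesis
    using that U(1-4) by blast
qed

text \<open>The seam \<open>T\<close> is closed in both pieces. Neighbourhoods of a seam point are
  therefore glued from both sides, and agreement of \<open>\<Phi>\<close> and \<open>\<Psi>\<close>
  along \<open>T\<close> is what lets the primitives on the two sides match.\<close>

locale glued_functors = group G for G :: "('g, 'm) monoid_scheme" (structure) +
  fixes X :: "'x topology" and Y :: "'y topology" and T :: "'t topology"
    and u :: "'t \<Rightarrow> 'x" and v :: "'t \<Rightarrow> 'y" and R \<Phi> \<Psi>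
  assumes R: "R = {(u t, v t) | t. t \<in> topspace T}"
    and u: "embedding_map T X u" and v: "embedding_map T Y v"
    and closed_u: "closedin X (u ` topspace T)" and closed_v: "closedin Y (v ` topspace T)"
    and lscX: "locally_simply_connected X" and lscY: "locally_simply_connected Y"
    and lpcT: "locally_path_connected_space T"
    and \<Phi>: "path_functor X G \<Phi>" and \<Psi>: "path_functor Y G \<Psi>"
    and agree: "\<And>p. pathin T p \<Longrightarrow> \<Phi> (u \<circ> p) = \<Psi> (v \<circ> p)"
begin

abbreviation "l \<equiv> glue_left R"
abbreviation "r \<equiv> glue_right R"
abbreviation "B \<equiv> glue X Y R"

lemma inj_u: "inj_on u (topspace T)" and inj_v: "inj_on v (topspace T)"
  using u v by (simp_all add: embedding_map_def homeomorphic_eq_everything_map)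

lemma R_unique: "(x, y) \<in> R \<Longrightarrow> (x, y') \<in> R \<Longrightarrow> y = y'" "(x, y) \<in> R \<Longrightarrow> (x', y) \<in> R \<Longrightarrow> x = x'"
  using inj_u inj_v unfolding R inj_on_def by auto

lemma l_eq_r_iff: "l x = r y \<longleftrightarrow> (\<exists>t\<in>topspace T. x = u t \<and> y = v t)"
proof -
  have "l x = r y \<longleftrightarrow> (x, y) \<in> R"
    unfolding glue_left_def glue_right_def glue_point_eq_iff using glue_equiv_iff[OF R_unique] by auto
  then show ?thesis by (auto simp: R)
qed

lemma l_inj: "l x = l x' \<longleftrightarrow> x = x'" and r_inj: "r y = r y' \<longleftrightarrow> y = y'"
  unfolding glue_left_def glue_right_def glue_point_eq_iff using glue_equiv_iff[OF R_unique] by auto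

definition compatible :: "('x + 'y) set set \<Rightarrow> (('x + 'y) set \<Rightarrow> 'g) \<Rightarrow> bool" where
  "compatible V \<tau> \<longleftrightarrow> openin B V \<and> (\<forall>z\<in>V. \<tau> z \<in> carrier G) \<and>
     potential X G \<Phi> {x \<in> topspace X. l x \<in> V} (\<tau> \<circ> l) \<and>
     potential Y G \<Psi> {y \<in> topspace Y. r y \<in> V} (\<tau> \<circ> r)"

definition "charts = {(V, \<tau>). compatible V \<tau>}"

lemma chartI:
  assumes U: "openin X U" and V: "openin Y V" and UV: "\<And>t. t \<in> topspace T \<Longrightarrow> u t \<in> U \<longleftrightarrow> v t \<in> V"
    and \<alpha>: "potential X G \<Phi> U \<alpha>" and \<beta>: "potential Y G \<Psi> V \<beta>"
    and \<alpha>\<beta>: "\<And>t. t \<in> topspace T \<Longrightarrow> u t \<in> U \<Longrightarrow> \<alpha> (u t) = \<beta> (v t)"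
  shows "\<exists>\<tau>. (l ` U \<union> r ` V, \<tau>) \<in> charts"
proof -
  define \<tau> where "\<tau> z = (if z \<in> l ` U then \<alpha> (inv_into U l z) else \<beta> (inv_into V r z))" for z
  have injl: "inj_on l U" and injr: "inj_on r V"
    by (auto simp: inj_on_def l_inj r_inj)
  have \<tau>l: "\<tau> (l x) = \<alpha> x" if "x \<in> U" for x
    using that injl by (simp add: \<tau>_def)
  have \<tau>r: "\<tau> (r y) = \<beta> y" if y: "y \<in> V" for y
  proof (cases "r y \<in> l ` U")
    case True
    then obtain x where x: "x \<in> U" "l x = r y" by auto
    then obtain t where "t \<in> topspace T" "x = u t" "y = v t" by (auto simp: l_eq_r_iff)
    then show ?thesis using \<tau>l[OF x(1)] \<alpha>\<beta> x by simp
  next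
    case False
    then show ?thesis using y injr by (simp add: \<tau>_def)
  qed
  have preX: "{x \<in> topspace X. l x \<in> l ` U \<union> r ` V} = U"
    using openin_subset[OF U] UV by (force simp: l_inj l_eq_r_iff)
  have preY: "{y \<in> topspace Y. r y \<in> l ` U \<union> r ` V} = V"
  proof -
    have "r y \<in> l ` U \<longleftrightarrow> (\<exists>t\<in>topspace T. u t \<in> U \<and> y = v t)" for y
      using l_eq_r_iff by (metis imageE imageI)
    then show ?thesis
      using openin_subset[OF V] UV by (auto simp: r_inj)
  qed
  have "openin B (l ` U \<union> r ` V)"
    unfolding openin_glue preX preY using U V openin_subset[OF U] openin_subset[OF V] by blast
  moreover have "potential X G \<Phi> U (\<tau> \<circ> l)"
    using \<alpha> \<tau>l unfolding potential_def by (auto simp: image_subset_iff)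
  moreover have "potential Y G \<Psi> V (\<tau> \<circ> r)"
    using \<beta> \<tau>r unfolding potential_def by (auto simp: image_subset_iff)
  ultimately have "compatible (l ` U \<union> r ` V) \<tau>"
    unfolding compatible_def preX preY potential_def by auto
  then show ?thesis by (auto simp: charts_def)
qed

text \<open>For a union to be open in the glued space, its two parts must meet \<open>T\<close> in
  the same set. Cutting down to a prescribed trace \<open>S\<close> achieves this on either
  side.\<close>

lemma shrink:
  assumes f: "embedding_map T Z f" and S: "openin T S" and U: "openin Z U" "f ` S \<subseteq> U"
  obtains U' where "openin Z U'" "U' \<subseteq> U" "\<And>t. t \<in> topspace T \<Longrightarrow> f t \<in> U' \<longleftrightarrow> t \<in> S"
proof -
  have hm: "homeomorphic_map T (subtopology Z (f ` topspace T)) f"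
    using f unfolding embedding_map_def .
  then have "open_map T (subtopology Z (f ` topspace T)) f"
    by (rule homeomorphic_imp_open_map)
  then have "openin (subtopology Z (f ` topspace T)) (f ` S)"
    using S by (simp add: open_map_def)
  then obtain W where W: "openin Z W" "f ` S = W \<inter> f ` topspace T"
    by (auto simp: openin_subtopology)
  have inj: "inj_on f (topspace T)"
    using hm by (rule homeomorphic_imp_injective_map)
  have "f t \<in> U \<inter> W \<longleftrightarrow> t \<in> S" if t: "t \<in> topspace T" for t
  proof
    assume "f t \<in> U \<inter> W"
    then have "f t \<in> f ` S" using W(2) t by blast
    then obtain s where "s \<in> S" "f t = f s" by blast
    then show "t \<in> S"
      using inj_onD[OF inj _ t] openin_subset[OF S] by blast
  next
    assume "t \<in> S"
    then have "f t \<in> f ` S" by blast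
    then show "f t \<in> U \<inter> W" using W(2) U(2) by blast
  qed
  then show ?thesis
    using that[of "U \<inter> W"] openin_Int[OF U(1) W(1)] by blast
qed

lemma charts_cover:
  assumes "z \<in> topspace B"
  shows "\<exists>V \<tau>. (V, \<tau>) \<in> charts \<and> z \<in> V"
proof -
  consider t where "t \<in> topspace T" "z = l (u t)" "z = r (v t)"
    | x where "x \<in> topspace X - u ` topspace T" "z = l x"
    | y where "y \<in> topspace Y - v ` topspace T" "z = r y"
  proof -
    have "z \<in> l ` topspace X \<or> z \<in> r ` topspace Y"
      using assms by (simp add: topspace_glue)
    moreover have "l (u t) = r (v t)" if "t \<in> topspace T" for t
      using that l_eq_r_iff by blast
    ultimately show ?thesis using that by blast
  qed
  then show ?thesis
  proof cases
    case 2
    obtain U \<alpha> where U: "openin X U" "x \<in> U" "U \<subseteq> topspace X - u ` topspace T" "potential X G \<Phi> U \<alpha>"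
      by (rule potential_exists[OF lscX is_group \<Phi> openin_diff[OF openin_topspace closed_u] 2(1)]) (rule that)
    have "\<exists>\<tau>. (l ` U \<union> r ` {}, \<tau>) \<in> charts"
      by (rule chartI[OF U(1) openin_empty _ U(4) potential_empty]) (use U(3) in auto)
    then show ?thesis using U(2) 2(2) by blast
  next
    case 3
    obtain U \<alpha> where U: "openin Y U" "y \<in> U" "U \<subseteq> topspace Y - v ` topspace T" "potential Y G \<Psi> U \<alpha>"
      by (rule potential_exists[OF lscY is_group \<Psi> openin_diff[OF openin_topspace closed_v] 3(1)]) (rule that)
    have "\<exists>\<tau>. (l ` {} \<union> r ` U, \<tau>) \<in> charts"
      by (rule chartI[OF openin_empty U(1) _ potential_empty U(4)]) (use U(3) in auto)
    then show ?thesis using U(2) 3(2) by blast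
  next
    case 1
    have cu: "continuous_map T X u" and cv: "continuous_map T Y v"
      using u v by (auto simp: embedding_map_def dest!: homeomorphic_imp_continuous_map intro: continuous_map_into_fulltopology)
    then have ut: "u t \<in> topspace X" "v t \<in> topspace Y"
      using 1(1) by (auto simp: continuous_map_def)
    obtain U \<alpha> where U: "openin X U" "u t \<in> U" "potential X G \<Phi> U \<alpha>" "\<alpha> (u t) = \<one>"
      by (rule potential_exists[OF lscX is_group \<Phi> openin_topspace ut(1)]) (rule that)
    obtain V \<beta> where V: "openin Y V" "v t \<in> V" "potential Y G \<Psi> V \<beta>" "\<beta> (v t) = \<one>"
      by (rule potential_exists[OF lscY is_group \<Psi> openin_topspace ut(2)]) (rule that)
    have op: "openin T ({s \<in> topspace T. u s \<in> U} \<inter> {s \<in> topspace T. v s \<in> V})"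
      using openin_continuous_map_preimage[OF cu U(1)] openin_continuous_map_preimage[OF cv V(1)] by (rule openin_Int)
    have "t \<in> {s \<in> topspace T. u s \<in> U} \<inter> {s \<in> topspace T. v s \<in> V}"
      using 1(1) U(2) V(2) by simp
    \<comment> \<open>Path-connectedness of \<open>S\<close> joins every seam point of the chart to
      \<open>t\<close>, where both primitives are the unit; \<open>agree\<close> along that path
      gives their equality.\<close>
    then obtain S where S: "openin T S" "t \<in> S" "path_connectedin T S"
      "S \<subseteq> {s \<in> topspace T. u s \<in> U} \<inter> {s \<in> topspace T. v s \<in> V}"
      using lpcT[unfolded locally_path_connected_space, rule_format, OF conjI[OF op]] by blast
    have uS: "u ` S \<subseteq> U" and vS: "v ` S \<subseteq> V"
      using S(4) by auto
    obtain U' where U': "openin X U'" "U' \<subseteq> U" "\<And>s. s \<in> topspace T \<Longrightarrow> u s \<in> U' \<longleftrightarrow> s \<in> S"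
      by (rule shrink[OF u S(1) U(1) uS]) (rule that)
    obtain V' where V': "openin Y V'" "V' \<subseteq> V" "\<And>s. s \<in> topspace T \<Longrightarrow> v s \<in> V' \<longleftrightarrow> s \<in> S"
      by (rule shrink[OF v S(1) V(1) vS]) (rule that)
    have "\<exists>\<tau>. (l ` U' \<union> r ` V', \<tau>) \<in> charts"
    proof (rule chartI[OF U'(1) V'(1) _ potential_mono[OF U(3) U'(2)] potential_mono[OF V(3) V'(2)]])
      fix s assume s: "s \<in> topspace T"
      show "u s \<in> U' \<longleftrightarrow> v s \<in> V'" using U'(3)[OF s] V'(3)[OF s] by simp
      assume "u s \<in> U'"
      then have "s \<in> S" using U'(3)[OF s] by simp
      then obtain p where p: "pathin T p" "p ` {0..1} \<subseteq> S" "p 0 = t" "p 1 = s"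
        using S(2,3) unfolding path_connectedin by (metis image_subset_iff_funcset)
      have "pathin X (u \<circ> p)" "pathin Y (v \<circ> p)"
        using p(1) cu cv by (simp_all add: pathin_compose)
      moreover have "(u \<circ> p) ` {0..1} \<subseteq> U" "(v \<circ> p) ` {0..1} \<subseteq> V"
        using p(2) S(4) by auto
      ultimately have "\<Phi> (u \<circ> p) = inv \<alpha> (u t) \<otimes> \<alpha> (u s)" "\<Psi> (v \<circ> p) = inv \<beta> (v t) \<otimes> \<beta> (v s)"
        using U(3) V(3) p(3,4) unfolding potential_def by auto
      moreover have "\<alpha> (u s) \<in> carrier G" "\<beta> (v s) \<in> carrier G"
        using U(3) V(3) \<open>s \<in> S\<close> S(4) unfolding potential_def by auto
      ultimately show "\<alpha> (u s) = \<beta> (v s)"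
        using agree[OF p(1)] U(4) V(4) by simp
    qed
    moreover have "u t \<in> U'" using U'(3)[OF 1(1)] S(2) by simp
    ultimately show ?thesis using 1(2) by blast
  qed
qed

text \<open>Along a path in a path-connected neighbourhood both primitives have the same increment
  \<open>\<Xi> p\<close>, so their quotient stays constant.\<close>

lemma potential_ratio:
  assumes Z: "locally_simply_connected Z" and \<Xi>: "path_functor Z G \<Xi>"
    and \<alpha>: "potential Z G \<Xi> U \<alpha>" "openin Z U" and \<beta>: "potential Z G \<Xi> V \<beta>" "openin Z V"
  shows "openin Z {x \<in> U \<inter> V. \<alpha> x \<otimes> inv \<beta> x = a}"
proof (subst openin_subopen, clarify)
  fix x assume x: "x \<in> U" "x \<in> V" and a: "a = \<alpha> x \<otimes> inv \<beta> x"
  obtain W \<gamma> where W: "openin Z W" "x \<in> W" "W \<subseteq> U \<inter> V" "path_connectedin Z W"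
    by (rule potential_exists[OF Z is_group \<Xi> openin_Int[OF \<alpha>(2) \<beta>(2)], of x]) (use x that in auto)
  have eq: "\<alpha> y \<otimes> inv \<beta> y = a" if y: "y \<in> W" for y
  proof -
    obtain p where p: "pathin Z p" "p ` {0..1} \<subseteq> W" "p 0 = x" "p 1 = y"
      using W(2,4) y unfolding path_connectedin by (metis image_subset_iff_funcset)
    have cl: "\<alpha> x \<in> carrier G" "\<alpha> y \<in> carrier G" "\<beta> x \<in> carrier G" "\<beta> y \<in> carrier G"
      using \<alpha>(1) \<beta>(1) W(3) x y unfolding potential_def by auto
    have "\<Xi> p = inv \<alpha> x \<otimes> \<alpha> y" "\<Xi> p = inv \<beta> x \<otimes> \<beta> y"
      using \<alpha>(1) \<beta>(1) p W(3) unfolding potential_def by blast+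
    then have "\<alpha> y = \<alpha> x \<otimes> (inv \<beta> x \<otimes> \<beta> y)"
      using cl cancel_left(1) by metis
    then show ?thesis
      using cl a by (simp add: m_assoc)
  qed
  have "W \<subseteq> {y \<in> U \<inter> V. \<alpha> y \<otimes> inv \<beta> y = \<alpha> x \<otimes> inv \<beta> x}"
  proof
    fix y assume "y \<in> W"
    then show "y \<in> {y \<in> U \<inter> V. \<alpha> y \<otimes> inv \<beta> y = \<alpha> x \<otimes> inv \<beta> x}"
      using W(3) eq[of y] unfolding a by blast
  qed
  then show "\<exists>S. openin Z S \<and> x \<in> S \<and> S \<subseteq> {y \<in> U \<inter> V. \<alpha> y \<otimes> inv \<beta> y = \<alpha> x \<otimes> inv \<beta> x}"
    using W(1,2) by blast
qed

sublocale local_system G B charts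
proof
  show "openin B V" if "(V, \<tau>) \<in> charts" for V \<tau>
    using that by (simp add: charts_def compatible_def)
  show "\<tau> z \<in> carrier G" if "(V, \<tau>) \<in> charts" "z \<in> V" for V \<tau> z
    using that by (simp add: charts_def compatible_def)
  show "\<exists>V \<tau>. (V, \<tau>) \<in> charts \<and> z \<in> V" if "z \<in> topspace B" for z
    using charts_cover[OF that] .
  fix V \<tau> V' \<tau>' a assume "(V, \<tau>) \<in> charts" "(V', \<tau>') \<in> charts"
  then have c: "compatible V \<tau>" "compatible V' \<tau>'"
    by (simp_all add: charts_def)
  have op: "openin X {x \<in> topspace X. l x \<in> V}" "openin Y {y \<in> topspace Y. r y \<in> V}"
    "openin X {x \<in> topspace X. l x \<in> V'}" "openin Y {y \<in> topspace Y. r y \<in> V'}"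
    using c by (simp_all add: compatible_def openin_glue)
  have pot: "potential X G \<Phi> {x \<in> topspace X. l x \<in> V} (\<tau> \<circ> l)" "potential X G \<Phi> {x \<in> topspace X. l x \<in> V'} (\<tau>' \<circ> l)"
    "potential Y G \<Psi> {y \<in> topspace Y. r y \<in> V} (\<tau> \<circ> r)" "potential Y G \<Psi> {y \<in> topspace Y. r y \<in> V'} (\<tau>' \<circ> r)"
    using c unfolding compatible_def by blast+
  have "V \<subseteq> l ` topspace X \<union> r ` topspace Y"
    using c(1) by (simp add: compatible_def openin_glue)
  moreover have "openin X ({x \<in> {x \<in> topspace X. l x \<in> V} \<inter> {x \<in> topspace X. l x \<in> V'}. (\<tau> \<circ> l) x \<otimes> inv (\<tau>' \<circ> l) x = a})"
    using potential_ratio[OF lscX \<Phi> pot(1) op(1) pot(2) op(3)] .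
  moreover have "openin Y ({y \<in> {y \<in> topspace Y. r y \<in> V} \<inter> {y \<in> topspace Y. r y \<in> V'}. (\<tau> \<circ> r) y \<otimes> inv (\<tau>' \<circ> r) y = a})"
    using potential_ratio[OF lscY \<Psi> pot(3) op(2) pot(4) op(4)] .
  moreover have "{x \<in> {x \<in> topspace X. l x \<in> V} \<inter> {x \<in> topspace X. l x \<in> V'}. (\<tau> \<circ> l) x \<otimes> inv (\<tau>' \<circ> l) x = a}
      = {x \<in> topspace X. l x \<in> {z \<in> V \<inter> V'. \<tau> z \<otimes> inv \<tau>' z = a}}"
    "{y \<in> {y \<in> topspace Y. r y \<in> V} \<inter> {y \<in> topspace Y. r y \<in> V'}. (\<tau> \<circ> r) y \<otimes> inv (\<tau>' \<circ> r) y = a}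
      = {y \<in> topspace Y. r y \<in> {z \<in> V \<inter> V'. \<tau> z \<otimes> inv \<tau>' z = a}}"
    by auto
  ultimately show "openin B {z \<in> V \<inter> V'. \<tau> z \<otimes> inv \<tau>' z = a}"
    unfolding openin_glue by auto
qed

text \<open>The section along \<open>l \<circ> p\<close> is \<open>\<Phi>\<close> of the initial
  segment of \<open>p\<close> up to time \<open>t\<close>; near \<open>t\<close> it changes by
  \<open>\<Phi>\<close> of a short segment lying in one chart.\<close>

lemma transport_left:
  assumes p: "pathin X p"
  shows "transport (l \<circ> p) = \<Phi> p"
proof -
  define q where "q t s = p (s * t)" for t s :: real
  have q: "pathin X (q t)" if "t \<in> {0..1}" for t
  proof -
    have "q t = p \<circ> (\<lambda>s. s * t)" by (simp add: q_def fun_eq_iff)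
    then show ?thesis
      using that p by (auto intro!: pathin_reparam continuous_intros simp: mult_le_one)
  qed
  have seg01: "t + s * (t' - t) \<in> {0..1}" if "t \<in> {0..1}" "t' \<in> {0..1}" "s \<in> {0..1}" for t t' s :: real
  proof -
    have "(1 - s) *\<^sub>R t + s *\<^sub>R t' \<in> {0..1}"
      using that by (intro convexD_alt) auto
    moreover have "(1 - s) *\<^sub>R t + s *\<^sub>R t' = t + s * (t' - t)"
      by (simp add: algebra_simps)
    ultimately show ?thesis by simp
  qed
  define m where "m t t' s = p (t + s * (t' - t))" for t t' s :: real
  have m: "pathin X (m t t')" if "t \<in> {0..1}" "t' \<in> {0..1}" for t t'
  proof -
    have "m t t' = p \<circ> (\<lambda>s. t + s * (t' - t))" by (simp add: m_def fun_eq_iff)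
    moreover have "t + s * (t' - t) \<in> {0..1}" if "s \<in> {0..1}" for s
      using seg01[of t t' s] that \<open>t \<in> {0..1}\<close> \<open>t' \<in> {0..1}\<close> by simp
    ultimately show ?thesis
      using p by (auto intro!: pathin_reparam continuous_intros)
  qed
  have qm: "\<Phi> (q t') = \<Phi> (q t) \<otimes> \<Phi> (m t t')" if "t \<in> {0..1}" "t' \<in> {0..1}" for t t'
  proof -
    have e: "q t 1 = m t t' 0" by (simp add: q_def m_def)
    let ?w = "join_path (\<lambda>s. s * t) (\<lambda>s. t + s * (t' - t))"
    have w: "pathin unit_interval ?w"
    proof (rule pathin_join)
      show "pathin unit_interval (\<lambda>s. s * t)"
        using that by (auto simp: pathin_def continuous_map_in_subtopology mult_le_one intro!: continuous_intros)
      have "continuous_on {0..1} (\<lambda>s. t + s * (t' - t))"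
        by (intro continuous_intros)
      then show "pathin unit_interval (\<lambda>s. t + s * (t' - t))"
        using seg01[OF that] by (auto simp: pathin_def continuous_map_in_subtopology image_subset_iff)
    qed simp
    have "path_homotopic X (p \<circ> ?w) (p \<circ> (\<lambda>s. s * t'))"
    proof (rule path_homotopic_reparam[OF p])
      show "continuous_on {0..1} ?w" "?w ` {0..1} \<subseteq> {0..1}"
        using w by (auto simp: pathin_def continuous_map_in_subtopology)
    qed (use that in \<open>auto intro!: continuous_intros simp: mult_le_one\<close>)
    moreover have "p \<circ> ?w = join_path (q t) (m t t')" "p \<circ> (\<lambda>s. s * t') = q t'"
      by (auto simp: join_path_def q_def m_def fun_eq_iff)
    ultimately have "\<Phi> (q t') = \<Phi> (join_path (q t) (m t t'))"
      using path_functorD(3)[OF \<Phi>] by metis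
    then show ?thesis
      using path_functorD(2)[OF \<Phi> q m e] that by simp
  qed
  have cl: "\<Phi> (q t) \<in> carrier G" if "t \<in> {0..1}" for t
    using path_functorD(1)[OF \<Phi> q[OF that]] .
  have lp: "pathin B (l \<circ> p)"
    using p continuous_map_glue_left by (rule pathin_compose)
  have "flat_section unit_interval (l \<circ> p) (\<lambda>t. \<Phi> (q t))"
    unfolding flat_section_def
  proof (intro conjI ballI)
    show "continuous_map unit_interval B (l \<circ> p)" using lp by (simp add: pathin_def)
    show "\<Phi> (q t) \<in> carrier G" if "t \<in> topspace unit_interval" for t using cl that by simp
    fix t assume "t \<in> topspace unit_interval"
    then have t: "t \<in> {0..1}" by simp
    have "(l \<circ> p) t \<in> topspace B"
      using lp t by (auto simp: pathin_def continuous_map_def)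
    then obtain V \<tau> where V: "(V, \<tau>) \<in> charts" "(l \<circ> p) t \<in> V" using charts_cover by blast
    have pot: "potential X G \<Phi> {x \<in> topspace X. l x \<in> V} (\<tau> \<circ> l)"
      using V(1) by (simp add: charts_def compatible_def)
    have "openin unit_interval {s \<in> topspace unit_interval. (l \<circ> p) s \<in> V}"
      using openin_continuous_map_preimage[OF lp[unfolded pathin_def] chart_open[OF V(1)]] .
    then obtain W where W: "open W" "{s \<in> topspace unit_interval. (l \<circ> p) s \<in> V} = {0..1} \<inter> W"
      unfolding openin_open by blast
    then have "t \<in> W" using t V(2) by auto
    then obtain e where e: "0 < e" "ball t e \<subseteq> W"
      using W(1) open_contains_ball by blast
    have "flat_at unit_interval (l \<circ> p) (\<lambda>t. \<Phi> (q t)) t V \<tau>"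
    proof (rule flat_atI)
      show "openin unit_interval ({0..1} \<inter> ball t e)"
        by (simp add: openin_open_Int)
      show "t \<in> {0..1} \<inter> ball t e" using t e(1) by simp
      fix s assume s: "s \<in> {0..1} \<inter> ball t e"
      have "s \<in> {s \<in> topspace unit_interval. (l \<circ> p) s \<in> V}"
        unfolding W(2) using s e(2) by blast
      then show "(l \<circ> p) s \<in> V" by simp
      have seg: "t + x * (s - t) \<in> {0..1} \<inter> ball t e" if x: "x \<in> {0..1}" for x
      proof -
        have "convex ({0..1} \<inter> ball t e)" by (intro convex_Int convex_ball) simp
        from convexD_alt[OF this _ s, of t x] show ?thesis
          using t e(1) x by (simp add: algebra_simps)
      qed
      have s01: "s \<in> {0..1}" using s by simp
      have "m t s ` {0..1} \<subseteq> {x \<in> topspace X. l x \<in> V}"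
      proof (rule image_subsetI)
        fix x :: real assume "x \<in> {0..1}"
        then have "t + x * (s - t) \<in> {s \<in> topspace unit_interval. (l \<circ> p) s \<in> V}"
          using seg e(2) unfolding W(2) by blast
        moreover have "m t s x \<in> topspace X"
          using m[OF t s01] \<open>x \<in> {0..1}\<close> by (auto simp: pathin_def continuous_map_def)
        ultimately show "m t s x \<in> {x \<in> topspace X. l x \<in> V}" by (simp add: m_def)
      qed
      then have "\<Phi> (m t s) = inv \<tau> (l (p t)) \<otimes> \<tau> (l (p s))"
        using pot m[OF t s01] unfolding potential_def by (auto simp: m_def)
      moreover have "\<tau> (l (p t)) \<in> carrier G" "\<tau> (l (p s)) \<in> carrier G"
        using chart_closed[OF V(1)] V(2) \<open>(l \<circ> p) s \<in> V\<close> by auto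
      ultimately show "\<Phi> (q s) \<otimes> inv \<tau> ((l \<circ> p) s) = \<Phi> (q t) \<otimes> inv \<tau> ((l \<circ> p) t)"
        using qm[OF t s01] cl[OF t] by (simp add: m_assoc)
    qed
    then show "\<exists>V \<tau>. (V, \<tau>) \<in> charts \<and> flat_at unit_interval (l \<circ> p) (\<lambda>t. \<Phi> (q t)) t V \<tau>"
      using V(1) by blast
  qed
  then have "transport (l \<circ> p) = inv \<Phi> (q 0) \<otimes> \<Phi> (q 1)"
    by (rule transport_eq)
  moreover have "q 0 = (\<lambda>s. p 0)" "q 1 = p"
    by (simp_all add: q_def fun_eq_iff)
  moreover have "\<Phi> (\<lambda>s. p 0) = \<one>"
    using path_functor_const[OF \<Phi> is_group path_start_in_topspace[OF p]] .
  ultimately show ?thesis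
    using path_functorD(1)[OF \<Phi> p] by simp
qed

end

section \<open>Manifolds are locally simply connected\<close>

lemma convex_neighbourhood:
  assumes W: "openin real_seqs W" "a \<in> W"
  obtains K where "openin real_seqs K" "a \<in> K" "K \<subseteq> W" "convex_seqs K"
proof -
  obtain U where U: "finite {i. U i \<noteq> (UNIV :: real set)}" "\<And>i::nat. open (U i)" "a \<in> Pi\<^sub>E UNIV U" "Pi\<^sub>E UNIV U \<subseteq> W"
    using W unfolding openin_product_topology_alt by auto
  have "\<exists>e>0. ball (a i) e \<subseteq> U i" for i
    using U(2)[of i] U(3) by (auto simp: open_contains_ball)
  then obtain e where e: "\<And>i. 0 < e i" "\<And>i. ball (a i) (e i) \<subseteq> U i"
    by metis
  define S where "S i = (if U i = UNIV then UNIV else ball (a i) (e i))" for i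
  have "finite {i. S i \<noteq> UNIV}"
    by (rule finite_subset[OF _ U(1)]) (auto simp: S_def)
  then have "openin real_seqs (Pi\<^sub>E UNIV S)"
    by (subst openin_PiE_gen) (auto simp: S_def)
  moreover have "a \<in> Pi\<^sub>E UNIV S"
    using e by (auto simp: S_def)
  moreover have "Pi\<^sub>E UNIV S \<subseteq> W"
  proof -
    have "S i \<subseteq> U i" for i using e(2) by (simp add: S_def)
    then have "Pi\<^sub>E UNIV S \<subseteq> Pi\<^sub>E UNIV U" by (rule PiE_mono)
    then show ?thesis using U(4) by (rule order_trans)
  qed
  moreover have "convex (S i)" for i
    by (simp add: S_def)
  then have "convex_seqs (Pi\<^sub>E UNIV S)"
    unfolding convex_seqs_def using convexD_alt[of "S _"] by (auto simp: PiE_UNIV_domain Pi_iff)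
  ultimately show ?thesis by (rule that)
qed

lemma path_connectedin_convex:
  assumes K: "convex_seqs K" shows "path_connectedin real_seqs K"
  unfolding path_connectedin
proof (intro conjI ballI)
  fix x y assume xy: "x \<in> K" "y \<in> K"
  have "pathin real_seqs (\<lambda>t i. (1 - t) * x i + t * y i)"
    unfolding pathin_seqs by (intro allI continuous_intros)
  moreover have "(\<lambda>t i. (1 - t) * x i + t * y i) \<in> {0..1} \<rightarrow> K"
    using K xy by (auto simp: convex_seqs_def)
  ultimately show "\<exists>g. pathin real_seqs g \<and> g \<in> {0..1} \<rightarrow> K \<and> g 0 = x \<and> g 1 = y"
    by (intro exI[of _ "\<lambda>t i. (1 - t) * x i + t * y i"]) simp
qed simp

text \<open>A convex neighbourhood in the half-space is transported by the chart, and paths in it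
  are deformed linearly. Boundary points are covered because the half-space is itself
  convex.\<close>

lemma compact_manifold_locally_simply_connected:
  assumes "compact_manifold n X"
  shows "locally_simply_connected X"
  unfolding locally_simply_connected_def
proof (intro allI impI)
  fix x N assume N: "openin X N" "x \<in> N"
  have "x \<in> topspace X" using N openin_subset by blast
  then obtain U0 V0 where U0: "openin X U0" "x \<in> U0" and V0: "openin (half_space n) V0"
    and hom: "subtopology X U0 homeomorphic_space subtopology (half_space n) V0"
    using assms unfolding compact_manifold_def by blast
  obtain f g where fg: "homeomorphic_maps (subtopology X U0) (subtopology (half_space n) V0) f g"
    using hom unfolding homeomorphic_space_def by blast
  define C where "C = {x::nat \<Rightarrow> real. (\<forall>i\<ge>n. x i = 0) \<and> 0 \<le> x 0}"
  have half: "half_space n = subtopology real_seqs C"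
    by (simp add: half_space_def Euclidean_space_def subtopology_subtopology C_def Int_def)
  have U0X: "U0 \<subseteq> topspace X" and V0C: "V0 \<subseteq> C"
    using openin_subset[OF U0(1)] openin_subset[OF V0] by (auto simp: half)
  have f: "continuous_map (subtopology X U0) (subtopology (half_space n) V0) f"
    and g: "continuous_map (subtopology (half_space n) V0) (subtopology X U0) g"
    and gf: "\<And>z. z \<in> U0 \<Longrightarrow> g (f z) = z" and fg': "\<And>v. v \<in> V0 \<Longrightarrow> f (g v) = v"
    using fg U0X V0C by (auto simp: homeomorphic_maps_def half)
  have fU: "f z \<in> V0" if "z \<in> U0" for z
    using f that U0X by (auto simp: continuous_map_def)
  have gV: "g v \<in> U0" if "v \<in> V0" for v
    using g that V0C by (auto simp: continuous_map_def half)
  have "openin (half_space n) {v \<in> V0. g v \<in> N}"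
  proof -
    have "openin (subtopology X U0) (N \<inter> U0)"
      using N(1) by (auto simp: openin_subtopology)
    from openin_continuous_map_preimage[OF g this]
    have "openin (subtopology (half_space n) V0) {v \<in> topspace (subtopology (half_space n) V0). g v \<in> N \<inter> U0}" .
    moreover have "{v \<in> topspace (subtopology (half_space n) V0). g v \<in> N \<inter> U0} = {v \<in> V0. g v \<in> N}"
      using gV openin_subset[OF V0] by auto
    ultimately show ?thesis
      using openin_open_subtopology[OF V0] by simp
  qed
  then obtain W where W: "openin real_seqs W" "{v \<in> V0. g v \<in> N} = W \<inter> C"
    unfolding half openin_subtopology by blast
  have "f x \<in> {v \<in> V0. g v \<in> N}"
    using fU[OF U0(2)] gf[OF U0(2)] N(2) by simp
  then have "f x \<in> W"
    unfolding W(2) by blast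
  then obtain K0 where K0: "openin real_seqs K0" "f x \<in> K0" "K0 \<subseteq> W" "convex_seqs K0"
    by (rule convex_neighbourhood[OF W(1)]) (rule that)
  \<comment> \<open>Inside the half-space, \<open>W\<close> is the part of \<open>V0\<close> that
    \<open>g\<close> maps into \<open>N\<close>; hence \<open>K\<close> lies in the range of the
    chart and over \<open>N\<close>.\<close>
  define K where "K = K0 \<inter> C"
  have KV: "v \<in> V0" "g v \<in> N" if "v \<in> K" for v
    using that K0(3) W(2) unfolding K_def by blast+
  have "convex_seqs C"
    by (auto simp: convex_seqs_def C_def)
  then have K: "convex_seqs K"
    using K0(4) by (auto simp: convex_seqs_def K_def)
  have fxK: "f x \<in> K"
    using K0(2) fU[OF U0(2)] V0C unfolding K_def by blast
  have gK: "continuous_map (subtopology real_seqs K) X g"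
  proof -
    have "subtopology (subtopology (half_space n) V0) K = subtopology real_seqs K"
      using KV V0C unfolding half subtopology_subtopology by (metis (no_types, lifting) Int_absorb1 inf.absorb_iff2 subset_iff)
    then show ?thesis
      using continuous_map_from_subtopology[OF continuous_map_into_fulltopology[OF g], of K] by simp
  qed
  define U where "U = {z \<in> U0. f z \<in> K}"
  have U_eq: "U = g ` K"
    using gf fg' KV gV unfolding U_def by force
  have "openin X U"
  proof -
    have "openin (subtopology (half_space n) V0) K"
      unfolding K_def half using K0(1) KV(1) V0C K_def by (auto simp: openin_subtopology subtopology_subtopology intro!: exI[of _ K0])
    from openin_continuous_map_preimage[OF f this] have "openin (subtopology X U0) U"
      using U0X by (simp add: U_def Int_absorb1)
    then show ?thesis
      using openin_open_subtopology[OF U0(1)] by simp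
  qed
  moreover have "x \<in> U" using fxK U0(2) by (simp add: U_def)
  moreover have "U \<subseteq> N" using U_eq KV(2) by blast
  moreover have "path_connectedin X U"
    unfolding U_eq
    using path_connectedin_continuous_map_image[OF gK, of K] path_connectedin_convex[OF K]
    by (simp add: path_connectedin_subtopology)
  moreover have "path_homotopic X p q"
    if p: "pathin X p" "p ` {0..1} \<subseteq> U" and q: "pathin X q" "q ` {0..1} \<subseteq> U" and e: "p 0 = q 0" "p 1 = q 1" for p q
  proof -
    have lift: "pathin (subtopology real_seqs K) (f \<circ> p) \<and> (\<forall>t\<in>{0..1}. g (f (p t)) = p t)"
      if p: "pathin X p" "p ` {0..1} \<subseteq> U" for p
    proof -
      have pU: "p t \<in> U0" "f (p t) \<in> K" if "t \<in> {0..1}" for t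
        using subsetD[OF p(2) imageI[OF that]] by (simp_all add: U_def)
      have "pathin (subtopology X U0) p"
        using p(1) pU by (simp add: pathin_subtopology)
      then have "pathin (subtopology (half_space n) V0) (f \<circ> p)"
        using f by (rule pathin_compose)
      then show ?thesis
        using pU gf by (simp add: half pathin_subtopology)
    qed
    have "path_homotopic X p (g \<circ> (f \<circ> p))"
      using lift[OF p] by (intro path_homotopic_eq[OF p(1)]) simp
    also have "path_homotopic X \<dots> (g \<circ> (f \<circ> q))"
      using lift[OF p] lift[OF q] e by (intro path_homotopic_convex[OF gK K]) auto
    also have "path_homotopic X \<dots> q"
      using lift[OF q] by (intro path_homotopic_sym[OF path_homotopic_eq[OF q(1)]]) simp
    finally show ?thesis .
  qed
  ultimately show "\<exists>U. openin X U \<and> x \<in> U \<and> U \<subseteq> N \<and> path_connectedin X U \<and>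
       (\<forall>p q. pathin X p \<longrightarrow> pathin X q \<longrightarrow> p ` {0..1} \<subseteq> U \<longrightarrow> q ` {0..1} \<subseteq> U \<longrightarrow>
          p 0 = q 0 \<longrightarrow> p 1 = q 1 \<longrightarrow> path_homotopic X p q)"
    by (intro exI[of _ U] conjI allI impI)
qed

section \<open>Homology cylinders\<close>

lemma homology_iso_compose:
  assumes "continuous_map X Y f" "continuous_map Y Z g" "homology_iso X Y f" "homology_iso Y Z g"
  shows "homology_iso X Z (g \<circ> f)"
  unfolding homology_iso_def
proof
  fix p :: nat
  have "hom_induced (int p) Y {} Z {} g \<circ> hom_induced (int p) X {} Y {} f \<in> iso (homology_group (int p) X) (homology_group (int p) Z)"
    using assms(3,4) unfolding homology_iso_def by (blast intro: iso_set_trans)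
  then show "hom_induced (int p) X {} Z {} (g \<circ> f) \<in> iso (homology_group (int p) X) (homology_group (int p) Z)"
    by (simp only: hom_induced_compose_empty[OF assms(1,2)])
qed

text \<open>Path-connectedness is read off from \<open>H_0\<close>.\<close>

lemma homology_iso_path_connected:
  assumes "homology_iso X Y f" "path_connected_space X"
  shows "path_connected_space Y"
proof -
  have "hom_induced (int 0) X {} Y {} f \<in> iso (homology_group (int 0) X) (homology_group (int 0) Y)"
    using assms(1) unfolding homology_iso_def by blast
  then have "homology_group 0 X \<cong> homology_group 0 Y"
    unfolding is_iso_def by auto
  then show ?thesis
    using isomorphic_homology_imp_path_connectedness assms(2) by blast
qed

lemma embedding_map_continuous: "embedding_map X Y f \<Longrightarrow> continuous_map X Y f"
  unfolding embedding_map_def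
  using homeomorphic_imp_continuous_map continuous_map_into_fulltopology by blast

text \<open>Base paths to points of \<open>T\<close> are taken inside the image of \<open>T\<close>.
  With the same \<open>e\<close> on both sides of a seam, the extended functors agree on every path
  in \<open>T\<close> as soon as the homomorphisms agree on loops.\<close>

lemma based_paths_along:
  assumes e: "based_paths T t0 e" and t0: "t0 \<in> topspace T" and u: "embedding_map T X u" and X: "path_connected_space X"
  obtains c where "based_paths X (u t0) c" "\<And>t. t \<in> topspace T \<Longrightarrow> c (u t) = u \<circ> e t"
proof -
  have cu: "continuous_map T X u" using embedding_map_continuous[OF u] .
  have inj: "inj_on u (topspace T)"
    using u unfolding embedding_map_def by (rule homeomorphic_imp_injective_map)
  have "u t0 \<in> topspace X" using cu t0 by (auto simp: continuous_map_def)
  then obtain c0 where c0: "based_paths X (u t0) c0"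
    using based_pathsE[OF X] by metis
  define c where "c x = (if x \<in> u ` topspace T then u \<circ> e (inv_into (topspace T) u x) else c0 x)" for x
  have c: "c (u t) = u \<circ> e t" if "t \<in> topspace T" for t
    using that inj by (simp add: c_def)
  have "path_between X (u t0) x (c x)" if "x \<in> topspace X" for x
  proof (cases "x \<in> u ` topspace T")
    case True
    then obtain t where "t \<in> topspace T" "x = u t" by blast
    then show ?thesis
      using c e path_between_image[OF _ cu] by (simp add: based_paths_def)
  next
    case False
    then show ?thesis using c0 that by (simp add: c_def based_paths_def)
  qed
  moreover have "c (u t0) = (\<lambda>t. u t0)"
    using c[OF t0] e by (simp add: based_paths_def o_def)
  ultimately have "based_paths X (u t0) c"
    by (simp add: based_paths_def)
  then show ?thesis using c by (rule that)
qed

text \<open>The part of the structure on which longitudes and the maps on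
  \<open>\<pi>\<^sub>1\<close> depend; it is available for a product and for a cobordism as well as
  for homology cylinders.\<close>

definition marked :: "'s marked_surface \<Rightarrow> ('s, 'a) cylinder \<Rightarrow> bool" where
  "marked S M \<longleftrightarrow> continuous_map (surf S) (mfd M) (mk_plus M) \<and> continuous_map (surf S) (mfd M) (mk_minus M) \<and>
     (\<forall>s\<in>mfd_boundary 2 (surf S). mk_plus M s = mk_minus M s)"

definition marked_map :: "'s marked_surface \<Rightarrow> ('s, 'a) cylinder \<Rightarrow> ('s, 'b) cylinder \<Rightarrow> ('a \<Rightarrow> 'b) \<Rightarrow> bool" where
  "marked_map S M N f \<longleftrightarrow> marked S M \<and> marked S N \<and> continuous_map (mfd M) (mfd N) f \<and>
     (\<forall>s\<in>topspace (surf S). f (mk_plus M s) = mk_plus N s \<and> f (mk_minus M s) = mk_minus N s)"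

locale standard =
  fixes S :: "'s marked_surface" and g n q k :: nat
  assumes n: "1 \<le> n" and S: "standard_surface g n S" and q: "1 \<le> q" and k: "k \<in> {1..2 * g + n - 1}"
begin

abbreviation "\<Sigma> \<equiv> surf S"
abbreviation "pt \<equiv> basept S"
abbreviation "F \<equiv> FS S"

lemma bdry_comp: "i \<in> {1..n} \<Longrightarrow> bdry_comp S i \<subseteq> topspace \<Sigma> \<inter> mfd_boundary 2 \<Sigma>"
proof -
  assume "i \<in> {1..n}"
  then have "bdry_comp S i \<in> connected_components_of (boundary_space 2 \<Sigma>)"
    using S unfolding standard_surface_def bij_betw_def by blast
  from connected_components_of_subset[OF this] show ?thesis by simp
qed

lemma pt: "pt \<in> topspace \<Sigma>" "pt \<in> mfd_boundary 2 \<Sigma>"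
proof -
  have "pt \<in> bdry_comp S n" using S by (simp add: standard_surface_def)
  then show "pt \<in> topspace \<Sigma>" "pt \<in> mfd_boundary 2 \<Sigma>"
    using bdry_comp[of n] n by auto
qed

lemma mfd_S: "compact_manifold 2 \<Sigma>"
  using S by (simp add: standard_surface_def oriented_manifold_def)

lemma lsc_S: "locally_simply_connected \<Sigma>"
  by (rule compact_manifold_locally_simply_connected[OF mfd_S])

lemma pc_S: "path_connected_space \<Sigma>"
  using S path_connected_eq_connected_space[OF locally_simply_connected_imp_locally_path_connected[OF lsc_S]]
  by (simp add: standard_surface_def)

sublocale F: group F
  unfolding FS_def by (rule group_pi1[OF pt(1)])

text \<open>\<open>alpha S k\<close> ends on the boundary of the surface, where the two markings
  agree; this is why the boundary longitudes are loops.\<close>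

lemma alpha:
  assumes "k \<le> n - 1"
  shows "path_between \<Sigma> pt (alpha S k 1) (alpha S k)" "alpha S k 1 \<in> mfd_boundary 2 \<Sigma>"
proof -
  have "k \<in> {1..n - 1}" using assms k by simp
  then have par: "parametrizes \<Sigma> (beta S k) (bdry_comp S k)" and pb: "path_between \<Sigma> pt (beta S k 0) (alpha S k)"
    using S unfolding standard_surface_def by blast+
  have e: "alpha S k 1 = beta S k 0" using path_betweenD(3)[OF pb] .
  show "path_between \<Sigma> pt (alpha S k 1) (alpha S k)" using pb e by simp
  have "beta S k 0 \<in> bdry_comp S k"
    using par unfolding parametrizes_def by (metis atLeastAtMost_iff imageI order_refl zero_le_one)
  then show "alpha S k 1 \<in> mfd_boundary 2 \<Sigma>"
    using e bdry_comp[of k] \<open>k \<in> {1..n - 1}\<close> le_diff_conv2[OF n, of k] by auto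
qed

lemma std_gen_closed: "std_gen g n S k \<in> carrier F"
  using S k unfolding standard_surface_def freely_generated_by_def by blast

text \<open>Meridians and longitudes of the handles call for the same argument, so both are treated
  as one generator \<open>std_gen\<close>.\<close>

lemma all_longitudes_eq:
  "all_longitudes g n S M k = (if k \<le> n - 1 then bdry_longitude S M k else difference_loop S M (std_gen g n S k))"
  by (simp add: all_longitudes_def std_gen_def)

context
  fixes M :: "('s, 'a) cylinder"
  assumes M: "marked S M"
begin

lemma marked_continuous: "continuous_map \<Sigma> (mfd M) (mk_plus M)" "continuous_map \<Sigma> (mfd M) (mk_minus M)"
  and marked_boundary: "s \<in> mfd_boundary 2 \<Sigma> \<Longrightarrow> mk_plus M s = mk_minus M s"
  using M by (auto simp: marked_def)

lemma hom_plus: "group_hom F (FM S M) (pi1_map (mfd M) (mk_plus M))"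
  unfolding FS_def FM_def by (rule group_hom_pi1_map[OF marked_continuous(1) pt(1)]) simp

text \<open>The base point lies on the boundary, where the markings agree, so \<open>i_-\<close>
  also lands in the group based at the image of \<open>i_+\<close>.\<close>

lemma hom_minus: "group_hom F (FM S M) (pi1_map (mfd M) (mk_minus M))"
  unfolding FS_def FM_def
  by (rule group_hom_pi1_map[OF marked_continuous(2) pt(1)]) (simp add: marked_boundary[OF pt(2)])

lemma group_FM: "group (FM S M)"
  using hom_plus by (simp add: group_hom_def)

lemma longitude_path:
  assumes "k \<le> n - 1"
  shows "path_between (mfd M) (mk_plus M pt) (mk_plus M (alpha S k 1)) (mk_plus M \<circ> alpha S k)"
    and "path_between (mfd M) (mk_plus M (alpha S k 1)) (mk_plus M pt) (mk_minus M \<circ> reverse_path (alpha S k))"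
  using path_between_image[OF alpha(1)[OF assms] marked_continuous(1)]
    path_between_image[OF path_between_reverse[OF alpha(1)[OF assms]] marked_continuous(2)]
    marked_boundary[OF alpha(2)[OF assms]] marked_boundary[OF pt(2)] by simp_all

lemma longitude_closed: "all_longitudes g n S M k \<in> carrier (FM S M)"
proof (cases "k \<le> n - 1")
  case True
  then show ?thesis
    using path_class_in_pi1[OF path_between_join[OF longitude_path[OF True]]]
    by (simp add: all_longitudes_eq bdry_longitude_def FM_def)
next
  case False
  interpret p: group_hom F "FM S M" "pi1_map (mfd M) (mk_plus M)" by (rule hom_plus)
  interpret m: group_hom F "FM S M" "pi1_map (mfd M) (mk_minus M)" by (rule hom_minus)
  show ?thesis
    using False std_gen_closed by (simp add: all_longitudes_eq difference_loop_def)
qed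

end

context
  fixes M :: "('s, 'a) cylinder" and N :: "('s, 'b) cylinder" and f :: "'a \<Rightarrow> 'b"
  assumes f: "marked_map S M N f"
begin

lemma marked_mapD: "marked S M" "marked S N" "continuous_map (mfd M) (mfd N) f"
  "s \<in> topspace \<Sigma> \<Longrightarrow> f (mk_plus M s) = mk_plus N s" "s \<in> topspace \<Sigma> \<Longrightarrow> f (mk_minus M s) = mk_minus N s"
  using f by (simp_all add: marked_map_def)

lemma hom_marked: "group_hom (FM S M) (FM S N) (pi1_map (mfd N) f)"
proof -
  have "mk_plus M pt \<in> topspace (mfd M)"
    using marked_continuous(1)[OF marked_mapD(1)] pt(1) by (auto simp: continuous_map_def)
  then show ?thesis
    unfolding FM_def using marked_mapD(4)[OF pt(1)] by (intro group_hom_pi1_map marked_mapD) simp_all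
qed

lemma marked_map_plus: "x \<in> carrier F \<Longrightarrow> pi1_map (mfd N) f (pi1_map (mfd M) (mk_plus M) x) = pi1_map (mfd N) (mk_plus N) x"
  and marked_map_minus: "x \<in> carrier F \<Longrightarrow> pi1_map (mfd N) f (pi1_map (mfd M) (mk_minus M) x) = pi1_map (mfd N) (mk_minus N) x"
proof -
  note c = marked_continuous[OF marked_mapD(1)]
  assume x: "x \<in> carrier F"
  show "pi1_map (mfd N) f (pi1_map (mfd M) (mk_plus M) x) = pi1_map (mfd N) (mk_plus N) x"
    unfolding pi1_map_comp[OF x[unfolded FS_def] c(1) marked_mapD(3)]
    using marked_mapD(4) by (intro pi1_map_cong[OF x[unfolded FS_def] continuous_map_compose[OF c(1) marked_mapD(3)]]) simp
  show "pi1_map (mfd N) f (pi1_map (mfd M) (mk_minus M) x) = pi1_map (mfd N) (mk_minus N) x"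
    unfolding pi1_map_comp[OF x[unfolded FS_def] c(2) marked_mapD(3)]
    using marked_mapD(5) by (intro pi1_map_cong[OF x[unfolded FS_def] continuous_map_compose[OF c(2) marked_mapD(3)]]) simp
qed

lemma marked_map_plus_q:
  assumes "C \<in> carrier (nil_quot F q)"
  shows "nil_quot_map (FM S N) q (pi1_map (mfd N) f) (plus_q S q M C) = plus_q S q N C"
    and "nil_quot_map (FM S N) q (pi1_map (mfd N) f) (minus_q S q M C) = minus_q S q N C"
  unfolding plus_q_def minus_q_def
  using nil_quot_map_comp[OF hom_plus[OF marked_mapD(1)] hom_marked hom_plus[OF marked_mapD(2)] assms marked_map_plus]
    nil_quot_map_comp[OF hom_minus[OF marked_mapD(1)] hom_marked hom_minus[OF marked_mapD(2)] assms marked_map_minus]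
  by simp_all

lemma marked_map_longitude:
  "pi1_map (mfd N) f (all_longitudes g n S M k) = all_longitudes g n S N k"
proof (cases "k \<le> n - 1")
  case True
  note lp = longitude_path[OF marked_mapD(1) True]
  let ?p = "join_path (mk_plus M \<circ> alpha S k) (mk_minus M \<circ> reverse_path (alpha S k))"
  have p: "pathin (mfd M) ?p"
    using path_betweenD(1)[OF path_between_join[OF lp]] .
  have a: "alpha S k t \<in> topspace \<Sigma>" if "t \<in> {0..1}" for t
    using path_image_subset_topspace[OF path_betweenD(1)[OF alpha(1)[OF True]]] that by blast
  have "path_homotopic (mfd N) (f \<circ> ?p) (join_path (mk_plus N \<circ> alpha S k) (mk_minus N \<circ> reverse_path (alpha S k)))"
    using a by (intro path_homotopic_eq pathin_compose[OF p marked_mapD(3)])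
      (simp add: join_path_def reverse_path_def marked_mapD(4,5))
  then show ?thesis
    using True pi1_map_path_class[OF p marked_mapD(3)] path_class_eqI
    by (simp add: all_longitudes_eq bdry_longitude_def)
next
  case False
  interpret p: group_hom F "FM S M" "pi1_map (mfd M) (mk_plus M)" by (rule hom_plus[OF marked_mapD(1)])
  interpret m: group_hom F "FM S M" "pi1_map (mfd M) (mk_minus M)" by (rule hom_minus[OF marked_mapD(1)])
  interpret h: group_hom "FM S M" "FM S N" "pi1_map (mfd N) f" by (rule hom_marked)
  show ?thesis
    using False std_gen_closed
    by (simp add: all_longitudes_eq difference_loop_def marked_map_plus marked_map_minus del: m.hom_inv)
qed

lemma marked_map_longitude_q:
  "nil_quot_map (FM S N) q (pi1_map (mfd N) f) (lcs (FM S M) q #>\<^bsub>FM S M\<^esub> all_longitudes g n S M k)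
    = lcs (FM S N) q #>\<^bsub>FM S N\<^esub> all_longitudes g n S N k"
  using nil_quot_map_coset[OF hom_marked longitude_closed[OF marked_mapD(1)]] marked_map_longitude by simp

end

section \<open>The invariants of a homology cylinder and of cobordant ones\<close>

lemma plus_q_iso:
  assumes M: "marked S M" and H: "homology_iso \<Sigma> (mfd M) (mk_plus M)"
  shows "plus_q S q M \<in> iso (nil_quot F q) (nil_quot (FM S M) q)"
  unfolding plus_q_def FM_def FS_def
  by (rule stallings[OF marked_continuous(1)[OF M] H pc_S homology_iso_path_connected[OF H pc_S] pt(1) refl q])

lemma homology_cylinderD:
  assumes "homology_cylinder S M"
  shows "marked S M" "homology_iso \<Sigma> (mfd M) (mk_plus M)" "compact_manifold 3 (mfd M)"
    "embedding_map \<Sigma> (mfd M) (mk_plus M)" "embedding_map \<Sigma> (mfd M) (mk_minus M)"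
proof -
  show e: "embedding_map \<Sigma> (mfd M) (mk_plus M)" "embedding_map \<Sigma> (mfd M) (mk_minus M)"
    using assms unfolding homology_cylinder_def embedding_map_in_subtopology by blast+
  show "marked S M"
    unfolding marked_def using assms embedding_map_continuous[OF e(1)] embedding_map_continuous[OF e(2)]
    unfolding homology_cylinder_def by blast
  show "homology_iso \<Sigma> (mfd M) (mk_plus M)" "compact_manifold 3 (mfd M)"
    using assms unfolding homology_cylinder_def oriented_manifold_def by blast+
qed

context
  fixes M :: "('s, 'a) cylinder"
  assumes M: "homology_cylinder S M"
begin

lemma plus_q_bij: "bij_betw (plus_q S q M) (carrier (nil_quot F q)) (carrier (nil_quot (FM S M) q))"
  using plus_q_iso[OF homology_cylinderD(1,2)[OF M]] by (simp add: iso_def)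

lemma plus_q_mu: "mu g n S q M k \<in> carrier (nil_quot F q)"
  "plus_q S q M (mu g n S q M k) = lcs (FM S M) q #>\<^bsub>FM S M\<^esub> all_longitudes g n S M k"
proof -
  interpret A: group "FM S M" by (rule group_FM[OF homology_cylinderD(1)[OF M]])
  have "lcs (FM S M) q #>\<^bsub>FM S M\<^esub> all_longitudes g n S M k \<in> plus_q S q M ` carrier (nil_quot F q)"
    using plus_q_bij longitude_closed[OF homology_cylinderD(1)[OF M]]
    by (auto simp: bij_betw_def carrier_FactGroup)
  then show "mu g n S q M k \<in> carrier (nil_quot F q)"
    "plus_q S q M (mu g n S q M k) = lcs (FM S M) q #>\<^bsub>FM S M\<^esub> all_longitudes g n S M k"
    unfolding mu_def by (rule inv_into_into, rule f_inv_into_f)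
qed

lemma plus_q_eta:
  assumes C: "C \<in> carrier (nil_quot F q)"
  shows "eta S q M C \<in> carrier (nil_quot F q)" "plus_q S q M (eta S q M C) = minus_q S q M C"
proof -
  have "minus_q S q M C \<in> carrier (nil_quot (FM S M) q)"
    unfolding minus_q_def
    using nil_quot_map_hom[OF hom_minus[OF homology_cylinderD(1)[OF M]]] C by (rule hom_in_carrier)
  then have "minus_q S q M C \<in> plus_q S q M ` carrier (nil_quot F q)"
    using plus_q_bij by (simp add: bij_betw_def)
  then show "eta S q M C \<in> carrier (nil_quot F q)" "plus_q S q M (eta S q M C) = minus_q S q M C"
    unfolding eta_def o_def by (rule inv_into_into, rule f_inv_into_f)
qed

end

text \<open>The cobordism \<open>W\<close> with the markings inherited from \<open>X\<close>, a space over which \<open>X\<close> and \<open>Y\<close> can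
  be compared.\<close>

lemma cobordism_marking:
  fixes X :: "('s, 'a) cylinder" and Y :: "('s, 'b) cylinder"
  assumes X: "marked S X" and Y: "homology_cylinder S Y" and cob: "homology_cobordant S X Y"
  obtains W :: "('s, nat \<Rightarrow> real) cylinder" and u v
  where "marked_map S X W u" "marked_map S Y W v" "inj_on (plus_q S q W) (carrier (nil_quot F q))"
proof -
  obtain W :: "(nat \<Rightarrow> real) topology" and e
    where e: "homeomorphic_map (glue (mfd X) (mfd Y) (cob_rel S X Y)) (boundary_space 4 W) e"
      and H: "homology_iso (mfd Y) W (e \<circ> glue_right (cob_rel S X Y))"
    using cob unfolding homology_cobordant_def Let_def by (elim exE conjE) (rule that)
  let ?R = "cob_rel S X Y"
  let ?l = "e \<circ> glue_left ?R" and ?r = "e \<circ> glue_right ?R"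
  have ce: "continuous_map (glue (mfd X) (mfd Y) ?R) W e"
    using homeomorphic_imp_continuous_map[OF e] by (rule continuous_map_into_fulltopology)
  have cl: "continuous_map (mfd X) W ?l" and cr: "continuous_map (mfd Y) W ?r"
    using continuous_map_compose[OF continuous_map_glue_left ce] continuous_map_compose[OF continuous_map_glue_right ce] .
  have lr: "?l (mk_plus X s) = ?r (mk_plus Y s)" "?l (mk_minus X s) = ?r (mk_minus Y s)" if "s \<in> topspace \<Sigma>" for s
  proof -
    have "(mk_plus X s, mk_plus Y s) \<in> ?R" "(mk_minus X s, mk_minus Y s) \<in> ?R"
      unfolding cob_rel_def using that by blast+
    then show "?l (mk_plus X s) = ?r (mk_plus Y s)" "?l (mk_minus X s) = ?r (mk_minus Y s)"
      by (simp_all add: glue_left_eq_right)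
  qed
  define Z :: "('s, nat \<Rightarrow> real) cylinder" where
    "Z = \<lparr>mfd = W, mfd_class = undefined, mk_plus = ?l \<circ> mk_plus X, mk_minus = ?l \<circ> mk_minus X\<rparr>"
  have Z: "mfd Z = W" "mk_plus Z = ?l \<circ> mk_plus X" "mk_minus Z = ?l \<circ> mk_minus X"
    by (simp_all add: Z_def)
  have mZ: "marked S Z"
    unfolding marked_def Z
    using continuous_map_compose[OF marked_continuous(1)[OF X] cl] continuous_map_compose[OF marked_continuous(2)[OF X] cl]
      marked_boundary[OF X] by simp
  note mY = homology_cylinderD(1)[OF Y]
  have u: "marked_map S X Z ?l"
    using X mZ cl by (simp add: marked_map_def Z)
  have v: "marked_map S Y Z ?r"
    using mY mZ cr lr by (simp add: marked_map_def Z)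
  \<comment> \<open>\<open>W\<close> is compared with the surface through \<open>Y\<close>; the
    other end \<open>X\<close> may be a product of cylinders, known only to be marked.\<close>
  have "homology_iso \<Sigma> W (?r \<circ> mk_plus Y)"
    by (rule homology_iso_compose[OF marked_continuous(1)[OF mY] cr homology_cylinderD(2)[OF Y] H])
  moreover have "hom_induced p \<Sigma> {} W {} (?r \<circ> mk_plus Y) = hom_induced p \<Sigma> {} W {} (mk_plus Z)" for p
    using lr by (intro hom_induced_eq) (simp add: Z)
  ultimately have "homology_iso \<Sigma> (mfd Z) (mk_plus Z)"
    unfolding homology_iso_def Z(1) by simp
  then have "inj_on (plus_q S q Z) (carrier (nil_quot F q))"
    using plus_q_iso[OF mZ] by (simp add: iso_def bij_betw_def)
  with u v show ?thesis by (rule that)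
qed

text \<open>Both \<open>C\<close> and the invariant of \<open>Y\<close> are sent to the longitude of
  \<open>W\<close>, where the plus marking is injective. A preimage \<open>C\<close> appears in
  place of \<open>mu\<close> of \<open>X\<close>, so that \<open>X\<close> may be a product.\<close>

lemma cobordant_mu:
  assumes "marked S X" "homology_cylinder S Y" "homology_cobordant S X Y" and C: "C \<in> carrier (nil_quot F q)"
    and eq: "plus_q S q X C = lcs (FM S X) q #>\<^bsub>FM S X\<^esub> all_longitudes g n S X k"
  shows "mu g n S q Y k = C"
proof -
  obtain W :: "('s, nat \<Rightarrow> real) cylinder" and u v where W: "marked_map S X W u" "marked_map S Y W v"
    "inj_on (plus_q S q W) (carrier (nil_quot F q))"
    by (rule cobordism_marking[OF assms(1-3)]) (rule that)
  have "plus_q S q W (mu g n S q Y k) = plus_q S q W C"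
    using marked_map_longitude_q[OF W(1)] marked_map_longitude_q[OF W(2)] eq plus_q_mu[OF assms(2)]
      marked_map_plus_q(1)[OF W(1) C] marked_map_plus_q(1)[OF W(2) plus_q_mu(1)[OF assms(2)]] by simp
  then show ?thesis
    using inj_onD[OF W(3)] plus_q_mu(1)[OF assms(2)] C by blast
qed

text \<open>Under the plus marking of \<open>W\<close> both values become the image of
  \<open>C\<close> under the minus marking.\<close>

lemma cobordant_eta:
  assumes X: "homology_cylinder S X" and "homology_cylinder S Y" "homology_cobordant S X Y"
    and C: "C \<in> carrier (nil_quot F q)"
  shows "eta S q Y C = eta S q X C"
proof -
  obtain W :: "('s, nat \<Rightarrow> real) cylinder" and u v where W: "marked_map S X W u" "marked_map S Y W v"
    "inj_on (plus_q S q W) (carrier (nil_quot F q))"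
    by (rule cobordism_marking[OF homology_cylinderD(1)[OF X] assms(2,3)]) (rule that)
  note eX = plus_q_eta[OF X C] and eY = plus_q_eta[OF assms(2) C]
  have "plus_q S q W (eta S q Y C) = plus_q S q W (eta S q X C)"
    using marked_map_plus_q[OF W(1)] marked_map_plus_q[OF W(2)] C eX eY by metis
  then show ?thesis
    using inj_onD[OF W(3)] eX(1) eY(1) by blast
qed

section \<open>The product of two homology cylinders\<close>

context
  fixes M :: "('s, 'a) cylinder" and N :: "('s, 'b) cylinder"
  assumes M: "homology_cylinder S M" and N: "homology_cylinder S N"
begin

abbreviation "R \<equiv> prod_rel S M N"
abbreviation "P \<equiv> cyl_prod S M N"

lemma prod_simps: "mfd P = glue (mfd M) (mfd N) R" "mk_plus P = glue_left R \<circ> mk_plus M" "mk_minus P = glue_right R \<circ> mk_minus N"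
  by (simp_all add: cyl_prod_def Let_def)

lemmas mM = homology_cylinderD(1)[OF M] and mN = homology_cylinderD(1)[OF N]

lemma glue_mark: "s \<in> topspace \<Sigma> \<Longrightarrow> glue_left R (mk_minus M s) = glue_right R (mk_plus N s)"
  by (rule glue_left_eq_right) (auto simp: prod_rel_def)

lemma continuous_l: "continuous_map (mfd M) (mfd P) (glue_left R)"
  and continuous_r: "continuous_map (mfd N) (mfd P) (glue_right R)"
  unfolding prod_simps by (rule continuous_map_glue_left continuous_map_glue_right)+

lemma bdry_topspace: "s \<in> mfd_boundary 2 \<Sigma> \<Longrightarrow> s \<in> topspace \<Sigma>"
  by (simp add: mfd_boundary_def)

lemma marked_prod: "marked S P"
  unfolding marked_def prod_simps(2,3)
  using continuous_map_compose[OF marked_continuous(1)[OF mM] continuous_l]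
    continuous_map_compose[OF marked_continuous(2)[OF mN] continuous_r]
    marked_boundary[OF mM] marked_boundary[OF mN] glue_mark bdry_topspace by simp

lemma base_l: "mk_plus P pt = glue_left R (mk_plus M pt)" and base_r: "mk_plus P pt = glue_right R (mk_plus N pt)"
  using glue_mark[OF pt(1)] marked_boundary[OF mM pt(2)] by (simp_all add: prod_simps)

lemma hom_l: "group_hom (FM S M) (FM S P) (pi1_map (mfd P) (glue_left R))"
  unfolding FM_def
  by (rule group_hom_pi1_map[OF continuous_l _ base_l])
    (use marked_continuous(1)[OF mM] pt(1) in \<open>auto simp: continuous_map_def\<close>)

lemma hom_r: "group_hom (FM S N) (FM S P) (pi1_map (mfd P) (glue_right R))"
  unfolding FM_def
  by (rule group_hom_pi1_map[OF continuous_r _ base_r])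
    (use marked_continuous(1)[OF mN] pt(1) in \<open>auto simp: continuous_map_def\<close>)

lemma prod_maps:
  assumes x: "x \<in> carrier F"
  shows "pi1_map (mfd P) (glue_left R) (pi1_map (mfd M) (mk_plus M) x) = pi1_map (mfd P) (mk_plus P) x"
    and "pi1_map (mfd P) (glue_right R) (pi1_map (mfd N) (mk_minus N) x) = pi1_map (mfd P) (mk_minus P) x"
    and "pi1_map (mfd P) (glue_left R) (pi1_map (mfd M) (mk_minus M) x)
      = pi1_map (mfd P) (glue_right R) (pi1_map (mfd N) (mk_plus N) x)"
proof -
  note x' = x[unfolded FS_def]
  note c = marked_continuous[OF mM] marked_continuous[OF mN]
  show "pi1_map (mfd P) (glue_left R) (pi1_map (mfd M) (mk_plus M) x) = pi1_map (mfd P) (mk_plus P) x"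
    unfolding pi1_map_comp[OF x' c(1) continuous_l] prod_simps(2) ..
  show "pi1_map (mfd P) (glue_right R) (pi1_map (mfd N) (mk_minus N) x) = pi1_map (mfd P) (mk_minus P) x"
    unfolding pi1_map_comp[OF x' c(4) continuous_r] prod_simps(3) ..
  show "pi1_map (mfd P) (glue_left R) (pi1_map (mfd M) (mk_minus M) x)
      = pi1_map (mfd P) (glue_right R) (pi1_map (mfd N) (mk_plus N) x)"
    unfolding pi1_map_comp[OF x' c(2) continuous_l] pi1_map_comp[OF x' c(3) continuous_r]
    using glue_mark by (intro pi1_map_cong[OF x' continuous_map_compose[OF c(2) continuous_l]]) simp
qed

text \<open>The middle surface carries both \<open>i_-\<close> and \<open>j_+\<close>. The strand
  along it is run back by the first factor and forth by the second, and cancels.\<close>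

lemma longitude_prod:
  "all_longitudes g n S P k = pi1_map (mfd P) (glue_left R) (all_longitudes g n S M k)
     \<otimes>\<^bsub>FM S P\<^esub> pi1_map (mfd P) (glue_right R) (all_longitudes g n S N k)"
proof (cases "k \<le> n - 1")
  case True
  let ?a = "alpha S k"
  \<comment> \<open>\<open>?s\<close> is the middle strand, on which \<open>i_-\<close> of the first
    cylinder and \<open>j_+\<close> of the second coincide; \<open>?p\<close> and \<open>?t\<close>
    are the outer ones.\<close>
  let ?p = "glue_left R \<circ> (mk_plus M \<circ> ?a)" and ?s = "glue_left R \<circ> (mk_minus M \<circ> ?a)"
    and ?t = "glue_right R \<circ> (mk_minus N \<circ> reverse_path ?a)"
  let ?pM = "join_path (mk_plus M \<circ> ?a) (mk_minus M \<circ> reverse_path ?a)"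
  let ?pN = "join_path (mk_plus N \<circ> ?a) (mk_minus N \<circ> reverse_path ?a)"
  note pM = path_betweenD(1)[OF path_between_join[OF longitude_path[OF mM True]]]
    and pN = path_betweenD(1)[OF path_between_join[OF longitude_path[OF mN True]]]
  have aS: "?a t \<in> topspace \<Sigma>" if "t \<in> {0..1}" for t
    using path_image_subset_topspace[OF path_betweenD(1)[OF alpha(1)[OF True]]] that by blast
  have a: "pathin \<Sigma> ?a" and ra: "pathin \<Sigma> (reverse_path ?a)"
    using path_betweenD(1)[OF alpha(1)[OF True]] by (simp_all add: pathin_reverse)
  have ps: "pathin (mfd P) ?p" "pathin (mfd P) ?s" "pathin (mfd P) ?t"
    using a ra marked_continuous[OF mM] marked_continuous[OF mN] continuous_l continuous_r
    by (auto intro!: pathin_compose)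
  have a0: "?a 0 = pt" using path_betweenD(2)[OF alpha(1)[OF True]] .
  have e: "?p 1 = ?s 1" "?p 0 = ?s 0" "?t 0 = ?s 1" "?t 1 = ?s 0"
    using marked_boundary[OF mM alpha(2)[OF True]] marked_boundary[OF mN alpha(2)[OF True]]
      glue_mark[OF aS[of 1]] marked_boundary[OF mM pt(2)] marked_boundary[OF mN pt(2)] glue_mark[OF pt(1)]
    by (simp_all add: a0)
  have lM: "glue_left R \<circ> ?pM = join_path ?p (reverse_path ?s)"
    by (simp add: comp_join_path comp_reverse_path o_assoc)
  have rN: "path_homotopic (mfd P) (glue_right R \<circ> ?pN) (join_path ?s ?t)"
    using pathin_compose[OF pN continuous_r] glue_mark aS
    by (intro path_homotopic_eq) (auto simp: join_path_def)
  have "path_homotopic (mfd P) (join_path (join_path ?p (reverse_path ?s)) (join_path ?s ?t))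
      (join_path ?p (join_path (reverse_path ?s) (join_path ?s ?t)))"
    using ps e by (intro join_path_assoc pathin_reverse pathin_join) simp_all
  also have "path_homotopic (mfd P) \<dots> (join_path ?p ?t)"
    using ps e by (intro path_homotopic_join[OF path_homotopic_refl[OF ps(1)]] join_path_cancel) simp_all
  finally have "path_class (mfd P) (join_path ?p ?t) =
      path_class (mfd P) (join_path (join_path ?p (reverse_path ?s)) (join_path ?s ?t))"
    using path_class_eqI by metis
  also have "\<dots> = path_class (mfd P) (join_path ?p (reverse_path ?s)) \<otimes>\<^bsub>FM S P\<^esub> path_class (mfd P) (join_path ?s ?t)"
    unfolding FM_def using ps e by (intro mult_pi1[symmetric] pathin_join pathin_reverse) simp_all
  also have "path_class (mfd P) (join_path ?p (reverse_path ?s)) = pi1_map (mfd P) (glue_left R) (path_class (mfd M) ?pM)"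
    using pi1_map_path_class[OF pM continuous_l] lM by simp
  also have "path_class (mfd P) (join_path ?s ?t) = pi1_map (mfd P) (glue_right R) (path_class (mfd N) ?pN)"
    using pi1_map_path_class[OF pN continuous_r] path_class_eqI[OF rN] by simp
  finally show ?thesis
    unfolding all_longitudes_eq bdry_longitude_def prod_simps(2,3) comp_assoc if_P[OF True] .
next
  case False
  interpret pM: group_hom F "FM S M" "pi1_map (mfd M) (mk_plus M)" by (rule hom_plus[OF mM])
  interpret mM: group_hom F "FM S M" "pi1_map (mfd M) (mk_minus M)" by (rule hom_minus[OF mM])
  interpret pN: group_hom F "FM S N" "pi1_map (mfd N) (mk_plus N)" by (rule hom_plus[OF mN])
  interpret mN: group_hom F "FM S N" "pi1_map (mfd N) (mk_minus N)" by (rule hom_minus[OF mN])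
  interpret pP: group_hom F "FM S P" "pi1_map (mfd P) (mk_plus P)" by (rule hom_plus[OF marked_prod])
  interpret mP: group_hom F "FM S P" "pi1_map (mfd P) (mk_minus P)" by (rule hom_minus[OF marked_prod])
  interpret l: group_hom "FM S M" "FM S P" "pi1_map (mfd P) (glue_left R)" by (rule hom_l)
  interpret r: group_hom "FM S N" "FM S P" "pi1_map (mfd P) (glue_right R)" by (rule hom_r)
  let ?x = "std_gen g n S k"
  let ?w = "pi1_map (mfd P) (glue_right R) (pi1_map (mfd N) (mk_plus N) ?x)"
  note x = std_gen_closed
  have w: "?w \<in> carrier (FM S P)" using x by simp
  have w': "pi1_map (mfd P) (glue_left R) (pi1_map (mfd M) (mk_minus M) (inv\<^bsub>F\<^esub> ?x)) = inv\<^bsub>FM S P\<^esub> ?w"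
    using prod_maps(3)[of "inv\<^bsub>F\<^esub> ?x"] x by simp
  have "pi1_map (mfd P) (glue_left R) (difference_loop S M ?x) = pi1_map (mfd P) (mk_plus P) ?x \<otimes>\<^bsub>FM S P\<^esub> inv\<^bsub>FM S P\<^esub> ?w"
    unfolding difference_loop_def using x w' by (simp add: prod_maps(1) del: mM.hom_inv)
  moreover have "pi1_map (mfd P) (glue_right R) (difference_loop S N ?x) = ?w \<otimes>\<^bsub>FM S P\<^esub> pi1_map (mfd P) (mk_minus P) (inv\<^bsub>F\<^esub> ?x)"
    unfolding difference_loop_def using x by (simp add: prod_maps(2) del: mN.hom_inv mP.hom_inv)
  ultimately show ?thesis
    using False x w by (simp add: all_longitudes_eq difference_loop_def pP.H.m_assoc pP.H.cancel_left del: mP.hom_inv)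
qed

text \<open>For the second factor, modulo the q-th terms:
  \<open>l_* i_+ \<eta>(M) = l_* i_- = r_* j_+\<close>, and \<open>j_+\<close> takes the invariant
  of \<open>N\<close> to its longitude.\<close>

lemma plus_q_prod:
  defines "C \<equiv> mu g n S q M k \<otimes>\<^bsub>nil_quot F q\<^esub> eta S q M (mu g n S q N k)"
  shows "C \<in> carrier (nil_quot F q)" "plus_q S q P C = lcs (FM S P) q #>\<^bsub>FM S P\<^esub> all_longitudes g n S P k"
proof -
  let ?A = "FM S M" and ?B = "FM S N" and ?G = "FM S P"
  let ?m = "mu g n S q M k" and ?m' = "mu g n S q N k"
  let ?e = "eta S q M ?m'"
  interpret Q: group "nil_quot F q" by (rule F.group_nil_quot)
  interpret l: group_hom ?A ?G "pi1_map (mfd P) (glue_left R)" by (rule hom_l)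
  interpret r: group_hom ?B ?G "pi1_map (mfd P) (glue_right R)" by (rule hom_r)
  interpret N: normal "lcs ?G q" ?G by (rule l.H.lcs_normal)
  note mu = plus_q_mu[OF M] and mu' = plus_q_mu[OF N]
  note e = plus_q_eta[OF M mu'(1)]
  show "C \<in> carrier (nil_quot F q)"
    unfolding C_def using mu(1) e(1) by (rule Q.m_closed)
  have lq: "nil_quot_map ?G q (pi1_map (mfd P) (glue_left R)) (plus_q S q M D) = plus_q S q P D"
    if "D \<in> carrier (nil_quot F q)" for D
    unfolding plus_q_def by (rule nil_quot_map_comp[OF hom_plus[OF mM] hom_l hom_plus[OF marked_prod] that prod_maps(1)])
  have hw: "group_hom F ?G (\<lambda>x. pi1_map (mfd P) (glue_right R) (pi1_map (mfd N) (mk_plus N) x))"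
    using hom_compose[OF group_hom.homh[OF hom_plus[OF mN]] r.homh] F.is_group l.H.is_group
    by (simp add: group_hom_def group_hom_axioms_def o_def)
  have lrq: "nil_quot_map ?G q (pi1_map (mfd P) (glue_left R)) (minus_q S q M D)
      = nil_quot_map ?G q (pi1_map (mfd P) (glue_right R)) (plus_q S q N D)"
    if "D \<in> carrier (nil_quot F q)" for D
    unfolding plus_q_def minus_q_def
    using nil_quot_map_comp[OF hom_minus[OF mM] hom_l hw that prod_maps(3)]
      nil_quot_map_comp[OF hom_plus[OF mN] hom_r hw that] by simp
  have "plus_q S q P C = plus_q S q P ?m \<otimes>\<^bsub>nil_quot ?G q\<^esub> plus_q S q P ?e"
    unfolding C_def plus_q_def using nil_quot_map_hom[OF hom_plus[OF marked_prod]] mu(1) e(1) by (rule hom_mult)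
  also have "plus_q S q P ?m = lcs ?G q #>\<^bsub>?G\<^esub> pi1_map (mfd P) (glue_left R) (all_longitudes g n S M k)"
    using lq[OF mu(1)] mu(2) nil_quot_map_coset[OF hom_l longitude_closed[OF mM]] by simp
  also have "plus_q S q P ?e = lcs ?G q #>\<^bsub>?G\<^esub> pi1_map (mfd P) (glue_right R) (all_longitudes g n S N k)"
    using lq[OF e(1)] e(2) lrq[OF mu'(1)] mu'(2) nil_quot_map_coset[OF hom_r longitude_closed[OF mN]] by simp
  finally show "plus_q S q P C = lcs ?G q #>\<^bsub>?G\<^esub> all_longitudes g n S P k"
    using N.rcos_sum[of "pi1_map (mfd P) (glue_left R) (all_longitudes g n S M k)"
        "pi1_map (mfd P) (glue_right R) (all_longitudes g n S N k)"]
      longitude_closed[OF mM] longitude_closed[OF mN] longitude_prod by simp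
qed

text \<open>The quotient map of \<open>\<pi>\<^sub>1(M)\<close> extends to the product, since by Stallings' theorem the map
  \<open>i\<^sub>-\<close> into \<open>\<pi>\<^sub>1(M) / \<pi>\<^sub>1(M)\<^sub>q\<close> factors through \<open>j\<^sub>+\<close>.\<close>

lemma prod_retraction:
  obtains \<rho> where "\<rho> \<in> hom (FM S P) (nil_quot (FM S M) q)"
    "\<And>a. a \<in> carrier (FM S M) \<Longrightarrow> \<rho> (pi1_map (mfd P) (glue_left R) a) = lcs (FM S M) q #>\<^bsub>FM S M\<^esub> a"
proof -
  let ?A = "FM S M" and ?B = "FM S N"
  interpret A: group ?A by (rule group_FM[OF mM])
  interpret Q: group "nil_quot ?A q" by (rule A.group_nil_quot)
  note HM = homology_cylinderD[OF M] and HN = homology_cylinderD[OF N]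
  have pcM: "path_connected_space (mfd M)" and pcN: "path_connected_space (mfd N)"
    using homology_iso_path_connected[OF HM(2) pc_S] homology_iso_path_connected[OF HN(2) pc_S] .
  have bM: "mk_plus M pt = mk_minus M pt" using marked_boundary[OF mM pt(2)] .
  have tM: "mk_minus M pt \<in> topspace (mfd M)" and tN: "mk_plus N pt \<in> topspace (mfd N)"
    using marked_continuous(2)[OF mM] marked_continuous(1)[OF mN] pt(1) by (auto simp: continuous_map_def)
  have A_eq: "?A = pi1 (mfd M) (mk_minus M pt)" by (simp add: FM_def bM)
  have i_minus: "pi1_map (mfd M) (mk_minus M) \<in> hom (pi1 \<Sigma> pt) ?A"
    using group_hom.homh[OF hom_minus[OF mM]] by (simp add: FS_def)
  obtain \<psi> where \<psi>: "\<psi> \<in> hom (pi1 (mfd N) (mk_plus N pt)) (nil_quot ?A q)"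
    "\<And>x. x \<in> carrier (pi1 \<Sigma> pt) \<Longrightarrow> \<psi> (pi1_map (mfd N) (mk_plus N) x) = lcs ?A q #>\<^bsub>?A\<^esub> pi1_map (mfd M) (mk_minus M) x"
    using stallings_extension[OF marked_continuous(1)[OF mN] HN(2) pc_S pcN pt(1) refl A.is_group i_minus q] by blast
  \<comment> \<open>One family of paths on the surface is pushed into both cylinders, so that
    \<open>\<Phi>\<close> and \<open>\<Psi>\<close> agree on all paths in the seam and not only on
    loops at the base point.\<close>
  obtain d where d: "based_paths \<Sigma> pt d" by (rule based_pathsE[OF pc_S pt(1)])
  obtain c where c: "based_paths (mfd M) (mk_minus M pt) c" "\<And>t. t \<in> topspace \<Sigma> \<Longrightarrow> c (mk_minus M t) = mk_minus M \<circ> d t"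
    by (rule based_paths_along[OF d pt(1) HM(5) pcM]) (rule that)
  obtain c' where c': "based_paths (mfd N) (mk_plus N pt) c'" "\<And>t. t \<in> topspace \<Sigma> \<Longrightarrow> c' (mk_plus N t) = mk_plus N \<circ> d t"
    by (rule based_paths_along[OF d pt(1) HN(4) pcN]) (rule that)
  have \<phi>: "(\<lambda>a. lcs ?A q #>\<^bsub>?A\<^esub> a) \<in> hom (pi1 (mfd M) (mk_minus M pt)) (nil_quot ?A q)"
    using A.coset_hom[of q] unfolding A_eq[symmetric] .
  define \<Phi> where "\<Phi> p = lcs ?A q #>\<^bsub>?A\<^esub> path_class (mfd M) (join_path (c (p 0)) (join_path p (reverse_path (c (p 1)))))" for p
  define \<Psi> where "\<Psi> p = \<psi> (path_class (mfd N) (join_path (c' (p 0)) (join_path p (reverse_path (c' (p 1))))))" for p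
  have func_M: "path_functor (mfd M) (nil_quot ?A q) \<Phi>"
    "\<And>p. path_between (mfd M) (mk_minus M pt) (mk_minus M pt) p \<Longrightarrow> \<Phi> p = lcs ?A q #>\<^bsub>?A\<^esub> path_class (mfd M) p"
    unfolding \<Phi>_def using hom_imp_path_functor[OF tM Q.is_group \<phi> c(1)] by blast+
  have func_N: "path_functor (mfd N) (nil_quot ?A q) \<Psi>"
    unfolding \<Psi>_def by (rule hom_imp_path_functor(1)[OF tN Q.is_group \<psi>(1) c'(1)])
  have agree: "\<Phi> (mk_minus M \<circ> p) = \<Psi> (mk_plus N \<circ> p)" if p: "pathin \<Sigma> p" for p
  proof -
    let ?J = "join_path (d (p 0)) (join_path p (reverse_path (d (p 1))))"
    note J = based_loop[OF d p]
    note e = path_start_in_topspace[OF p] path_finish_in_topspace[OF p]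
    have "\<Phi> (mk_minus M \<circ> p) = lcs ?A q #>\<^bsub>?A\<^esub> path_class (mfd M) (mk_minus M \<circ> ?J)"
      by (simp add: \<Phi>_def c(2) e comp_join_path comp_reverse_path)
    also have "\<dots> = \<psi> (path_class (mfd N) (mk_plus N \<circ> ?J))"
      using \<psi>(2)[OF path_class_in_pi1[OF J]] pi1_map_path_class[OF path_betweenD(1)[OF J] marked_continuous(2)[OF mM]]
        pi1_map_path_class[OF path_betweenD(1)[OF J] marked_continuous(1)[OF mN]] by simp
    also have "\<dots> = \<Psi> (mk_plus N \<circ> p)"
      by (simp add: \<Psi>_def c'(2) e comp_join_path comp_reverse_path)
    finally show ?thesis .
  qed
  have closed: "closedin (mfd Z) (f ` topspace \<Sigma>)"
    if "compact_manifold 3 (mfd Z)" "continuous_map \<Sigma> (mfd Z) f" for Z :: "('s, 'z) cylinder" and f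
  proof (rule compactin_imp_closedin)
    show "Hausdorff_space (mfd Z)" using that(1) by (simp add: compact_manifold_def)
    have "compactin \<Sigma> (topspace \<Sigma>)" using mfd_S by (simp add: compact_manifold_def compact_space_def)
    then show "compactin (mfd Z) (f ` topspace \<Sigma>)" using that(2) by (rule image_compactin)
  qed
  interpret glued_functors "nil_quot ?A q" "mfd M" "mfd N" \<Sigma> "mk_minus M" "mk_plus N" R \<Phi> \<Psi>
  proof
    show "prod_rel S M N = {(mk_minus M t, mk_plus N t) | t. t \<in> topspace \<Sigma>}" by (simp add: prod_rel_def)
    show "embedding_map \<Sigma> (mfd M) (mk_minus M)" "embedding_map \<Sigma> (mfd N) (mk_plus N)"
      using HM(5) HN(4) .
    show "closedin (mfd M) (mk_minus M ` topspace \<Sigma>)" "closedin (mfd N) (mk_plus N ` topspace \<Sigma>)"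
      using closed[OF HM(3) marked_continuous(2)[OF mM]] closed[OF HN(3) marked_continuous(1)[OF mN]] .
    show "locally_simply_connected (mfd M)" "locally_simply_connected (mfd N)"
      using compact_manifold_locally_simply_connected HM(3) HN(3) by blast+
    show "locally_path_connected_space \<Sigma>"
      using locally_simply_connected_imp_locally_path_connected[OF lsc_S] .
  qed (use func_M(1) func_N agree in blast)+
  obtain \<rho> where \<rho>: "\<rho> \<in> hom (pi1 (mfd P) (mk_plus P pt)) (nil_quot ?A q)"
    "\<And>p. path_between (mfd P) (mk_plus P pt) (mk_plus P pt) p \<Longrightarrow> \<rho> (path_class (mfd P) p) = transport p"
    using path_functor_imp_hom[OF path_functor_transport, of "mk_plus P pt"] unfolding prod_simps(1) by blast
  have "\<rho> (pi1_map (mfd P) (glue_left R) a) = lcs ?A q #>\<^bsub>?A\<^esub> a" if a: "a \<in> carrier ?A" for a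
  proof -
    obtain p where p: "path_between (mfd M) (mk_minus M pt) (mk_minus M pt) p" "a = path_class (mfd M) p"
      using a unfolding A_eq by (rule pi1_E)
    have "path_between (mfd P) (mk_plus P pt) (mk_plus P pt) (glue_left R \<circ> p)"
      using path_between_image[OF p(1) continuous_l] base_l bM by simp
    then have "\<rho> (path_class (mfd P) (glue_left R \<circ> p)) = \<Phi> p"
      using \<rho>(2) transport_left[OF path_betweenD(1)[OF p(1)]] by simp
    then show ?thesis
      using func_M(2)[OF p(1)] p(2) pi1_map_path_class[OF path_betweenD(1)[OF p(1)] continuous_l] by simp
  qed
  with \<rho>(1) show ?thesis
    using that by (simp add: FM_def)
qed

text \<open>The retraction \<open>\<rho>\<close> kills the q-th lower central term, so equality
  under the plus marking of the product descends to equality under that of \<open>M\<close>, where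
  Stallings' theorem applies.\<close>

lemma plus_q_prod_inj: "inj_on (plus_q S q P) (carrier (nil_quot F q))"
proof (rule inj_onI)
  let ?A = "FM S M" and ?G = "FM S P"
  fix C D assume CD: "C \<in> carrier (nil_quot F q)" "D \<in> carrier (nil_quot F q)" and eq: "plus_q S q P C = plus_q S q P D"
  obtain \<rho> where \<rho>: "\<rho> \<in> hom ?G (nil_quot ?A q)"
    "\<And>a. a \<in> carrier ?A \<Longrightarrow> \<rho> (pi1_map (mfd P) (glue_left R) a) = lcs ?A q #>\<^bsub>?A\<^esub> a"
    by (rule prod_retraction) (rule that)
  interpret A: group ?A by (rule group_FM[OF mM])
  interpret G: group ?G by (rule group_FM[OF marked_prod])
  interpret \<rho>: group_hom ?G "nil_quot ?A q" \<rho>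
    using \<rho>(1) G.is_group A.group_nil_quot by (simp add: group_hom_def group_hom_axioms_def)
  interpret p: group_hom F ?A "pi1_map (mfd M) (mk_plus M)" by (rule hom_plus[OF mM])
  interpret pP: group_hom F ?G "pi1_map (mfd P) (mk_plus P)" by (rule hom_plus[OF marked_prod])
  obtain x y where xy: "x \<in> carrier F" "C = lcs F q #>\<^bsub>F\<^esub> x" "y \<in> carrier F" "D = lcs F q #>\<^bsub>F\<^esub> y"
    using CD by (auto simp: carrier_FactGroup)
  have "lcs ?G q #>\<^bsub>?G\<^esub> pi1_map (mfd P) (mk_plus P) x = lcs ?G q #>\<^bsub>?G\<^esub> pi1_map (mfd P) (mk_plus P) y"
    using eq xy unfolding plus_q_def by (simp add: nil_quot_map_coset[OF pP.group_hom_axioms])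
  then obtain z where z: "z \<in> lcs ?G q" "pi1_map (mfd P) (mk_plus P) x = z \<otimes>\<^bsub>?G\<^esub> pi1_map (mfd P) (mk_plus P) y"
    using G.coset_eq_iff[OF G.lcs_normal] xy by auto
  have "\<rho> z = \<one>\<^bsub>nil_quot ?A q\<^esub>"
    using hom_lcs[OF \<rho>.group_hom_axioms z(1)] A.lcs_nil_quot by blast
  then have "\<rho> (pi1_map (mfd P) (mk_plus P) x) = \<rho> (pi1_map (mfd P) (mk_plus P) y)"
    using z xy G.lcs_closed[OF z(1)] by (simp del: one_FactGroup mult_FactGroup)
  then have "plus_q S q M C = plus_q S q M D"
    using \<rho>(2)[OF p.hom_closed[OF xy(1)]] \<rho>(2)[OF p.hom_closed[OF xy(3)]] xy prod_maps(1)[OF xy(1)] prod_maps(1)[OF xy(3)]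
      nil_quot_map_coset[OF p.group_hom_axioms xy(1)] nil_quot_map_coset[OF p.group_hom_axioms xy(3)]
    unfolding plus_q_def by metis
  then show "C = D"
    using plus_q_bij[OF M] CD unfolding bij_betw_def inj_on_def by blast
qed

lemma mu_prod: "mu g n S q P k = mu g n S q M k \<otimes>\<^bsub>nil_quot F q\<^esub> eta S q M (mu g n S q N k)"
  using inv_into_f_f[OF plus_q_prod_inj plus_q_prod(1)] plus_q_prod(2) unfolding mu_def[of g n S q P k] by metis

end

section \<open>Passage to classes of homology cylinders\<close>

lemma mu_hcob:
  assumes c: "c \<in> hcob_classes S" "M \<in> c" "M' \<in> c"
  shows "homology_cylinder S M" "mu g n S q M k = mu g n S q M' k"
    "C \<in> carrier (nil_quot F q) \<Longrightarrow> eta S q M C = eta S q M' C"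
proof -
  \<comment> \<open>A class is the set of cylinders to which one fixed \<open>M0\<close> is
    cobordant; any two members are compared through \<open>M0\<close>.\<close>
  obtain M0 :: "('s, nat \<Rightarrow> real) cylinder" where M0: "homology_cylinder S M0"
    "\<And>N. N \<in> c \<Longrightarrow> homology_cylinder S N \<and> homology_cobordant S M0 N"
  proof -
    from c(1) obtain M0 :: "('s, nat \<Rightarrow> real) cylinder" where "homology_cylinder S M0"
      "c = {(M, N). homology_cylinder S M \<and> homology_cylinder S N \<and> homology_cobordant S M N} `` {M0}"
      unfolding hcob_classes_def by (elim quotientE) (simp only: mem_Collect_eq)
    then show ?thesis by (intro that[of M0]) simp_all
  qed
  have mu: "mu g n S q N k = mu g n S q M0 k" if "N \<in> c" for N
    using cobordant_mu[OF homology_cylinderD(1)[OF M0(1)] _ _ plus_q_mu[OF M0(1)]] M0(2)[OF that] by blast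
  have eta: "eta S q N C = eta S q M0 C" if "N \<in> c" "C \<in> carrier (nil_quot F q)" for N
    using cobordant_eta[OF M0(1)] M0(2)[OF that(1)] that(2) by blast
  show "homology_cylinder S M" using M0(2)[OF c(2)] by blast
  show "mu g n S q M k = mu g n S q M' k" using mu[OF c(2)] mu[OF c(3)] by simp
  show "eta S q M C = eta S q M' C" if "C \<in> carrier (nil_quot F q)"
    using eta[OF c(2) that] eta[OF c(3) that] by simp
qed

end

theorem proposition3p7:
  fixes S :: "'s marked_surface"
    and M :: "('s, 'a) cylinder" and N :: "('s, 'b) cylinder"
    and g n q k :: nat
  assumes "1 \<le> n" and "standard_surface g n S"
    and "homology_cylinder S M" and "homology_cylinder S N"
    and "1 \<le> q" and "k \<in> {1..2 * g + n - 1}"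
  shows "mu g n S q (cyl_prod S M N) k =
           mu g n S q M k \<otimes>\<^bsub>nil_quot (FS S) q\<^esub> eta S q M (mu g n S q N k) \<and>
         (\<forall>c\<in>hcob_classes S. \<forall>d\<in>hcob_classes S.
            \<forall>M'\<in>c. \<forall>N'\<in>d. \<forall>P\<in>hcob_mult S c d.
              mu g n S q P k =
                mu g n S q M' k \<otimes>\<^bsub>nil_quot (FS S) q\<^esub> eta S q M' (mu g n S q N' k))"
proof -
  interpret standard S g n q k
    using assms by unfold_locales
  have "mu g n S q P k = mu g n S q M' k \<otimes>\<^bsub>nil_quot (FS S) q\<^esub> eta S q M' (mu g n S q N' k)"
    if c: "c \<in> hcob_classes S" "M' \<in> c" and d: "d \<in> hcob_classes S" "N' \<in> d" and P: "P \<in> hcob_mult S c d"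
    for c d M' N' P
  proof -
    obtain M0 N0 where M0: "M0 \<in> c" and N0: "N0 \<in> d" and cob: "homology_cobordant S (cyl_prod S M0 N0) P"
      and hP: "homology_cylinder S P"
      using P unfolding hcob_mult_def by blast
    have hM: "homology_cylinder S M0" "homology_cylinder S N0"
      using mu_hcob(1)[OF c(1) M0 c(2)] mu_hcob(1)[OF d(1) N0 d(2)] .
    \<comment> \<open>\<open>plus_q_prod\<close> provides a preimage of the longitude in the product
      of the representatives \<open>M0\<close> and \<open>N0\<close>, and the cobordism carries it
      to \<open>P\<close>; afterwards \<open>mu_hcob\<close> exchanges the representatives for
      \<open>M'\<close> and \<open>N'\<close>.\<close>
    have "mu g n S q P k = mu g n S q M0 k \<otimes>\<^bsub>nil_quot (FS S) q\<^esub> eta S q M0 (mu g n S q N0 k)"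
      using cobordant_mu[OF marked_prod[OF hM] hP cob plus_q_prod[OF hM]] .
    then show ?thesis
      using mu_hcob(2)[OF c(1) M0 c(2)] mu_hcob(2)[OF d(1) N0 d(2)] mu_hcob(3)[OF c(1) M0 c(2) plus_q_mu(1)[OF hM(2)]]
      by simp
  qed
  then show ?thesis
    using mu_prod[OF assms(3,4)] by blast
qed

end
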